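(* Suppose $-1<q,t<1$. Let $\mathcal{M}_{q,t}$ be the set of extreme points of the convex set $\mathcal{H}_{q,t}$ of non-negative normalized harmonic functions on the Young graph with Macdonald multiplicities, and for $f\in\mathcal{H}_{q,t}$ let $\widetilde f:\Lambda\to\mathbb{R}$ be the linear functional with $\widetilde f(Q_\mu)=f(\mu)$ for every partition $\mu$. Then $$\big\{\widetilde f \mid f\in\mathcal{M}_{q,t}\big\}=\Big\{\text{homomorphisms }\theta:\Lambda\to\mathbb{R}\ \Big|\ \theta\Big(\frac{1-t}{1-q}h_1\Big)=1\ \text{ and }\ \theta(Q_\mu)\ge0\ \text{for every partition }\mu\Big\}.$$
   Context: $\Lambda$ is the algebra over $\mathbb{R}$ of symmetric power series of bounded degree in countably many variables $x_1,x_2,\dots$; homomorphisms $\Lambda\to\mathbb{R}$ are unital $\mathbb{R}$-algebra homomorphisms; $h_1=\sum_{i\ge1}x_i$. Partitions: a partition $\lambda$ is a finite non-increasing sequence of positive integers $\lambda_1\ge\dots\ge\lambda_\ell$ (the empty partition $\emptyset$ is allowed), $\lambda_i=0$ for $i>\ell=\ell(\lambda)$, $|\lambda|=\sum_i\lambda_i$. It is identified with its Young diagram, the set of boxes $(i,j)$ with $1\le i\le\ell(\lambda)$, $1\le j\le\lambda_i$ ($i$ = row, $j$ = column); $\lambda'_j$ is the length of the $j$-th column. $\mu\subset\lambda$ means containment of diagrams; $\mu\nearrow\lambda$ means that $\lambda$ is obtained from $\mu$ by adding one box. Write $\mu\prec_{\mathsf h}\lambda$ if $\mu\subset\lambda$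 and $\lambda\setminus\mu$ has at most one box in each column (horizontal strip). For a box $s=(i,j)\in\lambda$ put $b_\lambda(s)=\dfrac{1-q^{\lambda_i-j}t^{\lambda'_j-i+1}}{1-q^{\lambda_i-j+1}t^{\lambda'_j-i}}$ (with $0^0=1$), and $b_\lambda(s)=1$ if $s\notin\lambda$. For $\mu\subset\lambda$ let $R_{\lambda/\mu}$ (resp. $C_{\lambda/\mu}$) be the union of all rows (resp. columns) containing boxes of $\lambda\setminus\mu$. For $\mu\prec_{\mathsf h}\lambda$ put $$\psi_{\lambda/\mu}=\psi_{\lambda/\mu}(q,t)=\prod_{s\in R_{\lambda/\mu}- C_{\lambda/\mu}} \frac{b_\mu(s)}{b_\lambda(s)},\qquad \phi_{\lambda/\mu}=\prod_{s\in C_{\lambda/\mu}}\frac{b_\lambda(s)}{b_\mu(s)}.$$ A semistandard tableau $T$ of shape $\lambda$ is a filling of the boxes of $\lambda$ with positive integers, weakly increasing along rows and strictly increasing down columns; $T_i$ is the partition formed by the boxes with entries $\le i$ ($T_0=\emptyset$). Put $\phi(T)=\prod_{i\ge1}\phi_{T_i/T_{i-1}}$ and $x^T=\prod_{i\ge1}x_i^{|T_i|-|T_{i-1}|}$. The Macdonald symmetric function is $Q_\lambda=Q_\lambda(x;q,t)=\sum_T\phi(T)x^T$, the sum being over all semistandard tableaux of shape $\lambda$; the $Q_\lambda$ form an $\mathbb{R}$-basis of $\Lambda$. $\mathcal{H}_{q,t}$ is the set of functions $f:\{\text{partitions}\}\to\mathbb{R}_{\ge0}$ such that $f(\emptyset)=1$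 and $f(\mu)=\sum_{\lambda:\ \mu\nearrow\lambda}\psi_{\lambda/\mu}(q,t)f(\lambda)$ for every partition $\mu$. It is a convex set. *)

theory Defs
  imports "HOL-Analysis.Analysis" "HOL-Library.Multiset" "HOL-Library.Function_Algebras"
begin

section \<open>Real-valued functions as a vector space\<close>

instantiation "fun" :: (type, real_vector) real_vector
begin

definition "c *\<^sub>R f = (\<lambda>x. c *\<^sub>R f x)"

instance
  by standard (auto simp: scaleR_fun_def fun_eq_iff algebra_simps)

end


section \<open>Power series in countably many variables\<close>

text \<open>
  The variables are indexed from 0: index i stands for the variable usually written with
  subscript i + 1. A monomial is the multiset of the indices of its variables, so that
  multiplication of monomials is addition of multisets and the total degree is the size.
\<close>

typedef mpowser = "UNIV :: (nat multiset \<Rightarrow> real) set"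
  morphisms mcoeff Abs_mpowser
  by simp

lemma mcoeff_Abs [simp]: "mcoeff (Abs_mpowser f) = f"
  by (simp add: Abs_mpowser_inverse)

lemma mpowser_eqI: "(\<And>M. mcoeff F M = mcoeff G M) \<Longrightarrow> F = G"
  by (metis ext mcoeff_inject)

lemma finite_subset_mset_Collect: "finite {A :: 'a multiset. A \<subseteq># M}"
proof (induction M)
  case empty
  then show ?case by simp
next
  case (add x M)
  have "{A. A \<subseteq># add_mset x M} \<subseteq> {A. A \<subseteq># M} \<union> add_mset x ` {A. A \<subseteq># M}"
  proof
    fix A assume "A \<in> {A. A \<subseteq># add_mset x M}"
    then have A: "A \<subseteq># add_mset x M" by simp
    show "A \<in> {A. A \<subseteq># M} \<union> add_mset x ` {A. A \<subseteq># M}"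
    proof (cases "x \<in># A")
      case True
      then obtain B where "A = add_mset x B" by (meson multi_member_split)
      then show ?thesis using A by auto
    next
      case False
      then show ?thesis using A
        by (metis UnI1 diff_single_trivial mem_Collect_eq subset_eq_diff_conv add_mset_add_single)
    qed
  qed
  then show ?case using add by (meson finite_UnI finite_imageI finite_subset)
qed

lemma finite_mset_splits: "finite {(A, B). A + B = (M :: 'a multiset)}"
proof (rule finite_subset)
  show "{(A, B). A + B = M} \<subseteq> {A. A \<subseteq># M} \<times> {A. A \<subseteq># M}" by auto
  show "finite ({A. A \<subseteq># M} \<times> {A. A \<subseteq># M})"
    by (simp add: finite_subset_mset_Collect)
qed

instantiation mpowser :: comm_ring_1
begin

definition "0 = Abs_mpowser (\<lambda>M. 0)"
definition "1 = Abs_mpowser (\<lambda>M. if M = {#} then 1 else 0)"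
definition "F + G = Abs_mpowser (\<lambda>M. mcoeff F M + mcoeff G M)"
definition "F - G = Abs_mpowser (\<lambda>M. mcoeff F M - mcoeff G M)"
definition "- F = Abs_mpowser (\<lambda>M. - mcoeff F M)"
definition "F * G = Abs_mpowser (\<lambda>M. \<Sum>(A, B) \<in> {(A, B). A + B = M}. mcoeff F A * mcoeff G B)"

instance
proof
  fix F G H :: mpowser
  show "F * G * H = F * (G * H)"
  proof (rule mpowser_eqI)
    fix M
    have "mcoeff (F * G * H) M =
        (\<Sum>p \<in> {(D, C). D + C = M}. \<Sum>r \<in> {(A, B). A + B = fst p}.
            mcoeff F (fst r) * mcoeff G (snd r) * mcoeff H (snd p))"
      by (simp only: times_mpowser_def mcoeff_Abs sum_distrib_right case_prod_unfold)
    also have "\<dots> =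
        (\<Sum>(p, r) \<in> (SIGMA p:{(D, C). D + C = M}. {(A, B). A + B = fst p}).
            mcoeff F (fst r) * mcoeff G (snd r) * mcoeff H (snd p))"
      by (rule sum.Sigma) (simp_all only: finite_mset_splits ball_simps simp_thms)
    also have "\<dots> =
        (\<Sum>(p, r) \<in> (SIGMA p:{(A, D). A + D = M}. {(B, C). B + C = snd p}).
            mcoeff F (fst p) * (mcoeff G (fst r) * mcoeff H (snd r)))"
      by (rule sum.reindex_bij_witness
            [where i = "\<lambda>((A, D), (B, C)). ((A + B, C), (A, B))"
               and j = "\<lambda>((D, C), (A, B)). ((A, B + C), (B, C))"])
        (auto simp: add.assoc mult.assoc)
    also have "\<dots> =
        (\<Sum>p \<in> {(A, D). A + D = M}. \<Sum>r \<in> {(B, C). B + C = snd p}.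
            mcoeff F (fst p) * (mcoeff G (fst r) * mcoeff H (snd r)))"
      by (rule sum.Sigma[symmetric]) (simp_all only: finite_mset_splits ball_simps simp_thms)
    also have "\<dots> = mcoeff (F * (G * H)) M"
      by (simp only: times_mpowser_def mcoeff_Abs sum_distrib_left case_prod_unfold)
    finally show "mcoeff (F * G * H) M = mcoeff (F * (G * H)) M" .
  qed
  show "F * G = G * F"
  proof (rule mpowser_eqI)
    fix M
    show "mcoeff (F * G) M = mcoeff (G * F) M"
      unfolding times_mpowser_def mcoeff_Abs
      by (rule sum.reindex_bij_witness[where i = prod.swap and j = prod.swap])
        (auto simp: algebra_simps)
  qed
  show "1 * F = F"
  proof (rule mpowser_eqI)
    fix M
    have "mcoeff (1 * F) M =
        (\<Sum>p \<in> {(A, B). A + B = M}. if p = ({#}, M) then mcoeff F M else 0)"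
      unfolding times_mpowser_def one_mpowser_def mcoeff_Abs
      by (rule sum.cong) (auto split: if_splits)
    also have "\<dots> = mcoeff F M"
      by (subst sum.delta) (auto simp: finite_mset_splits)
    finally show "mcoeff (1 * F) M = mcoeff F M" .
  qed
  show "(F + G) * H = F * H + G * H"
    by (rule mpowser_eqI)
      (simp add: times_mpowser_def plus_mpowser_def split_def algebra_simps sum.distrib)
  show "(0 :: mpowser) \<noteq> 1"
  proof
    assume "(0 :: mpowser) = 1"
    then have "mcoeff 0 {#} = mcoeff 1 {#}" by simp
    then show False by (simp add: zero_mpowser_def one_mpowser_def)
  qed
qed (auto intro!: mpowser_eqI
      simp: zero_mpowser_def plus_mpowser_def minus_mpowser_def uminus_mpowser_def)

end

instantiation mpowser :: real_algebra_1
begin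

definition "c *\<^sub>R F = Abs_mpowser (\<lambda>M. c * mcoeff F M)"

instance
  by standard
    (auto intro!: mpowser_eqI
      simp: scaleR_mpowser_def plus_mpowser_def times_mpowser_def
        algebra_simps sum_distrib_left split_def)

end


section \<open>The algebra of symmetric functions\<close>

definition Lambda :: "mpowser set" where
  "Lambda = {F. (\<forall>p M. bij p \<longrightarrow> mcoeff F (image_mset p M) = mcoeff F M) \<and>
                (\<exists>d. \<forall>M. mcoeff F M \<noteq> 0 \<longrightarrow> size M \<le> d)}"

definition h1 :: mpowser where
  "h1 = Abs_mpowser (\<lambda>M. if size M = 1 then 1 else 0)"

text \<open>
  Functionals on \<open>Lambda\<close> are extensional, so that they are determined by their
  values on \<open>Lambda\<close>.
\<close>

definition Lambda_linear :: "(mpowser \<Rightarrow> real) set" where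
  "Lambda_linear = {\<theta> \<in> extensional Lambda.
     (\<forall>F\<in>Lambda. \<forall>G\<in>Lambda. \<theta> (F + G) = \<theta> F + \<theta> G) \<and>
     (\<forall>c. \<forall>F\<in>Lambda. \<theta> (c *\<^sub>R F) = c * \<theta> F)}"

definition Lambda_hom :: "(mpowser \<Rightarrow> real) set" where
  "Lambda_hom = {\<theta> \<in> Lambda_linear.
     \<theta> 1 = 1 \<and> (\<forall>F\<in>Lambda. \<forall>G\<in>Lambda. \<theta> (F * G) = \<theta> F * \<theta> G)}"


section \<open>Partitions and Young diagrams\<close>

typedef int_partition = "{xs :: nat list. sorted_wrt (\<ge>) xs \<and> 0 \<notin> set xs}"
  morphisms parts Abs_int_partition
  by (rule exI[of _ "[]"]) simp

definition empty_partition :: int_partition where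
  "empty_partition = Abs_int_partition []"

text \<open>Boxes are pairs (row, column), both counted from 1.\<close>

definition diagram :: "int_partition \<Rightarrow> (nat \<times> nat) set" where
  "diagram \<nu> = {(i, j). 1 \<le> i \<and> i \<le> length (parts \<nu>) \<and> 1 \<le> j \<and> j \<le> parts \<nu> ! (i - 1)}"

definition add_box :: "int_partition \<Rightarrow> int_partition \<Rightarrow> bool" (infix \<open>\<nearrow>\<close> 50) where
  "\<mu> \<nearrow> \<nu> \<longleftrightarrow> (\<exists>s. s \<notin> diagram \<mu> \<and> diagram \<nu> = insert s (diagram \<mu>))"


section \<open>Macdonald coefficients\<close>

text \<open>
  From here on, partitions are identified with their diagrams. The arguments D and E below
  stand for the diagrams of partitions; the pair of D and E stands for the skew shape
  with outer diagram D and inner diagram E.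
\<close>

definition row_len :: "(nat \<times> nat) set \<Rightarrow> nat \<Rightarrow> nat" where
  "row_len D i = card {j. (i, j) \<in> D}"

definition col_len :: "(nat \<times> nat) set \<Rightarrow> nat \<Rightarrow> nat" where
  "col_len D j = card {i. (i, j) \<in> D}"

definition mac_b :: "real \<Rightarrow> real \<Rightarrow> (nat \<times> nat) set \<Rightarrow> nat \<times> nat \<Rightarrow> real" where
  "mac_b q t D s = (if s \<in> D then
     (case s of (i, j) \<Rightarrow>
       (1 - q ^ (row_len D i - j) * t ^ (col_len D j - i + 1)) /
       (1 - q ^ (row_len D i - j + 1) * t ^ (col_len D j - i)))
     else 1)"

text \<open>
  Rows and columns consist of the boxes of the outer diagram; for boxes outside of it the
  factors in \<open>mac_psi\<close> and \<open>mac_phi\<close> would be 1.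
\<close>

definition skew_rows :: "(nat \<times> nat) set \<Rightarrow> (nat \<times> nat) set \<Rightarrow> (nat \<times> nat) set" where
  "skew_rows D E = {(i, j) \<in> D. \<exists>j'. (i, j') \<in> D - E}"

definition skew_cols :: "(nat \<times> nat) set \<Rightarrow> (nat \<times> nat) set \<Rightarrow> (nat \<times> nat) set" where
  "skew_cols D E = {(i, j) \<in> D. \<exists>i'. (i', j) \<in> D - E}"

definition mac_psi :: "real \<Rightarrow> real \<Rightarrow> (nat \<times> nat) set \<Rightarrow> (nat \<times> nat) set \<Rightarrow> real" where
  "mac_psi q t D E = (\<Prod>s \<in> skew_rows D E - skew_cols D E. mac_b q t E s / mac_b q t D s)"

definition mac_phi :: "real \<Rightarrow> real \<Rightarrow> (nat \<times> nat) set \<Rightarrow> (nat \<times> nat) set \<Rightarrow> real" where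
  "mac_phi q t D E = (\<Prod>s \<in> skew_cols D E. mac_b q t D s / mac_b q t E s)"


section \<open>Macdonald symmetric functions\<close>

text \<open>
  Entries are counted from 0, like the variables: entry i stands for i + 1.
\<close>

definition ssyt :: "int_partition \<Rightarrow> (nat \<times> nat \<Rightarrow> nat) set" where
  "ssyt \<nu> = {T \<in> extensional (diagram \<nu>).
     (\<forall>i j j'. (i, j) \<in> diagram \<nu> \<and> (i, j') \<in> diagram \<nu> \<and> j < j' \<longrightarrow> T (i, j) \<le> T (i, j')) \<and>
     (\<forall>i i' j. (i, j) \<in> diagram \<nu> \<and> (i', j) \<in> diagram \<nu> \<and> i < i' \<longrightarrow> T (i, j) < T (i', j))}"

text \<open>
  With the shifted entries, the diagram of the i-th partition of the chain defined by T
  consists of the boxes whose entry is less than i.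
\<close>

definition subshape :: "int_partition \<Rightarrow> (nat \<times> nat \<Rightarrow> nat) \<Rightarrow> nat \<Rightarrow> (nat \<times> nat) set" where
  "subshape \<nu> T i = {s \<in> diagram \<nu>. T s < i}"

text \<open>
  The product may be restricted to the indices i occurring as entries: for all others the
  diagrams with indices i and i + 1 are equal and the factor is 1.
\<close>

definition mac_phi_tableau :: "real \<Rightarrow> real \<Rightarrow> int_partition \<Rightarrow> (nat \<times> nat \<Rightarrow> nat) \<Rightarrow> real" where
  "mac_phi_tableau q t \<nu> T =
     (\<Prod>i \<in> T ` diagram \<nu>. mac_phi q t (subshape \<nu> T (Suc i)) (subshape \<nu> T i))"

definition mac_Q :: "real \<Rightarrow> real \<Rightarrow> int_partition \<Rightarrow> mpowser" where
  "mac_Q q t \<nu> = Abs_mpowser (\<lambda>M.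
     \<Sum>T \<in> {T \<in> ssyt \<nu>. \<forall>i. count M i = card (subshape \<nu> T (Suc i)) - card (subshape \<nu> T i)}.
       mac_phi_tableau q t \<nu> T)"


section \<open>Harmonic functions on the Young graph\<close>

definition harmonic :: "real \<Rightarrow> real \<Rightarrow> (int_partition \<Rightarrow> real) set" where
  "harmonic q t = {f. (\<forall>\<nu>. f \<nu> \<ge> 0) \<and> f empty_partition = 1 \<and>
     (\<forall>\<mu>. f \<mu> = (\<Sum>\<nu> | \<mu> \<nearrow> \<nu>. mac_psi q t (diagram \<nu>) (diagram \<mu>) * f \<nu>))}"

definition extreme_harmonic :: "real \<Rightarrow> real \<Rightarrow> (int_partition \<Rightarrow> real) set" where
  "extreme_harmonic q t = {f. f extreme_point_of harmonic q t}"

definition tilde :: "real \<Rightarrow> real \<Rightarrow> (int_partition \<Rightarrow> real) \<Rightarrow> mpowser \<Rightarrow> real" where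
  "tilde q t f = (THE \<theta>. \<theta> \<in> Lambda_linear \<and> (\<forall>\<mu>. \<theta> (mac_Q q t \<mu>) = f \<mu>))"

end

theory Submission
  imports Defs "HOL-Computational_Algebra.Polynomial"
begin

text \<open>
  Harmonic functions on the Young graph are linear functionals on symmetric functions: if
  $e_1 Q_\mu$ expands with the edge weights $\psi$ (up to the scalar $c_1 = (1-t)/(1-q)$),
  then $f$ is harmonic iff $\tilde f$ is nonnegative on all $Q_\mu$, is 1 at 1, and
  satisfies $\tilde f (c_1 h_1 F) = \tilde f (F)$. In this picture the theorem is the ring
  theorem of Vershik and Kerov: extremality is the same as multiplicativity. The proof has an
  algebraic half, which makes the picture available starting from the tableau definition of
  $Q_\mu$, and a convexity half.

  Algebra. Nothing in the tableau definition shows that $Q_\mu$ is symmetric. Everything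
  is obtained from the Pieri rule \<open>Pieri_elem\<close>, which expands $e_k Q_\mu$ over the partitions
  that arise from $\mu$ by adding a vertical strip of size $k$. Removing the boxes with the
  largest entry from a tableau removes a horizontal strip, so by induction on the number of
  variables the Pieri rule says that adding vertical strips and removing horizontal strips
  commute, up to one extra term that accounts for $e_k$ using the last variable. This is
  \<open>strip_commutation\<close>. For a fixed pair of partitions $\lambda, \mu$ let
  $x_i = q^{\mu_i} t^{-i}$ and $y_j = q^{\lambda_j - 1} t^{-j}$; then the weight of
  adding boxes in the rows $i \in I$ becomes a common factor times a product over
  $I$ and its complement of simple fractions in the $x$ and $y$, and the weight of removing boxes
  in the rows $j \in J$ becomes the corresponding product with the roles of $x$ and $y$ exchanged.
  The sums over subsets of the $x$ and of the $y$ are related by \<open>xsum_eq_ysum\<close>, a rational identity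
  that follows by induction from partial fractions and also produces the extra term. The rewriting needs $q$ and $t$ to be multiplicatively
  independent, which is removed afterwards by continuity.

  If $\mu$ arises from $\nu$ by deleting the first column, of length $k$, then the leading term
  of $e_k Q_\mu$ is a nonzero multiple of $Q_\nu$; hence every $Q_\nu$ is a polynomial in the
  $e_k$ (\<open>Q_elem_algebra\<close>) and in particular symmetric. Triangularity for the dominance order
  then makes the $Q_\nu$ a basis of the algebra of symmetric functions (\<open>independent_Q\<close>,
  \<open>Lambda_eq_span\<close>), which is therefore generated by the $e_k$.

  Extreme functions are multiplicative (\<open>extreme_imp_hom\<close>). For a harmonic $f$ put
  $g(\mu) = \tilde f (e_k Q_\mu)$. The Pieri coefficients are positive, so $g$ is nonnegative,
  and it satisfies the harmonicity equation. It is bounded by a constant multiple of $f$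
  (\<open>Pieri_dominated\<close>), because a vertical strip can be added box by box at a bounded
  cost. Hence $f$ is a proper convex combination of the normalisations of $f + c g$ and
  $f - c g$ for a small $c > 0$. If $f$ is extreme, the two coincide and $g$ is a multiple
  of $f$, that is, $\tilde f (e_k Q_\mu) = \tilde f (e_k) \tilde f (Q_\mu)$. Since the $e_k$
  generate, $\tilde f$ is a homomorphism.

  Homomorphisms are extreme (\<open>hom_imp_extreme\<close>). For every harmonic $g$ and every symmetric $F$
  one has $\tilde g (F)^2 \le \tilde g (F^2)$ (\<open>harmonic_square_ge\<close>): the
  difference is a continuous concave function of $g$ on the compact set of harmonic functions,
  so its minimum is attained at an extreme point, and there it vanishes by the first direction.
  If a homomorphism is a mixture of $\tilde a$ and $\tilde b$, then equality must hold in the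
  strictly convex inequality for squares, which forces $a = b$.
\<close>

section \<open>Subset sums and partial fractions\<close>

text \<open>
  Lagrange interpolation at the points of $P$ reproduces $p$; the interpolating basis
  polynomials without their denominators are monic of degree $|P| - 1$, so the left-hand side is
  the top coefficient of the interpolant.
\<close>

lemma sum_Lagrange_eq_coeff:
  fixes p :: "'a::field poly"
  assumes fin: "finite P" and deg: "degree p < card P"
  shows "(\<Sum>a\<in>P. poly p a / (\<Prod>b\<in>P - {a}. a - b)) = coeff p (card P - 1)"
proof -
  define w where "w a = poly p a / (\<Prod>b\<in>P - {a}. a - b)" for a
  define B where "B a = (\<Prod>b\<in>P - {a}. [:-b, 1:])" for a
  define L where "L = (\<Sum>a\<in>P. smult (w a) (B a))"
  have degB: "degree (B a) = card P - 1" and lcB: "coeff (B a) (card P - 1) = 1" if "a \<in> P" for a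
  proof -
    show d: "degree (B a) = card P - 1"
      unfolding B_def using that fin by (subst degree_prod_eq_sum_degree) auto
    have "lead_coeff (B a) = 1"
      unfolding B_def by (simp add: lead_coeff_prod)
    then show "coeff (B a) (card P - 1) = 1" by (simp add: d)
  qed
  have polyB: "poly (B a) x = (if x = a then \<Prod>b\<in>P - {a}. a - b else 0)"
    if "a \<in> P" "x \<in> P" for a x
    using that fin by (auto simp: B_def poly_prod prod_zero_iff)
  have "poly L x = poly p x" if x: "x \<in> P" for x
  proof -
    have "poly L x = (\<Sum>a\<in>P. if a = x then w a * (\<Prod>b\<in>P - {a}. a - b) else 0)"
      unfolding L_def poly_sum by (rule sum.cong) (use x in \<open>auto simp: polyB\<close>)
    also have "\<dots> = w x * (\<Prod>b\<in>P - {x}. x - b)"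
      using x fin by simp
    also have "\<dots> = poly p x"
      using fin by (simp add: w_def prod_zero_iff)
    finally show ?thesis .
  qed
  moreover have "degree L < card P"
  proof -
    have "degree L \<le> card P - 1" unfolding L_def
      by (rule degree_sum_le) (use fin degB degree_smult_le in \<open>force\<close>)+
    then show ?thesis using deg by linarith
  qed
  ultimately have "L = p"
    using deg by (intro poly_eqI_degree[of P]) auto
  then have "coeff p (card P - 1) = coeff L (card P - 1)" by simp
  also have "\<dots> = (\<Sum>a\<in>P. w a)"
    unfolding L_def coeff_sum by (rule sum.cong) (auto simp: lcB simp del: One_nat_def)
  finally show ?thesis by (simp add: w_def)
qed

text \<open>
  The sums over subsets into which the weights of strips turn. That $\tau$ is not a root of
  unity makes the $\tau$-integers invertible, and the inductions below divide by them. The basic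
  factor \<open>v\<close> a b is a ratio that vanishes for $b = \tau a$ and has a pole at $b = a$.
\<close>

locale subset_sums =
  fixes \<tau> :: real and x :: "'i \<Rightarrow> real" and y :: "'j \<Rightarrow> real"
  assumes tau0: "\<tau> \<noteq> 0" and tau_root: "\<And>n. n > 0 \<Longrightarrow> \<tau> ^ n \<noteq> 1"
begin

definition v :: "real \<Rightarrow> real \<Rightarrow> real" where
  "v a b = (b - \<tau> * a) / (b - a)"

definition xterm :: "'i set \<Rightarrow> 'j set \<Rightarrow> 'i set \<Rightarrow> real" where
  "xterm A B I = (\<Prod>i\<in>I. (\<Prod>j\<in>A - I. v (x j) (x i)) * (\<Prod>m\<in>B. v (x i) (y m)))"

definition yterm :: "'i set \<Rightarrow> 'j set \<Rightarrow> 'j set \<Rightarrow> real" where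
  "yterm A B J = (\<Prod>j\<in>J. (\<Prod>l\<in>B - J. v (y j) (y l)) * (\<Prod>i\<in>A. v (x i) (y j)))"

definition xsum :: "'i set \<Rightarrow> 'j set \<Rightarrow> nat \<Rightarrow> real" where
  "xsum A B k = (\<Sum>I | I \<subseteq> A \<and> card I = k. xterm A B I)"

definition ysum :: "'i set \<Rightarrow> 'j set \<Rightarrow> nat \<Rightarrow> real" where
  "ysum A B k = (\<Sum>J | J \<subseteq> B \<and> card J = k. yterm A B J)"

definition good :: "'i set \<Rightarrow> 'j set \<Rightarrow> bool" where
  "good A B \<longleftrightarrow> finite A \<and> finite B \<and> inj_on x A \<and> inj_on y B \<and>
    0 \<notin> x ` A \<and> 0 \<notin> y ` B \<and> x ` A \<inter> y ` B = {}"

lemma good_subset: "good A B \<Longrightarrow> A' \<subseteq> A \<Longrightarrow> B' \<subseteq> B \<Longrightarrow> good A' B'"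
  unfolding good_def by (blast intro: finite_subset inj_on_subset)

lemma tau1: "\<tau> \<noteq> 1" using tau_root[of 1] by simp

text \<open>
  The terms are the residues of
  $\prod_{j \in A} (z - \tau x_j) \prod_{m \in B} (y_m - \tau z) /
   (z \prod_{j \in A} (z - x_j) \prod_{m \in B} (z - y_m))$,
  divided by $1 - \tau$; the poles at the $y_m$ give the sum on the right. The constant comes from
  the residues at 0 and at infinity.
\<close>

lemma partial_fractions:
  assumes "good A B"
  shows "(\<Sum>i\<in>A. (\<Prod>j\<in>A - {i}. v (x j) (x i)) * (\<Prod>m\<in>B. v (x i) (y m))) =
    (\<Sum>m\<in>B. (\<Prod>l\<in>B - {m}. v (y m) (y l)) * (\<Prod>i\<in>A. v (x i) (y m)))
    + (\<tau> ^ card B - \<tau> ^ card A) / (1 - \<tau>)"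
proof -
  note [simp] = tau0
  have fA: "finite A" and fB: "finite B" and ix: "inj_on x A" and iy: "inj_on y B"
    and zx: "0 \<notin> x ` A" and zy: "0 \<notin> y ` B" and dis: "x ` A \<inter> y ` B = {}"
    using assms by (auto simp: good_def)
  define P where "P = insert 0 (x ` A \<union> y ` B)"
  define p where "p = (\<Prod>j\<in>A. [:- (\<tau> * x j), 1:]) * (\<Prod>m\<in>B. [:y m, - \<tau>:])"
  \<comment> \<open>the residues; at the node 0 the residue is \<open>\<tau> ^ card A\<close> up to sign, at infinity it is the top coefficient\<close>
  define W where "W a = poly p a / (\<Prod>b\<in>P - {a}. a - b)" for a
  have finP: "finite P" using fA fB by (simp add: P_def)
  have cardP: "card P = Suc (card A + card B)"
    using fA fB zx zy dis ix iy by (auto simp: P_def card_Un_disjoint card_image)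
  have degp: "degree p = card A + card B"
  proof -
    have "degree p = degree (\<Prod>j\<in>A. [:- (\<tau> * x j), 1:]) + degree (\<Prod>m\<in>B. [:y m, - \<tau>:])"
      unfolding p_def by (rule degree_mult_eq) (simp_all add: fA fB prod_zero_iff)
    also have "\<dots> = card A + card B"
      by (simp add: degree_prod_eq_sum_degree)
    finally show ?thesis .
  qed
  have "lead_coeff p = (- \<tau>) ^ card B"
    unfolding p_def by (simp add: lead_coeff_mult lead_coeff_prod)
  then have lc: "coeff p (card P - 1) = (- \<tau>) ^ card B"
    by (simp add: cardP degp)
  have sumW: "(\<Sum>a\<in>P. W a) = (- \<tau>) ^ card B"
    unfolding W_def using sum_Lagrange_eq_coeff[OF finP, of p] degp cardP lc by simp
  have poly_p: "poly p z = (\<Prod>j\<in>A. z - \<tau> * x j) * (\<Prod>m\<in>B. y m - \<tau> * z)" for z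
    by (simp add: p_def poly_prod algebra_simps)
  have split: "(\<Sum>a\<in>P. W a) = W 0 + (\<Sum>i\<in>A. W (x i)) + (\<Sum>m\<in>B. W (y m))"
    using fA fB zx zy dis ix iy
    by (auto simp: P_def sum.union_disjoint sum.reindex)
  have W0: "W 0 = (- 1) ^ card B * \<tau> ^ card A"
  proof -
    have "P - {0} = x ` A \<union> y ` B" using zx zy by (auto simp: P_def)
    then have "(\<Prod>b\<in>P - {0}. 0 - b) = (\<Prod>i\<in>A. - x i) * (\<Prod>m\<in>B. - y m)"
      using fA fB dis ix iy by (simp add: prod.union_disjoint prod.reindex)
    moreover have "poly p 0 = (\<Prod>j\<in>A. \<tau> * (- x j)) * (\<Prod>m\<in>B. (-1) * (- y m))"
      by (simp add: poly_p)
    moreover have "(\<Prod>i\<in>A. - x i) \<noteq> 0" "(\<Prod>m\<in>B. - y m) \<noteq> 0"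
      using zx zy fA fB by (auto simp: prod_zero_iff)
    ultimately show ?thesis
      unfolding W_def by (simp only: prod.distrib prod_constant) (simp add: field_simps)
  qed
  have Wx: "W (x i) = (- 1) ^ card B * (1 - \<tau>) *
      ((\<Prod>j\<in>A - {i}. v (x j) (x i)) * (\<Prod>m\<in>B. v (x i) (y m)))" if i: "i \<in> A" for i
  proof -
    have xi: "x i \<noteq> 0" using i zx by auto
    have "P - {x i} = insert 0 (x ` (A - {i}) \<union> y ` B)"
      using i zx zy dis ix by (auto simp: P_def inj_on_def)
    then have "(\<Prod>b\<in>P - {x i}. x i - b)
        = (\<Prod>b\<in>insert 0 (x ` (A - {i}) \<union> y ` B). x i - b)" by simp
    also have "\<dots> = x i * ((\<Prod>j\<in>A - {i}. x i - x j) * (\<Prod>m\<in>B. x i - y m))"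
    proof -
      have "0 \<notin> x ` (A - {i}) \<union> y ` B" using zx zy by auto
      moreover have "x ` (A - {i}) \<inter> y ` B = {}" using dis by auto
      moreover have "inj_on x (A - {i})" using ix by (rule inj_on_subset) auto
      ultimately show ?thesis using fA fB iy
        by (simp add: prod.union_disjoint prod.reindex)
    qed
    finally have den: "(\<Prod>b\<in>P - {x i}. x i - b)
        = x i * ((\<Prod>j\<in>A - {i}. x i - x j) * (\<Prod>m\<in>B. (-1) * (y m - x i)))"
      by simp
    have num: "poly p (x i) = (1 - \<tau>) * x i * (\<Prod>j\<in>A - {i}. x i - \<tau> * x j) *
        (\<Prod>m\<in>B. y m - \<tau> * x i)"
      unfolding poly_p using i fA by (simp add: prod.remove[of A i] algebra_simps)
    have "(- 1 :: real) ^ card B = 1 \<or> (- 1 :: real) ^ card B = - 1"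
      by (simp add: minus_one_power_iff)
    then show ?thesis
      unfolding W_def den num v_def prod.distrib prod_dividef prod_constant using xi
      by (elim disjE) (auto simp add: divide_simps algebra_simps)
  qed
  have Wy: "W (y m) = - ((- 1) ^ card B * (1 - \<tau>) *
      ((\<Prod>l\<in>B - {m}. v (y m) (y l)) * (\<Prod>i\<in>A. v (x i) (y m))))" if m: "m \<in> B" for m
  proof -
    have ym: "y m \<noteq> 0" using m zy by auto
    have "P - {y m} = insert 0 (x ` A \<union> y ` (B - {m}))"
      using m zx zy dis iy by (auto simp: P_def inj_on_def)
    then have "(\<Prod>b\<in>P - {y m}. y m - b)
        = (\<Prod>b\<in>insert 0 (x ` A \<union> y ` (B - {m})). y m - b)" by simp
    also have "\<dots> = y m * ((\<Prod>i\<in>A. y m - x i) * (\<Prod>l\<in>B - {m}. y m - y l))"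
    proof -
      have "0 \<notin> x ` A \<union> y ` (B - {m})" using zx zy by auto
      moreover have "x ` A \<inter> y ` (B - {m}) = {}" using dis by auto
      moreover have "inj_on y (B - {m})" using iy by (rule inj_on_subset) auto
      ultimately show ?thesis using fA fB ix
        by (simp add: prod.union_disjoint prod.reindex)
    qed
    finally have den: "(\<Prod>b\<in>P - {y m}. y m - b)
        = y m * ((\<Prod>i\<in>A. y m - x i) * (\<Prod>l\<in>B - {m}. (-1) * (y l - y m)))"
      by simp
    have num: "poly p (y m) = (1 - \<tau>) * y m * (\<Prod>i\<in>A. y m - \<tau> * x i) *
        (\<Prod>l\<in>B - {m}. y l - \<tau> * y m)"
      unfolding poly_p using m fB by (simp add: prod.remove[of B m] algebra_simps)
    have "(- 1 :: real) ^ card (B - {m}) = 1 \<or> (- 1 :: real) ^ card (B - {m}) = - 1"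
      by (simp add: minus_one_power_iff)
    moreover have "(- 1 :: real) ^ card B = - ((- 1) ^ card (B - {m}))"
      using m fB by (metis card_Suc_Diff1 mult_minus1 power_Suc)
    ultimately show ?thesis
      unfolding W_def den num v_def prod.distrib prod_dividef prod_constant using ym
      by (elim disjE) (auto simp add: divide_simps algebra_simps)
  qed
  let ?X = "\<Sum>i\<in>A. (\<Prod>j\<in>A - {i}. v (x j) (x i)) * (\<Prod>m\<in>B. v (x i) (y m))"
  let ?Y = "\<Sum>m\<in>B. (\<Prod>l\<in>B - {m}. v (y m) (y l)) * (\<Prod>i\<in>A. v (x i) (y m))"
  have "(\<Sum>i\<in>A. W (x i)) = (- 1) ^ card B * (1 - \<tau>) * ?X"
    by (simp add: Wx sum_distrib_left)
  moreover have "(\<Sum>m\<in>B. W (y m)) = - ((- 1) ^ card B * (1 - \<tau>) * ?Y)"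
    by (simp add: Wy sum_distrib_left sum_negf)
  ultimately have "(- \<tau>) ^ card B = (- 1) ^ card B * (\<tau> ^ card A + (1 - \<tau>) * ?X - (1 - \<tau>) * ?Y)"
    unfolding sumW[symmetric] split W0 by (simp add: algebra_simps)
  moreover have "(- \<tau>) ^ card B = (- 1) ^ card B * \<tau> ^ card B"
    by (simp flip: power_mult_distrib)
  ultimately have "\<tau> ^ card B = \<tau> ^ card A + (1 - \<tau>) * ?X - (1 - \<tau>) * ?Y"
    by simp
  then show ?thesis using tau1 by (simp add: field_simps)
qed


lemma sum_subset_member:
  assumes "finite A"
  shows "(\<Sum>i\<in>A. \<Sum>I' | I' \<subseteq> A - {i} \<and> card I' = k. f i I') =
    (\<Sum>I | I \<subseteq> A \<and> card I = Suc k. \<Sum>i\<in>I. f i (I - {i}))"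
proof -
  have fin: "finite {I. I \<subseteq> C \<and> P I}" if "C \<subseteq> A" for C P
    using assms that by (rule_tac finite_subset[of _ "Pow A"]) auto
  have finI: "finite I" if "I \<subseteq> A" for I using that assms by (rule finite_subset)
  have "(\<Sum>i\<in>A. \<Sum>I' | I' \<subseteq> A - {i} \<and> card I' = k. f i I') =
      (\<Sum>(i, I') \<in> Sigma A (\<lambda>i. {I'. I' \<subseteq> A - {i} \<and> card I' = k}). f i I')"
    by (rule sum.Sigma) (use assms fin in auto)
  also have "\<dots> = (\<Sum>(I, i) \<in> Sigma {I. I \<subseteq> A \<and> card I = Suc k} (\<lambda>I. I). f i (I - {i}))"
    by (rule sum.reindex_bij_witness[where i = "\<lambda>(I, i). (i, I - {i})"
          and j = "\<lambda>(i, I). (insert i I, i)"])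
      (auto simp: insert_absorb finI finite_subset card_insert_if subset_Diff_insert)
  also have "\<dots> = (\<Sum>I | I \<subseteq> A \<and> card I = Suc k. \<Sum>i\<in>I. f i (I - {i}))"
    by (rule sum.Sigma[symmetric]) (use fin finI in auto)
  finally show ?thesis .
qed

lemma sum_subset_nonmember:
  assumes "finite A"
  shows "(\<Sum>I' | I' \<subseteq> A \<and> card I' = k. \<Sum>i\<in>A - I'. f i I') =
    (\<Sum>I | I \<subseteq> A \<and> card I = Suc k. \<Sum>i\<in>I. f i (I - {i}))"
proof -
  have fin: "finite {I. I \<subseteq> A \<and> P I}" for P
    using assms by (rule_tac finite_subset[of _ "Pow A"]) auto
  have "(\<Sum>I' | I' \<subseteq> A \<and> card I' = k. \<Sum>i\<in>A - I'. f i I') =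
      (\<Sum>I' | I' \<subseteq> A \<and> card I' = k. \<Sum>i | i \<in> A \<and> I' \<subseteq> A - {i}. f i I')"
    by (intro sum.cong) auto
  also have "\<dots> = (\<Sum>i\<in>A. \<Sum>I' | I' \<in> {I'. I' \<subseteq> A \<and> card I' = k} \<and> I' \<subseteq> A - {i}. f i I')"
    by (rule sum.swap_restrict) (use assms fin in auto)
  also have "\<dots> = (\<Sum>i\<in>A. \<Sum>I' | I' \<subseteq> A - {i} \<and> card I' = k. f i I')"
    by (intro sum.cong) auto
  also note sum_subset_member[OF assms]
  finally show ?thesis .
qed

definition qnum :: "nat \<Rightarrow> real" where "qnum k = (1 - \<tau> ^ k) / (1 - \<tau>)"

lemma xterm_remove:
  assumes "finite A" "I \<subseteq> A" "i \<in> I"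
  shows "(\<Prod>j\<in>A - {i}. v (x j) (x i)) * (\<Prod>m\<in>B. v (x i) (y m)) * xterm (A - {i}) B (I - {i}) =
    xterm A B I * (\<Prod>j\<in>I - {i}. v (x j) (x i))"
proof -
  have fI: "finite I" using assms finite_subset by blast
  have 1: "A - {i} - (I - {i}) = A - I" using assms by auto
  have 2: "(\<Prod>j\<in>A - {i}. v (x j) (x i)) = (\<Prod>j\<in>A - I. v (x j) (x i)) * (\<Prod>j\<in>I - {i}. v (x j) (x i))"
  proof -
    have "A - {i} = (A - I) \<union> (I - {i})" using assms by auto
    then show ?thesis using assms fI by (auto intro!: prod.union_disjoint)
  qed
  show ?thesis
    unfolding xterm_def 1 2 prod.remove[OF fI assms(3)] by (simp add: mult_ac)
qed

lemma yterm_insert: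
  assumes "finite B" "J \<subseteq> B" "m \<in> J"
  shows "yterm A B (J - {m}) * ((\<Prod>l\<in>B - (J - {m}) - {m}. v (y m) (y l)) * (\<Prod>i\<in>A. v (x i) (y m))) =
    yterm A B J * (\<Prod>j\<in>J - {m}. v (y j) (y m))"
proof -
  have fJ: "finite J" using assms finite_subset by blast
  have 1: "B - (J - {m}) - {m} = B - J" using assms by auto
  have 2: "(\<Prod>l\<in>B - (J - {m}). v (y j) (y l)) = v (y j) (y m) * (\<Prod>l\<in>B - J. v (y j) (y l))" for j
  proof -
    have "B - (J - {m}) = insert m (B - J)" using assms by auto
    then show ?thesis using assms by auto
  qed
  show ?thesis
    unfolding yterm_def 1 2 prod.remove[OF fJ assms(3)] by (simp add: prod.distrib mult_ac)
qed

text \<open>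
  A set of size $k + 1$ is built by choosing one of its elements $i$ and then the
  rest. Relative to the term of the whole set $I$, the choice of $i$ has the weight
  $\prod_{j \in I - \{i\}} v(x_j, x_i)$; by the partial fraction identity without $y$ variables,
  these weights add up to the $\tau$-integer of $|I|$.
\<close>

lemma xsum_recursion:
  assumes "good A B"
  shows "qnum (Suc k) * xsum A B (Suc k) =
    (\<Sum>i\<in>A. (\<Prod>j\<in>A - {i}. v (x j) (x i)) * (\<Prod>m\<in>B. v (x i) (y m)) * xsum (A - {i}) B k)"
proof -
  have fA: "finite A" using assms by (simp add: good_def)
  let ?g = "\<lambda>i. (\<Prod>j\<in>A - {i}. v (x j) (x i)) * (\<Prod>m\<in>B. v (x i) (y m))"
  have "(\<Sum>i\<in>A. ?g i * xsum (A - {i}) B k) =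
      (\<Sum>i\<in>A. \<Sum>I' | I' \<subseteq> A - {i} \<and> card I' = k. ?g i * xterm (A - {i}) B I')"
    by (simp add: xsum_def sum_distrib_left)
  also have "\<dots> = (\<Sum>I | I \<subseteq> A \<and> card I = Suc k. \<Sum>i\<in>I. ?g i * xterm (A - {i}) B (I - {i}))"
    by (rule sum_subset_member[OF fA])
  also have "\<dots> = (\<Sum>I | I \<subseteq> A \<and> card I = Suc k. xterm A B I * qnum (Suc k))"
  proof (rule sum.cong, goal_cases)
    case (2 I)
    then have I: "I \<subseteq> A" "card I = Suc k" by auto
    have "good I {}" using good_subset[OF assms, of I "{}"] I by simp
    from partial_fractions[OF this]
    have "(\<Sum>i\<in>I. \<Prod>j\<in>I - {i}. v (x j) (x i)) = qnum (Suc k)"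
      by (simp add: qnum_def I)
    moreover have "(\<Sum>i\<in>I. ?g i * xterm (A - {i}) B (I - {i})) =
        (\<Sum>i\<in>I. xterm A B I * (\<Prod>j\<in>I - {i}. v (x j) (x i)))"
      by (rule sum.cong) (use xterm_remove[OF fA I(1)] in auto)
    ultimately show ?case by (simp add: sum_distrib_left[symmetric])
  qed simp
  also have "\<dots> = qnum (Suc k) * xsum A B (Suc k)"
    by (simp add: xsum_def sum_distrib_left mult.commute)
  finally show ?thesis by simp
qed

text \<open>
  For a fixed $J$, the sum over $i$ is the left-hand side of the partial fraction identity for $A$
  and $B - J$. The poles on its right-hand side enlarge $J$ by one element, and the constant
  keeps $J$.
\<close>

lemma ysum_exchange:
  assumes "good A B"
  shows "(\<Sum>i\<in>A. (\<Prod>j\<in>A - {i}. v (x j) (x i)) * (\<Prod>m\<in>B. v (x i) (y m)) * ysum (A - {i}) B r) =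
    qnum (Suc r) * ysum A B (Suc r) + (\<tau> ^ (card B - r) - \<tau> ^ card A) / (1 - \<tau>) * ysum A B r"
proof -
  have fA: "finite A" and fB: "finite B" using assms by (simp_all add: good_def)
  let ?g = "\<lambda>i. (\<Prod>j\<in>A - {i}. v (x j) (x i)) * (\<Prod>m\<in>B. v (x i) (y m))"
  let ?S = "{J. J \<subseteq> B \<and> card J = r}"
  let ?h = "\<lambda>J m. (\<Prod>l\<in>B - J - {m}. v (y m) (y l)) * (\<Prod>i\<in>A. v (x i) (y m))"
  let ?c = "(\<tau> ^ (card B - r) - \<tau> ^ card A) / (1 - \<tau>)"
  have "(\<Sum>i\<in>A. ?g i * ysum (A - {i}) B r) =
      (\<Sum>J\<in>?S. \<Sum>i\<in>A. ?g i * yterm (A - {i}) B J)"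
    unfolding ysum_def sum_distrib_left by (rule sum.swap)
  also have "\<dots> = (\<Sum>J\<in>?S. yterm A B J * ((\<Sum>m\<in>B - J. ?h J m) + ?c))"
  proof (rule sum.cong, goal_cases)
    case (2 J)
    then have J: "J \<subseteq> B" "card J = r" by auto
    have fJ: "finite J" using J fB finite_subset by blast
    have "?g i * yterm (A - {i}) B J =
        yterm A B J * ((\<Prod>j\<in>A - {i}. v (x j) (x i)) * (\<Prod>m\<in>B - J. v (x i) (y m)))"
      if i: "i \<in> A" for i
    proof -
      have "(\<Prod>m\<in>B. v (x i) (y m)) = (\<Prod>m\<in>B - J. v (x i) (y m)) * (\<Prod>m\<in>J. v (x i) (y m))"
        by (rule prod.subset_diff) (use J fB in auto)
      moreover have "yterm A B J = (\<Prod>m\<in>J. v (x i) (y m)) * yterm (A - {i}) B J"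
        unfolding yterm_def prod.remove[OF fA i] prod.distrib by (simp add: mult_ac)
      ultimately show ?thesis by (simp add: mult_ac)
    qed
    then have "(\<Sum>i\<in>A. ?g i * yterm (A - {i}) B J) =
        yterm A B J * (\<Sum>i\<in>A. (\<Prod>j\<in>A - {i}. v (x j) (x i)) * (\<Prod>m\<in>B - J. v (x i) (y m)))"
      unfolding sum_distrib_left by (intro sum.cong) auto
    also have "good A (B - J)" using good_subset[OF assms, of A "B - J"] by auto
    note partial_fractions[OF this]
    also have "card (B - J) = card B - r" using J fJ by (simp add: card_Diff_subset)
    finally show ?case .
  qed simp
  also have "\<dots> = (\<Sum>J\<in>?S. \<Sum>m\<in>B - J. yterm A B J * ?h J m) + ?c * ysum A B r"
    by (simp add: distrib_left sum.distrib sum_distrib_left ysum_def mult.commute)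
  also have "(\<Sum>J\<in>?S. \<Sum>m\<in>B - J. yterm A B J * ?h J m) =
      (\<Sum>J | J \<subseteq> B \<and> card J = Suc r. \<Sum>m\<in>J. yterm A B (J - {m}) * ?h (J - {m}) m)"
    by (rule sum_subset_nonmember[OF fB])
  also have "\<dots> = (\<Sum>J | J \<subseteq> B \<and> card J = Suc r. yterm A B J * qnum (Suc r))"
  proof (rule sum.cong, goal_cases)
    case (2 J)
    then have J: "J \<subseteq> B" "card J = Suc r" by auto
    have fJ: "finite J" using J fB finite_subset by blast
    have swap: "(\<Sum>m\<in>J. \<Prod>j\<in>J - {m}. v (y j) (y m)) = qnum (Suc r)"
    proof -
      \<comment> \<open>the partial fraction identity with y in the role of x and no second set of variables\<close>
      interpret yx: subset_sums \<tau> y x by unfold_locales (use tau0 tau_root in auto)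
      have "yx.good J {}" using assms J fJ unfolding yx.good_def good_def
        by (auto intro: inj_on_subset)
      from yx.partial_fractions[OF this] show ?thesis by (simp add: qnum_def J)
    qed
    have "(\<Sum>m\<in>J. yterm A B (J - {m}) * ?h (J - {m}) m) =
        (\<Sum>m\<in>J. yterm A B J * (\<Prod>j\<in>J - {m}. v (y j) (y m)))"
      by (rule sum.cong) (use yterm_insert[OF fB J(1)] in auto)
    then show ?case using swap by (simp add: sum_distrib_left[symmetric])
  qed simp
  also have "\<dots> = qnum (Suc r) * ysum A B (Suc r)"
    by (simp add: ysum_def sum_distrib_left mult.commute)
  finally show ?thesis .
qed

definition qbin :: "int \<Rightarrow> nat \<Rightarrow> real" where
  "qbin d n = (\<Prod>i<n. 1 - \<tau> powi (d - int i)) / (\<Prod>i<n. 1 - \<tau> ^ Suc i)"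

lemma qbin_0 [simp]: "qbin d 0 = 1" by (simp add: qbin_def)

lemma tau_Suc: "1 - \<tau> ^ Suc n \<noteq> 0" using tau_root[of "Suc n"] by simp

lemma qbin_Suc: "qbin d (Suc n) * (1 - \<tau> ^ Suc n) = qbin d n * (1 - \<tau> powi (d - int n))"
  using tau_Suc[of n] by (simp add: qbin_def del: power_Suc)

lemma qbin_Suc': "qbin d (Suc n) * (1 - \<tau> ^ Suc n) = qbin (d - 1) n * (1 - \<tau> powi d)"
proof -
  have "(\<Prod>i<Suc n. 1 - \<tau> powi (d - int i)) = (1 - \<tau> powi d) * (\<Prod>i<n. 1 - \<tau> powi (d - 1 - int i))"
    by (subst prod.lessThan_Suc_shift) (simp add: algebra_simps)
  moreover have "(\<Prod>i<Suc n. 1 - \<tau> ^ Suc i) = (\<Prod>i<n. 1 - \<tau> ^ Suc i) * (1 - \<tau> ^ Suc n)"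
    by (rule prod.lessThan_Suc)
  ultimately show ?thesis using tau_Suc[of n]
    by (simp add: qbin_def mult.commute del: power_Suc prod.lessThan_Suc)
qed

text \<open>
  A power of $\tau$ times the $\tau$-binomial coefficient of $a - b$ over $k - r$. The
  difference $a - b$ is an integer that may be negative, because the induction below decreases the
  size of $A$ while $B$ stays fixed.
\<close>

definition xy_coeff :: "int \<Rightarrow> int \<Rightarrow> nat \<Rightarrow> nat \<Rightarrow> real" where
  "xy_coeff a b k r = \<tau> powi ((b - int r) * int (k - r)) * qbin (a - b) (k - r)"

text \<open>
  This is the $\tau$-Pascal rule in the form in which \<open>ysum_exchange\<close> requires it.
\<close>

lemma xy_coeff_recursion:
  assumes "r \<le> k"
  shows "qnum (Suc k) * xy_coeff a b (Suc k) r =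
    xy_coeff (a - 1) b k (r - 1) * qnum r + xy_coeff (a - 1) b k r * ((\<tau> powi (b - int r) - \<tau> powi a) / (1 - \<tau>))"
proof -
  define m where "m = k - r"
  have k: "k = m + r" using assms by (simp add: m_def)
  define d where "d = a - b"
  define u where "u = \<tau> powi ((b - int r) * int m)"
  define z where "z = \<tau> powi (b - int r)"
  have z0: "z \<noteq> 0" using tau0 by (simp add: z_def)
  have pa: "\<tau> powi (i + j) = \<tau> powi i * \<tau> powi j" for i j
    by (rule power_int_add) (simp add: tau0)
  have pn: "\<tau> ^ n = \<tau> powi (int n)" for n by simp
  have uz: "\<tau> powi ((b - int r) * int (Suc m)) = u * z"
  proof -
    have "(b - int r) * int (Suc m) = (b - int r) * int m + (b - int r)" by (simp add: algebra_simps)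
    then show ?thesis by (simp only: pa u_def z_def)
  qed
  have e1: "xy_coeff a b (Suc k) r = u * z * qbin d (Suc m)"
    using uz by (simp add: xy_coeff_def k Suc_diff_le d_def)
  have e2: "xy_coeff (a - 1) b k r = u * qbin (d - 1) m"
    by (simp add: xy_coeff_def k u_def d_def algebra_simps)
  have e3: "xy_coeff (a - 1) b k (r - 1) * qnum r = u * z * \<tau> ^ Suc m * qbin (d - 1) (Suc m) * qnum r"
  proof (cases r)
    case 0
    then show ?thesis by (simp add: qnum_def)
  next
    case (Suc r')
    have "(b - int r + 1) * int (Suc m) = (b - int r) * int (Suc m) + int (Suc m)"
      by (simp add: algebra_simps)
    then have "\<tau> powi ((b - int r + 1) * int (Suc m)) = u * z * \<tau> ^ Suc m"
      by (simp only: pa uz pn)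
    moreover have "k - (r - 1) = Suc m" using Suc by (simp add: k)
    moreover have "b - int (r - 1) = b - int r + 1" using Suc by simp
    moreover have "a - 1 - b = d - 1" by (simp add: d_def)
    ultimately show ?thesis by (simp only: xy_coeff_def)
  qed
  have e4: "\<tau> powi a = z * \<tau> powi d * \<tau> ^ r"
  proof -
    have "a = (b - int r) + d + int r" by (simp add: d_def)
    then have "\<tau> powi a = \<tau> powi ((b - int r) + d + int r)" by simp
    then show ?thesis by (simp only: pa pn z_def)
  qed
  define T where "T = 1 - \<tau> ^ Suc m"
  have T: "T \<noteq> 0" using tau_Suc[of m] by (simp add: T_def)
  define P where "P = qbin (d - 1) m"
  have q1: "qbin d (Suc m) = P * (1 - \<tau> powi d) / T"
    using qbin_Suc'[of d m] T by (simp add: T_def P_def field_simps del: power_Suc)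
  have q2: "qbin (d - 1) (Suc m) = P * (1 - \<tau> powi (d - 1 - int m)) / T"
    using qbin_Suc[of "d - 1" m] T by (simp add: T_def P_def field_simps del: power_Suc)
  define D where "D = \<tau> powi d"
  define M where "M = \<tau> ^ Suc m"
  define R where "R = \<tau> ^ r"
  have q3: "M * \<tau> powi (d - 1 - int m) = D"
    unfolding M_def D_def pn pa[symmetric] by simp
  have k1: "\<tau> ^ Suc k = M * R" by (simp add: k M_def R_def power_add)
  have TM: "T = 1 - M" by (simp add: T_def M_def)
  have "(1 - M * R) * (P * (1 - D)) = P * (M - D) * (1 - R) + P * (1 - D * R) * (1 - M)"
    by (simp add: algebra_simps)
  then have main: "(1 - M * R) * (P * (1 - D) / T) =
      P * (M - D) / T * (1 - R) + P * (1 - D * R)"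
    using T by (simp add: TM field_simps)
  have "qnum (Suc k) * xy_coeff a b (Suc k) r = u * z / (1 - \<tau>) * ((1 - M * R) * (P * (1 - D) / T))"
    by (simp add: qnum_def e1 q1 D_def[symmetric] k1 mult_ac del: power_Suc)
  also have "\<dots> = u * z / (1 - \<tau>) * (P * (M - D) / T * (1 - R) + P * (1 - D * R))"
    by (simp only: main)
  also have "\<dots> = xy_coeff (a - 1) b k (r - 1) * qnum r + xy_coeff (a - 1) b k r * ((z - \<tau> powi a) / (1 - \<tau>))"
  proof -
    have "u * z * \<tau> ^ Suc m * qbin (d - 1) (Suc m) = u * z * (P * (M - D) / T)"
      unfolding q2 M_def[symmetric] q3[symmetric] by (simp add: algebra_simps)
    then have "xy_coeff (a - 1) b k (r - 1) * qnum r = u * z / (1 - \<tau>) * (P * (M - D) / T * (1 - R))"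
      unfolding e3 by (simp add: qnum_def R_def mult_ac)
    moreover have "xy_coeff (a - 1) b k r * ((z - \<tau> powi a) / (1 - \<tau>)) = u * z / (1 - \<tau>) * (P * (1 - D * R))"
      unfolding e2 e4 P_def[symmetric] D_def[symmetric] R_def[symmetric]
      by (simp add: right_diff_distrib mult_ac)
    ultimately show ?thesis by (simp only: distrib_left)
  qed
  finally show ?thesis by (simp add: z_def)
qed

text \<open>
  Induction on $k$: both sides satisfy the same recursion, by \<open>xsum_recursion\<close> on the left
  and by \<open>ysum_exchange\<close> on the right. The identity is of the kind that underlies the kernel
  function identities for Macdonald's $q$-difference operators.
\<close>

theorem xsum_eq_ysum:
  "good A B \<Longrightarrow> xsum A B k = (\<Sum>r\<le>k. xy_coeff (int (card A)) (int (card B)) k r * ysum A B r)"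
proof (induction k arbitrary: A)
  case 0
  then have "{I. I \<subseteq> A \<and> card I = 0} = {{}}" "{I. I \<subseteq> B \<and> card I = 0} = {{}}"
    unfolding good_def by (auto simp: card_eq_0_iff finite_subset)
  then show ?case by (simp add: xsum_def ysum_def xterm_def yterm_def xy_coeff_def)
next
  case (Suc k)
  have fA: "finite A" and fB: "finite B" using Suc.prems by (simp_all add: good_def)
  define a b where "a = int (card A)" and "b = int (card B)"
  let ?g = "\<lambda>i. (\<Prod>j\<in>A - {i}. v (x j) (x i)) * (\<Prod>m\<in>B. v (x i) (y m))"
  have Y0: "ysum A B r = 0" if "r > card B" for r
  proof -
    have "card J \<noteq> r" if "J \<subseteq> B" for J using card_mono[OF fB that] \<open>r > card B\<close> by simp
    then have "{J. J \<subseteq> B \<and> card J = r} = {}" by blast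
    then show ?thesis by (simp only: ysum_def sum.empty)
  qed
  have K: "(\<tau> ^ (card B - r) - \<tau> ^ card A) / (1 - \<tau>) * ysum A B r =
      (\<tau> powi (b - int r) - \<tau> powi a) / (1 - \<tau>) * ysum A B r" for r
  proof (cases "r \<le> card B")
    case True
    then have "b - int r = int (card B - r)" by (simp add: b_def)
    then show ?thesis by (simp only: a_def power_int_of_nat)
  qed (simp add: Y0)
  have "qnum (Suc k) * xsum A B (Suc k) = (\<Sum>i\<in>A. ?g i * xsum (A - {i}) B k)"
    by (rule xsum_recursion[OF Suc.prems])
  also have "\<dots> = (\<Sum>i\<in>A. ?g i * (\<Sum>r\<le>k. xy_coeff (a - 1) b k r * ysum (A - {i}) B r))"
  proof (rule sum.cong, goal_cases)
    case (2 i)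
    have "int (card (A - {i})) = a - 1" using 2 fA
      by (metis a_def card_Suc_Diff1 add_diff_cancel_left' of_nat_Suc)
    moreover have "good (A - {i}) B" using good_subset[OF Suc.prems] by auto
    ultimately show ?case using Suc.IH[of "A - {i}"] by (simp add: b_def)
  qed simp
  also have "\<dots> = (\<Sum>r\<le>k. xy_coeff (a - 1) b k r * (\<Sum>i\<in>A. ?g i * ysum (A - {i}) B r))"
    unfolding sum_distrib_left by (subst sum.swap) (simp add: mult_ac)
  also have "\<dots> = (\<Sum>r\<le>k. xy_coeff (a - 1) b k r * (qnum (Suc r) * ysum A B (Suc r)
      + (\<tau> powi (b - int r) - \<tau> powi a) / (1 - \<tau>) * ysum A B r))"
    unfolding ysum_exchange[OF Suc.prems] K ..
  also have "\<dots> = (\<Sum>r\<le>k. xy_coeff (a - 1) b k r * qnum (Suc r) * ysum A B (Suc r))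
      + (\<Sum>r\<le>k. xy_coeff (a - 1) b k r * ((\<tau> powi (b - int r) - \<tau> powi a) / (1 - \<tau>)) * ysum A B r)"
    by (simp only: distrib_left sum.distrib mult.assoc)
  also have "(\<Sum>r\<le>k. xy_coeff (a - 1) b k r * qnum (Suc r) * ysum A B (Suc r)) =
      (\<Sum>r\<le>Suc k. xy_coeff (a - 1) b k (r - 1) * qnum r * ysum A B r)"
    unfolding sum.atMost_Suc_shift by (simp add: qnum_def)
  also have "\<dots> = (\<Sum>r\<le>k. xy_coeff (a - 1) b k (r - 1) * qnum r * ysum A B r)
      + qnum (Suc k) * ysum A B (Suc k)"
    by (simp add: xy_coeff_def)
  finally have "qnum (Suc k) * xsum A B (Suc k) =
      (\<Sum>r\<le>k. (xy_coeff (a - 1) b k (r - 1) * qnum r + xy_coeff (a - 1) b k r *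
          ((\<tau> powi (b - int r) - \<tau> powi a) / (1 - \<tau>))) * ysum A B r) + qnum (Suc k) * ysum A B (Suc k)"
    by (simp only: distrib_right sum.distrib add_ac)
  also have "\<dots> = (\<Sum>r\<le>k. qnum (Suc k) * xy_coeff a b (Suc k) r * ysum A B r) + qnum (Suc k) * ysum A B (Suc k)"
    by (intro arg_cong2[where f = "(+)"] sum.cong refl) (simp only: xy_coeff_recursion atMost_iff)
  also have "\<dots> = qnum (Suc k) * (\<Sum>r\<le>Suc k. xy_coeff a b (Suc k) r * ysum A B r)"
    by (simp add: xy_coeff_def sum_distrib_left distrib_left mult_ac)
  finally show ?case using tau_Suc[of k] tau1 by (simp add: qnum_def a_def b_def del: power_Suc sum.atMost_Suc)
qed

text \<open>
  With exactly one $x$ more than $y$, the binomial coefficients of 1 over $k - r$ vanish unless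
  $r = k$ or $r = k - 1$.
\<close>

corollary xsum_eq_ysum_Suc:
  assumes "good A B" and "card A = Suc (card B)"
  shows "xsum A B k = ysum A B k +
    (if k = 0 then 0 else \<tau> powi (int (card B) - int k + 1) * ysum A B (k - 1))"
proof -
  define c where "c = xy_coeff (int (card A)) (int (card B)) k"
  have z: "c r = 0" if "r + 1 < k" for r
  proof -
    have "(\<Prod>i<k - r. 1 - \<tau> powi (1 - int i)) = 0"
      by (rule prod_zero) (use that in \<open>auto intro!: bexI[of _ 1]\<close>)
    then show ?thesis by (simp add: c_def xy_coeff_def qbin_def assms)
  qed
  have c0: "c k = 1" by (simp add: c_def xy_coeff_def)
  show ?thesis
  proof (cases k)
    case 0
    then show ?thesis using xsum_eq_ysum[OF assms(1), of k] c0 by (simp add: c_def)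
  next
    case (Suc n)
    have c1: "c n = \<tau> powi (int (card B) - int k + 1)"
    proof -
      have "k - n = Suc 0" using Suc by simp
      then show ?thesis unfolding c_def xy_coeff_def qbin_def using assms tau1 Suc by simp
    qed
    have "(\<Sum>r\<le>k. c r * ysum A B r) = (\<Sum>r<n. c r * ysum A B r) + c n * ysum A B n + c k * ysum A B k"
      using Suc by (simp flip: lessThan_Suc_atMost)
    also have "(\<Sum>r<n. c r * ysum A B r) = 0"
      by (rule sum.neutral) (use z Suc in auto)
    finally show ?thesis using xsum_eq_ysum[OF assms(1), of k] Suc c0 c1 by (simp add: c_def)
  qed
qed

end

section \<open>Partitions as row functions\<close>

text \<open>
  Rows are counted from 0 and padded with zeros, so that strips become inequalities between
  functions on the natural numbers.
\<close>

definition part :: "int_partition \<Rightarrow> nat \<Rightarrow> nat" where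
  "part \<nu> i = (if i < length (parts \<nu>) then parts \<nu> ! i else 0)"

definition plen :: "int_partition \<Rightarrow> nat" where
  "plen \<nu> = length (parts \<nu>)"

definition colen :: "int_partition \<Rightarrow> nat \<Rightarrow> nat" where
  "colen \<nu> j = card {i. j < part \<nu> i}"

definition psize :: "int_partition \<Rightarrow> nat" where
  "psize \<nu> = card (diagram \<nu>)"

lemma part_eq_0_iff: "part \<nu> i = 0 \<longleftrightarrow> plen \<nu> \<le> i"
proof -
  have "0 \<notin> set (parts \<nu>)" using parts[of \<nu>] by simp
  then have "parts \<nu> ! i \<noteq> 0" if "i < length (parts \<nu>)" using that by (metis nth_mem)
  then show ?thesis by (auto simp: part_def plen_def)
qed

lemma part_eq_0 [simp]: "plen \<nu> \<le> i \<Longrightarrow> part \<nu> i = 0"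
  by (simp add: part_eq_0_iff)

lemma part_antimono: "i \<le> j \<Longrightarrow> part \<nu> j \<le> part \<nu> i"
  using parts[of \<nu>] by (auto simp: part_def sorted_wrt_iff_nth_less le_less)

lemma part_eqI: "(\<And>i. part \<mu> i = part \<nu> i) \<Longrightarrow> \<mu> = \<nu>"
proof -
  assume eq: "\<And>i. part \<mu> i = part \<nu> i"
  have "plen \<mu> = plen \<nu>" by (metis eq le_antisym le_refl part_eq_0_iff)
  then have "parts \<mu> = parts \<nu>"
  proof (intro nth_equalityI)
    fix i assume "i < length (parts \<mu>)"
    then show "parts \<mu> ! i = parts \<nu> ! i"
      using eq[of i] \<open>plen \<mu> = plen \<nu>\<close> by (simp add: part_def plen_def)
  qed (simp add: plen_def)
  then show ?thesis by (simp add: parts_inject)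
qed

text \<open>
  A partition is the same thing as a weakly decreasing function that reaches 0.
\<close>

lemma ex_part:
  assumes anti: "\<And>i. g (Suc i) \<le> g i" and zero: "g n = 0"
  shows "\<exists>\<nu>. part \<nu> = g"
proof -
  have mono: "g j \<le> g i" if "i \<le> j" for i j
    using lift_Suc_antimono_le[of g i j, OF anti that] .
  define k where "k = (LEAST n. g n = 0)"
  have k: "g k = 0" unfolding k_def by (rule LeastI) (rule zero)
  have pos: "g i \<noteq> 0" if "i < k" for i using not_less_Least[of i] that by (auto simp: k_def)
  define xs where "xs = map g [0..<k]"
  have "sorted_wrt (\<ge>) xs \<and> 0 \<notin> set xs"
  proof
    show "sorted_wrt (\<ge>) xs"
      by (auto simp: xs_def sorted_wrt_iff_nth_less intro: mono)
    show "0 \<notin> set xs" using pos by (force simp: xs_def)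
  qed
  then have p: "parts (Abs_int_partition xs) = xs" by (simp add: Abs_int_partition_inverse)
  have "part (Abs_int_partition xs) = g"
  proof
    fix i
    show "part (Abs_int_partition xs) i = g i"
      using mono[of k i] k unfolding part_def p by (auto simp: xs_def not_less)
  qed
  then show ?thesis by blast
qed

lemma mem_diagram [simp]: "(Suc i, Suc j) \<in> diagram \<nu> \<longleftrightarrow> j < part \<nu> i"
  by (auto simp: diagram_def part_def)

lemma zero_notin_diagram [simp]: "(0, j) \<notin> diagram \<nu>" "(i, 0) \<notin> diagram \<nu>"
  by (auto simp: diagram_def)

lemma diagramE:
  assumes "s \<in> diagram \<nu>"
  obtains i j where "s = (Suc i, Suc j)" "j < part \<nu> i"
proof -
  obtain a b where s: "s = (a, b)" by force
  with assms have "a \<noteq> 0" "b \<noteq> 0" by (auto simp: diagram_def)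
  then obtain i j where "a = Suc i" "b = Suc j" by (meson not0_implies_Suc)
  then show thesis using assms s that by auto
qed

lemma diagram_eq_image: "plen \<nu> \<le> n \<Longrightarrow>
    diagram \<nu> = (\<lambda>(i, j). (Suc i, Suc j)) ` (SIGMA i:{..<n}. {..<part \<nu> i})"
proof (intro equalityI subsetI)
  fix s assume n: "plen \<nu> \<le> n" and "s \<in> diagram \<nu>"
  then obtain i j where s: "s = (Suc i, Suc j)" "j < part \<nu> i" by (auto elim: diagramE)
  then have "i < n" using n part_eq_0_iff[of \<nu> i] by (metis le_trans not_less not_less0)
  then show "s \<in> (\<lambda>(i, j). (Suc i, Suc j)) ` (SIGMA i:{..<n}. {..<part \<nu> i})"
    using s by force
qed auto

lemma finite_diagram [simp]: "finite (diagram \<nu>)"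
  by (subst diagram_eq_image[OF order_refl]) auto

lemma psize_eq_sum: "plen \<nu> \<le> n \<Longrightarrow> psize \<nu> = (\<Sum>i<n. part \<nu> i)"
  unfolding psize_def by (subst diagram_eq_image, assumption, subst card_image) (auto simp: inj_on_def)

lemma diagram_subset_iff: "diagram \<mu> \<subseteq> diagram \<nu> \<longleftrightarrow> (\<forall>i. part \<mu> i \<le> part \<nu> i)"
proof
  assume "diagram \<mu> \<subseteq> diagram \<nu>"
  then show "\<forall>i. part \<mu> i \<le> part \<nu> i"
    by (metis mem_diagram subsetD leI less_irrefl)
next
  assume "\<forall>i. part \<mu> i \<le> part \<nu> i"
  then show "diagram \<mu> \<subseteq> diagram \<nu>" by (auto elim!: diagramE) (meson less_le_trans)
qed

lemma diagram_inject: "diagram \<mu> = diagram \<nu> \<longleftrightarrow> \<mu> = \<nu>"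
  by (metis diagram_subset_iff order_antisym order_refl part_eqI)

lemma psize_mono: "(\<And>i. part \<mu> i \<le> part \<nu> i) \<Longrightarrow> psize \<mu> \<le> psize \<nu>"
  unfolding psize_def by (rule card_mono) (auto simp: diagram_subset_iff)

lemma psize_eq_imp_eq: "(\<And>i. part \<mu> i \<le> part \<nu> i) \<Longrightarrow> psize \<mu> = psize \<nu> \<Longrightarrow> \<mu> = \<nu>"
  unfolding psize_def using card_subset_eq[of "diagram \<nu>" "diagram \<mu>"]
  by (auto simp: diagram_subset_iff diagram_inject)

lemma less_colen_iff: "i < colen \<nu> j \<longleftrightarrow> j < part \<nu> i"
proof -
  let ?S = "{i. j < part \<nu> i}"
  have fin: "finite ?S"
    by (rule finite_subset[of _ "{..<plen \<nu>}"]) (auto intro: not_le_imp_less)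
  have down: "i \<in> ?S" if "k \<in> ?S" "i \<le> k" for i k
    using that part_antimono[OF that(2), of \<nu>] by auto
  show ?thesis
  proof
    assume "j < part \<nu> i"
    then have "{..i} \<subseteq> ?S" using down by auto
    from card_mono[OF fin this] show "i < colen \<nu> j" by (simp add: colen_def)
  next
    assume less: "i < colen \<nu> j"
    show "j < part \<nu> i"
    proof (rule ccontr)
      assume "\<not> j < part \<nu> i"
      then have "?S \<subseteq> {..<i}" using down by (metis lessThan_iff mem_Collect_eq not_less subsetI)
      from card_mono[OF _ this] less show False by (simp add: colen_def)
    qed
  qed
qed

lemma colen_eqI: "j < part \<nu> r \<Longrightarrow> part \<nu> (Suc r) \<le> j \<Longrightarrow> colen \<nu> j = Suc r"
  by (metis Suc_leI le_antisym less_colen_iff not_less)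

lemma row_len_diagram [simp]: "row_len (diagram \<nu>) (Suc i) = part \<nu> i"
proof -
  have "{j. (Suc i, j) \<in> diagram \<nu>} = Suc ` {..<part \<nu> i}"
    by (auto elim: diagramE)
  then show ?thesis by (simp add: row_len_def card_image)
qed

lemma col_len_diagram [simp]: "col_len (diagram \<nu>) (Suc j) = colen \<nu> j"
proof -
  have "{i. (i, Suc j) \<in> diagram \<nu>} = Suc ` {i. j < part \<nu> i}"
    by (auto elim: diagramE)
  then show ?thesis by (simp add: col_len_def colen_def card_image)
qed

lemma part_empty [simp]: "part empty_partition i = 0"
  by (simp add: part_def empty_partition_def Abs_int_partition_inverse)

lemma diagram_empty [simp]: "diagram empty_partition = {}"
  by (auto elim: diagramE)

lemma psize_empty [simp]: "psize empty_partition = 0"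
  by (simp add: psize_def)

lemma plen_empty [simp]: "plen empty_partition = 0"
  by (simp add: plen_def empty_partition_def Abs_int_partition_inverse)

lemma psize_0_iff: "psize \<nu> = 0 \<longleftrightarrow> \<nu> = empty_partition"
  by (metis card_eq_0_iff diagram_empty diagram_inject finite_diagram psize_def)

lemma plen_le_iff: "plen \<nu> \<le> n \<longleftrightarrow> part \<nu> n = 0"
  by (simp add: part_eq_0_iff)

definition hstrip :: "int_partition \<Rightarrow> int_partition \<Rightarrow> bool" where
  "hstrip \<kappa> \<nu> \<longleftrightarrow> (\<forall>i. part \<kappa> i \<le> part \<nu> i \<and> part \<nu> (Suc i) \<le> part \<kappa> i)"

definition vstrip :: "int_partition \<Rightarrow> int_partition \<Rightarrow> bool" where
  "vstrip \<mu> \<nu> \<longleftrightarrow> (\<forall>i. part \<mu> i \<le> part \<nu> i \<and> part \<nu> i \<le> Suc (part \<mu> i))"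

lemma hstripD: "hstrip \<kappa> \<nu> \<Longrightarrow> part \<kappa> i \<le> part \<nu> i" "hstrip \<kappa> \<nu> \<Longrightarrow> part \<nu> (Suc i) \<le> part \<kappa> i"
  by (auto simp: hstrip_def)

lemma hstrip_plen: "hstrip \<kappa> \<nu> \<Longrightarrow> plen \<kappa> \<le> plen \<nu>" "hstrip \<kappa> \<nu> \<Longrightarrow> plen \<nu> \<le> Suc (plen \<kappa>)"
  by (metis hstripD(1) le_zero_eq part_eq_0 plen_le_iff order_refl)
     (metis hstripD(2) le_zero_eq part_eq_0 plen_le_iff order_refl)

lemma finite_plen_le: "finite {\<nu>. plen \<nu> \<le> n \<and> (\<forall>i. part \<nu> i \<le> m)}"
proof (rule finite_imageD)
  show "finite (part ` {\<nu>. plen \<nu> \<le> n \<and> (\<forall>i. part \<nu> i \<le> m)})"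
    by (rule finite_subset[OF _ finite_set_of_finite_funs[of "{..<n}" "{..m}" 0]])
      (auto simp: not_less)
  show "inj_on part {\<nu>. plen \<nu> \<le> n \<and> (\<forall>i. part \<nu> i \<le> m)}"
    by (auto intro!: inj_onI part_eqI)
qed

lemma psize_ge_plen: "plen \<nu> \<le> psize \<nu>"
proof -
  have "(\<Sum>i<plen \<nu>. 1) \<le> (\<Sum>i<plen \<nu>. part \<nu> i)"
    by (rule sum_mono) (metis One_nat_def Suc_leI lessThan_iff not_less not_gr_zero part_eq_0_iff)
  then show ?thesis using psize_eq_sum[of \<nu> "plen \<nu>"] by simp
qed

lemma part_le_psize: "part \<nu> i \<le> psize \<nu>"
proof -
  have "part \<nu> i \<le> (\<Sum>i<Suc i + plen \<nu>. part \<nu> i)" by (rule member_le_sum) auto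
  then show ?thesis using psize_eq_sum[of \<nu> "Suc i + plen \<nu>"] by simp
qed

lemma finite_psize: "finite {\<nu>. psize \<nu> \<le> n}"
  by (rule finite_subset[OF _ finite_plen_le[of n n]])
    (use psize_ge_plen part_le_psize le_trans in blast)

lemma finite_psize_eq: "finite {\<nu>. psize \<nu> = n}"
  by (rule finite_subset[OF _ finite_psize[of n]]) auto

section \<open>Arm-leg factors\<close>

locale macdonald =
  fixes q t :: real
  assumes q_bounds: "- 1 < q" "q < 1" and t_bounds: "- 1 < t" "t < 1"
begin

abbreviation psi :: "int_partition \<Rightarrow> int_partition \<Rightarrow> real" where
  "psi \<nu> \<mu> \<equiv> mac_psi q t (diagram \<nu>) (diagram \<mu>)"

abbreviation phi :: "int_partition \<Rightarrow> int_partition \<Rightarrow> real" where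
  "phi \<nu> \<mu> \<equiv> mac_phi q t (diagram \<nu>) (diagram \<mu>)"

lemma abs_qt_le: "\<bar>q ^ a * t ^ b\<bar> \<le> \<bar>q\<bar> ^ a" "\<bar>q ^ a * t ^ b\<bar> \<le> \<bar>t\<bar> ^ b"
proof -
  have "\<bar>q\<bar> ^ a \<le> 1" "\<bar>t\<bar> ^ b \<le> 1" using q_bounds t_bounds by (auto intro!: power_le_one)
  then show "\<bar>q ^ a * t ^ b\<bar> \<le> \<bar>q\<bar> ^ a" "\<bar>q ^ a * t ^ b\<bar> \<le> \<bar>t\<bar> ^ b"
    by (auto simp: abs_mult power_abs mult_left_le mult_left_le_one_le)
qed

lemma qt_less_1: "a + b > 0 \<Longrightarrow> \<bar>q ^ a * t ^ b\<bar> < 1"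
proof -
  assume "a + b > 0"
  then have "a > 0 \<or> b > 0" by auto
  moreover have "\<bar>q\<bar> < 1" "\<bar>t\<bar> < 1" using q_bounds t_bounds by auto
  ultimately have "\<bar>q\<bar> ^ a < 1 \<or> \<bar>t\<bar> ^ b < 1"
    using power_decreasing[of 1 a "\<bar>q\<bar>"] power_decreasing[of 1 b "\<bar>t\<bar>"] by fastforce
  then show ?thesis using abs_qt_le[of a b] by linarith
qed

lemma one_minus_qt_pos: "a + b > 0 \<Longrightarrow> 1 - q ^ a * t ^ b > 0"
  using qt_less_1[of a b] by linarith

lemma one_minus_qt_nz [simp]: "a + b > 0 \<Longrightarrow> 1 - q ^ a * t ^ b \<noteq> 0"
  using one_minus_qt_pos[of a b] by linarith

text \<open>
  The value of $b_\lambda$ at a box with arm length $a$ and leg length $l$.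
\<close>

definition arm_leg :: "nat \<Rightarrow> nat \<Rightarrow> real" where
  "arm_leg a l = (1 - q ^ a * t ^ (l + 1)) / (1 - q ^ (a + 1) * t ^ l)"

lemma arm_leg_pos: "arm_leg a l > 0"
  unfolding arm_leg_def by (intro divide_pos_pos one_minus_qt_pos) auto

text \<open>
  For $|q| < 1$ this is $f(q^a t^l) / f(t^l)$ with
  $f(u) = \prod_{n \ge 0} (1 - t u q^n) / (1 - q u q^n)$. The product of $b_\lambda$ over a part of
  a row on which the leg is constant telescopes to a quotient of two such values.
\<close>

definition ff :: "nat \<Rightarrow> nat \<Rightarrow> real" where
  "ff l a = (\<Prod>c<a. 1 / arm_leg c l)"

lemma ff_pos: "ff l a > 0"
  unfolding ff_def by (intro prod_pos) (auto simp: arm_leg_pos)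

lemma ff_nz [simp]: "ff l a \<noteq> 0" using ff_pos[of l a] by simp

lemma ff_0 [simp]: "ff l 0 = 1" by (simp add: ff_def)

lemma ff_Suc: "ff l (Suc a) = ff l a / arm_leg a l" by (simp add: ff_def)

lemma prod_arm_leg:
  assumes "c \<le> d" "d \<le> A"
  shows "(\<Prod>j\<in>{c..<d}. arm_leg (A - Suc j) l) = ff l (A - d) / ff l (A - c)"
  using assms
proof (induction d rule: dec_induct)
  case (step n)
  have "A - n = Suc (A - Suc n)" using step by simp
  then have "ff l (A - n) = ff l (A - Suc n) / arm_leg (A - Suc n) l" by (simp only: ff_Suc)
  then have "ff l (A - n) / ff l (A - c) * arm_leg (A - Suc n) l = ff l (A - Suc n) / ff l (A - c)"
    using arm_leg_pos[of "A - Suc n" l] by (simp add: field_simps)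
  then show ?case using step by simp
qed simp

lemma mac_b_diagram: "j < part \<nu> i \<Longrightarrow>
    mac_b q t (diagram \<nu>) (Suc i, Suc j) = arm_leg (part \<nu> i - Suc j) (colen \<nu> j - Suc i)"
  by (simp add: mac_b_def arm_leg_def)

lemma mac_b_pos: "mac_b q t (diagram \<nu>) s > 0"
proof (cases "s \<in> diagram \<nu>")
  case True
  then show ?thesis by (auto elim!: diagramE simp: mac_b_diagram arm_leg_pos)
qed (simp add: mac_b_def)

lemma mac_psi_pos: "psi \<nu> \<mu> > 0"
  unfolding mac_psi_def by (intro prod_pos) (auto simp: mac_b_pos)

lemma mac_phi_pos: "phi \<nu> \<mu> > 0"
  unfolding mac_phi_def by (intro prod_pos) (auto simp: mac_b_pos)

text \<open>
  The factor between the two normalisations $Q_\lambda = b_\lambda P_\lambda$ of the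
  Macdonald functions.
\<close>

definition bb :: "int_partition \<Rightarrow> real" where
  "bb \<nu> = (\<Prod>s\<in>diagram \<nu>. mac_b q t (diagram \<nu>) s)"

lemma bb_pos: "bb \<nu> > 0" unfolding bb_def by (intro prod_pos) (auto simp: mac_b_pos)

text \<open>
  A box that shares neither its row nor its column with an added box keeps its arm and
  leg, so $b$ at this box cancels from the quotient on the right. The other boxes outside $C$ lie
  in $R - C$, where $\psi$ provides the inverse factor.
\<close>

lemma mac_phi_eq_psi:
  assumes sub: "diagram \<mu> \<subseteq> diagram \<nu>"
  shows "phi \<nu> \<mu> = psi \<nu> \<mu> * bb \<nu> / bb \<mu>"
proof -
  let ?D = "diagram \<nu>" and ?E = "diagram \<mu>"
  let ?R = "skew_rows ?D ?E" and ?C = "skew_cols ?D ?E"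
  let ?r = "\<lambda>s. mac_b q t ?D s / mac_b q t ?E s"
  have RC: "?R \<subseteq> ?D" "?C \<subseteq> ?D" by (auto simp: skew_rows_def skew_cols_def)
  have "bb \<mu> = (\<Prod>s\<in>?D. mac_b q t ?E s)" unfolding bb_def
    by (rule prod.mono_neutral_left) (use sub in \<open>auto simp: mac_b_def\<close>)
  then have "bb \<nu> / bb \<mu> = (\<Prod>s\<in>?D. ?r s)" by (simp add: bb_def prod_dividef)
  also have "\<dots> = (\<Prod>s\<in>?C \<union> (?R - ?C). ?r s)"
  proof (rule prod.mono_neutral_right)
    show "\<forall>s\<in>?D - (?C \<union> (?R - ?C)). ?r s = 1"
    proof
      fix s assume s: "s \<in> ?D - (?C \<union> (?R - ?C))"
      then obtain i j where ij: "s = (Suc i, Suc j)" "j < part \<nu> i" by (auto elim: diagramE)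
      have row: "(Suc i, j') \<in> ?D \<longleftrightarrow> (Suc i, j') \<in> ?E" for j'
        using s ij sub by (auto simp: skew_rows_def)
      have col: "(i', Suc j) \<in> ?D \<longleftrightarrow> (i', Suc j) \<in> ?E" for i'
        using s ij sub by (auto simp: skew_cols_def)
      have "mac_b q t ?D s = mac_b q t ?E s"
        unfolding mac_b_def ij row_len_def col_len_def using row col by simp
      then show "?r s = 1" using mac_b_pos[of \<mu> s] by simp
    qed
  qed (use RC in auto)
  also have "\<dots> = (\<Prod>s\<in>?C. ?r s) * (\<Prod>s\<in>?R - ?C. ?r s)"
    by (rule prod.union_disjoint) (use RC finite_subset[OF _ finite_diagram[of \<nu>]] in auto)
  also have "(\<Prod>s\<in>?R - ?C. ?r s) = 1 / mac_psi q t ?D ?E"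
    by (simp add: mac_psi_def prod_dividef)
  also have "(\<Prod>s\<in>?C. ?r s) = mac_phi q t ?D ?E" by (simp add: mac_phi_def)
  finally show ?thesis using mac_psi_pos[of \<nu> \<mu>] by (simp add: field_simps)
qed

text \<open>
  In row $i$, the boxes of $\mu$ in columns of height $r + 1$ that receive no box form the interval
  from $\nu_{r+1}$ to $\mu_r$. The leg is $r - i$ on this interval in both diagrams, so the product
  over the interval telescopes. Rows without an added box may be included: they
  contribute 1.
\<close>

lemma mac_psi_hstrip:
  assumes hs: "hstrip \<mu> \<nu>" and N: "plen \<mu> \<le> N"
  shows "psi \<nu> \<mu> =
    (\<Prod>i<N. \<Prod>r\<in>{i..<N}.
      ff (r - i) (part \<mu> i - part \<mu> r) * ff (r - i) (part \<nu> i - part \<nu> (Suc r)) /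
      (ff (r - i) (part \<nu> i - part \<mu> r) * ff (r - i) (part \<mu> i - part \<nu> (Suc r))))"
proof -
  let ?D = "diagram \<nu>" and ?E = "diagram \<mu>"
  let ?R = "skew_rows ?D ?E" and ?C = "skew_cols ?D ?E"
  let ?f = "\<lambda>s. mac_b q t ?E s / mac_b q t ?D s"
  note hsD = hstripD[OF hs]
  define Sg where "Sg = (SIGMA i:{..<N}. SIGMA r:{i..<N}. {part \<nu> (Suc r)..<part \<mu> r})"
  define emb where "emb = (\<lambda>(i, r :: nat, j). (Suc i, Suc j))"
  have Sg: "j < part \<mu> r" "part \<nu> (Suc r) \<le> j" "i \<le> r" "j < part \<mu> i" "j < part \<nu> i"
      "colen \<mu> j = Suc r" "colen \<nu> j = Suc r" if "(i, r, j) \<in> Sg" for i r j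
  proof -
    show 1: "j < part \<mu> r" "part \<nu> (Suc r) \<le> j" "i \<le> r" using that by (auto simp: Sg_def)
    then show 2: "j < part \<mu> i" using part_antimono[of i r \<mu>] by simp
    then show "j < part \<nu> i" using hsD(1)[of i] by simp
    have "part \<mu> (Suc r) \<le> j" using 1 hsD(1)[of "Suc r"] by simp
    then show "colen \<mu> j = Suc r" using 1 by (intro colen_eqI)
    show "colen \<nu> j = Suc r" using 1 hsD(1)[of r] by (intro colen_eqI) auto
  qed
  have inj: "inj_on emb Sg"
  proof (rule inj_onI)
    fix a b assume ab: "a \<in> Sg" "b \<in> Sg" "emb a = emb b"
    obtain i r j where a: "a = (i, r, j)" by (cases a) auto
    obtain i' r' j' where b: "b = (i', r', j')" by (cases b) auto
    show "a = b" using ab Sg(6)[of i r j] Sg(6)[of i' r' j'] unfolding a b emb_def by simp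
  qed
  have sub: "?R - ?C \<subseteq> emb ` Sg"
  proof
    fix s assume s: "s \<in> ?R - ?C"
    then have "s \<in> ?D" by (auto simp: skew_rows_def)
    then obtain i j where ij: "s = (Suc i, Suc j)" "j < part \<nu> i" by (auto elim: diagramE)
    have col: "j < part \<mu> i'" if "j < part \<nu> i'" for i'
    proof (rule ccontr)
      assume "\<not> j < part \<mu> i'"
      then have "(Suc i', Suc j) \<in> ?D - ?E" using that by simp
      then have "s \<in> ?C" using ij by (auto simp: skew_cols_def intro: exI[of _ "Suc i'"])
      then show False using s by simp
    qed
    have i: "i < colen \<mu> j" using col[OF ij(2)] by (simp add: less_colen_iff)
    then obtain r where r: "colen \<mu> j = Suc r" by (cases "colen \<mu> j") auto
    then have "j < part \<mu> r" "\<not> j < part \<mu> (Suc r)" by (simp_all flip: less_colen_iff)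
    moreover have "part \<nu> (Suc r) \<le> j" using col[of "Suc r"] calculation(2) by (meson not_less)
    moreover have "r < N" using calculation(1) N by (metis le_trans not_less not_less0 part_eq_0)
    ultimately have "(i, r, j) \<in> Sg" using i r by (auto simp: Sg_def)
    then show "s \<in> emb ` Sg" using ij by (force simp: emb_def)
  qed
  have val: "?f (emb (i, r, j)) = arm_leg (part \<mu> i - Suc j) (r - i) / arm_leg (part \<nu> i - Suc j) (r - i)"
    if "(i, r, j) \<in> Sg" for i r j
    using Sg[OF that] by (simp add: emb_def mac_b_diagram)
  have "mac_psi q t ?D ?E = (\<Prod>s\<in>emb ` Sg. ?f s)"
    unfolding mac_psi_def
  proof (rule prod.mono_neutral_left[OF _ sub])
    show "finite (emb ` Sg)" by (auto simp: Sg_def)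
    show "\<forall>s\<in>emb ` Sg - (?R - ?C). ?f s = 1"
    proof
      fix s assume s: "s \<in> emb ` Sg - (?R - ?C)"
      then obtain i r j where irj: "(i, r, j) \<in> Sg" and s': "s = emb (i, r, j)" by auto
      have sD: "s \<in> ?D" using Sg[OF irj] by (simp add: s' emb_def)
      have "s \<notin> ?C"
      proof
        assume "s \<in> ?C"
        then obtain i' where "(Suc i', Suc j) \<in> ?D - ?E"
          unfolding skew_cols_def s' emb_def by (auto elim: diagramE)
        then have "i' < colen \<nu> j" "\<not> i' < colen \<mu> j" by (auto simp: less_colen_iff)
        then show False using Sg(6,7)[OF irj] by simp
      qed
      then have "s \<notin> ?R" using s by auto
      then have "\<not> part \<mu> i < part \<nu> i"
      proof (rule contrapos_nn)
        assume "part \<mu> i < part \<nu> i"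
        then have "(Suc i, Suc (part \<mu> i)) \<in> ?D - ?E" by simp
        then show "s \<in> ?R" using sD unfolding skew_rows_def s' emb_def prod.case by blast
      qed
      then have "part \<mu> i = part \<nu> i" using hsD(1)[of i] by simp
      then show "?f s = 1" unfolding s' val[OF irj] using arm_leg_pos[of "part \<nu> i - Suc j" "r - i"] by simp
    qed
  qed
  also have "\<dots> = (\<Prod>x\<in>Sg. ?f (emb x))" by (rule prod.reindex_cong[OF inj]) auto
  also have "\<dots> = (\<Prod>(i, r, j)\<in>Sg. arm_leg (part \<mu> i - Suc j) (r - i) / arm_leg (part \<nu> i - Suc j) (r - i))"
    by (rule prod.cong) (auto simp: val)
  also have "\<dots> = (\<Prod>i<N. \<Prod>r\<in>{i..<N}. \<Prod>j\<in>{part \<nu> (Suc r)..<part \<mu> r}.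
      arm_leg (part \<mu> i - Suc j) (r - i) / arm_leg (part \<nu> i - Suc j) (r - i))"
    unfolding Sg_def by (simp add: prod.Sigma)
  also have "\<dots> = (\<Prod>i<N. \<Prod>r\<in>{i..<N}.
      ff (r - i) (part \<mu> i - part \<mu> r) * ff (r - i) (part \<nu> i - part \<nu> (Suc r)) /
      (ff (r - i) (part \<nu> i - part \<mu> r) * ff (r - i) (part \<mu> i - part \<nu> (Suc r))))"
  proof (intro prod.cong refl)
    fix i r assume "r \<in> {i..<N}"
    then have ir: "i \<le> r" by simp
    have c: "part \<nu> (Suc r) \<le> part \<mu> r" by (rule hsD(2))
    have d: "part \<mu> r \<le> part \<mu> i" by (rule part_antimono[OF ir])
    have e: "part \<mu> r \<le> part \<nu> i" using d hsD(1)[of i] by simp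
    show "(\<Prod>j\<in>{part \<nu> (Suc r)..<part \<mu> r}.
        arm_leg (part \<mu> i - Suc j) (r - i) / arm_leg (part \<nu> i - Suc j) (r - i)) =
      ff (r - i) (part \<mu> i - part \<mu> r) * ff (r - i) (part \<nu> i - part \<nu> (Suc r)) /
      (ff (r - i) (part \<nu> i - part \<mu> r) * ff (r - i) (part \<mu> i - part \<nu> (Suc r)))"
      unfolding prod_dividef prod_arm_leg[OF c d] prod_arm_leg[OF c e] by simp
  qed
  finally show ?thesis .
qed

text \<open>
  The factor for one row that receives a box and a row, $l$ rows above it, that does not; $c$ and
  $d$ are the differences of their lengths before and after.
\<close>

definition vf :: "nat \<Rightarrow> nat \<Rightarrow> nat \<Rightarrow> real" where
  "vf c d l = (1 - q ^ c * t ^ (l - 1)) * (1 - q ^ d * t ^ (l + 1)) /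
    ((1 - q ^ c * t ^ l) * (1 - q ^ d * t ^ l))"

text \<open>
  Macdonald's $\psi'_{\nu/\mu}$, the coefficient of $P_\nu$ in $e_k P_\mu$ for a vertical strip
  $\nu / \mu$.
\<close>

definition vpsi :: "int_partition \<Rightarrow> int_partition \<Rightarrow> real" where
  "vpsi \<nu> \<mu> = (\<Prod>b | part \<nu> b \<noteq> part \<mu> b. \<Prod>a | a < b \<and> part \<nu> a = part \<mu> a.
     vf (part \<mu> a - part \<mu> b) (part \<nu> a - part \<nu> b) (b - a))"

text \<open>
  The same coefficient in the $Q$ normalisation.
\<close>

definition pieri :: "int_partition \<Rightarrow> int_partition \<Rightarrow> real" where
  "pieri \<nu> \<mu> = vpsi \<nu> \<mu> * bb \<mu> / bb \<nu>"

lemma add_boxE: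
  assumes "\<mu> \<nearrow> \<nu>"
  obtains m where "\<And>i. part \<nu> i = (if i = m then Suc (part \<mu> m) else part \<mu> i)"
proof -
  obtain s where s: "s \<notin> diagram \<mu>" "diagram \<nu> = insert s (diagram \<mu>)"
    using assms by (auto simp: add_box_def)
  then obtain m j where mj: "s = (Suc m, Suc j)" "j < part \<nu> m"
    by (metis diagramE insertI1)
  have iff: "b < part \<nu> a \<longleftrightarrow> b < part \<mu> a \<or> (a = m \<and> b = j)" for a b
    using s(2) mj(1) by (metis Pair_inject insert_iff mem_diagram nat.inject)
  have j: "j = part \<mu> m"
  proof (rule linorder_cases[of "part \<mu> m" j])
    assume less: "part \<mu> m < j"
    then have "part \<mu> m < part \<nu> m" using mj(2) by simp
    then show ?thesis using iff[of "part \<mu> m" m] less by simp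
  qed (use s(1) mj(1) in auto)
  have "part \<nu> i = (if i = m then Suc (part \<mu> m) else part \<mu> i)" for i
  proof (cases "i = m")
    case True
    have "part \<nu> m = Suc j" using iff[of _ m] j
      by (metis less_Suc_eq linorder_neqE_nat less_irrefl)
    then show ?thesis using True j by simp
  next
    case False
    then show ?thesis using iff[of _ i] by (metis less_irrefl linorder_neqE_nat)
  qed
  then show thesis by (rule that)
qed

lemma arm_leg_ratio: "arm_leg d (Suc l) / arm_leg d l = vf (Suc d) d (Suc l)"
  unfolding arm_leg_def vf_def by (simp add: mult_ac)

text \<open>
  Adding one box lengthens the legs of the boxes above it, which yields the factors \<open>vf\<close>;
  the added box itself has arm and leg 0 and contributes $(1 - t) / (1 - q)$.
\<close>

lemma mac_phi_add_box:
  assumes "\<mu> \<nearrow> \<nu>"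
  shows "phi \<nu> \<mu> = vpsi \<nu> \<mu> * ((1 - t) / (1 - q))"
proof -
  obtain m where m: "\<And>i. part \<nu> i = (if i = m then Suc (part \<mu> m) else part \<mu> i)"
    using add_boxE[OF assms] by metis
  define j where "j = part \<mu> m"
  have cn: "colen \<nu> j = Suc m"
  proof (rule colen_eqI)
    show "j < part \<nu> m" by (simp add: m j_def)
    show "part \<nu> (Suc m) \<le> j" using part_antimono[of m "Suc m" \<mu>] by (simp add: m j_def)
  qed
  have less: "j < part \<mu> i" if "i < m" for i
    using part_antimono[of i m \<nu>] that m[of i] m[of m] by (simp add: j_def)
  have cm: "colen \<mu> j = m"
  proof (cases m)
    case 0
    then show ?thesis using less_colen_iff[of 0 \<mu> j] by (simp add: j_def)
  next
    case (Suc r)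
    then show ?thesis using less[of r] by (intro colen_eqI[of j \<mu> r, THEN trans]) (auto simp: j_def)
  qed
  have C: "skew_cols (diagram \<nu>) (diagram \<mu>) = (\<lambda>i. (Suc i, Suc j)) ` {..m}"
  proof (intro equalityI subsetI)
    fix s assume s: "s \<in> skew_cols (diagram \<nu>) (diagram \<mu>)"
    then have "s \<in> diagram \<nu>" by (auto simp: skew_cols_def)
    then obtain a b where ab: "s = (Suc a, Suc b)" "b < part \<nu> a" by (auto elim: diagramE)
    obtain i' where "(i', Suc b) \<in> diagram \<nu> - diagram \<mu>" using s ab by (auto simp: skew_cols_def)
    then obtain a' where "b < part \<nu> a'" "\<not> b < part \<mu> a'" by (auto elim!: diagramE)
    then have "b = j" using m[of a'] by (auto simp: j_def split: if_splits)
    then have "a < Suc m" using ab cn less_colen_iff[of a \<nu> j] by simp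
    then show "s \<in> (\<lambda>i. (Suc i, Suc j)) ` {..m}" using ab \<open>b = j\<close> by auto
  next
    fix s assume "s \<in> (\<lambda>i. (Suc i, Suc j)) ` {..m}"
    then obtain i where i: "i \<le> m" "s = (Suc i, Suc j)" by auto
    then have "s \<in> diagram \<nu>" using cn less_colen_iff[of i \<nu> j] by simp
    moreover have "(Suc m, Suc j) \<in> diagram \<nu> - diagram \<mu>" by (simp add: m j_def)
    ultimately show "s \<in> skew_cols (diagram \<nu>) (diagram \<mu>)" using i(2) unfolding skew_cols_def by blast
  qed
  let ?r = "\<lambda>s. mac_b q t (diagram \<nu>) s / mac_b q t (diagram \<mu>) s"
  have "phi \<nu> \<mu> = (\<Prod>i\<le>m. ?r (Suc i, Suc j))"
    unfolding mac_phi_def C by (rule prod.reindex_cong[of "\<lambda>i. (Suc i, Suc j)"]) (auto simp: inj_on_def)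
  also have "\<dots> = (\<Prod>i<m. ?r (Suc i, Suc j)) * ?r (Suc m, Suc j)"
    by (simp flip: lessThan_Suc_atMost)
  also have "?r (Suc m, Suc j) = (1 - t) / (1 - q)"
  proof -
    have "mac_b q t (diagram \<mu>) (Suc m, Suc j) = 1" by (simp add: mac_b_def j_def)
    moreover have "mac_b q t (diagram \<nu>) (Suc m, Suc j) = arm_leg 0 0"
      using m[of m] by (subst mac_b_diagram) (simp_all add: cn[unfolded j_def] j_def)
    ultimately show ?thesis by (simp add: arm_leg_def)
  qed
  also have "(\<Prod>i<m. ?r (Suc i, Suc j)) = (\<Prod>i<m. vf (part \<mu> i - part \<mu> m) (part \<nu> i - part \<nu> m) (m - i))"
  proof (rule prod.cong, goal_cases)
    case (2 i)
    then have i: "i < m" by simp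
    define l where "l = m - Suc i"
    define d where "d = part \<mu> i - Suc j"
    have l: "m - i = Suc l" using i by (simp add: l_def)
    have d: "part \<mu> i - part \<mu> m = Suc d" "part \<nu> i - part \<nu> m = d"
      using less[OF i] i m[of i] m[of m] by (simp_all add: d_def j_def)
    have "mac_b q t (diagram \<mu>) (Suc i, Suc j) = arm_leg d l"
      using less[OF i] by (simp add: mac_b_diagram cm d_def l_def)
    moreover have "mac_b q t (diagram \<nu>) (Suc i, Suc j) = arm_leg d (Suc l)"
      using less[OF i] i m[of i] l by (simp add: mac_b_diagram cn d_def)
    ultimately show ?case by (simp add: arm_leg_ratio d l)
  qed simp
  also have "\<dots> = vpsi \<nu> \<mu>"
  proof -
    have "{b. part \<nu> b \<noteq> part \<mu> b} = {m}" using m by auto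
    moreover have "{a. a < m \<and> part \<nu> a = part \<mu> a} = {..<m}" using m by auto
    ultimately show ?thesis by (simp add: vpsi_def)
  qed
  finally show ?thesis .
qed

text \<open>
  The edge weights of the Young graph are, up to the scalar that normalises $h_1$, the Pieri
  coefficients for $e_1$.
\<close>

lemma mac_psi_add_box:
  assumes "\<mu> \<nearrow> \<nu>"
  shows "psi \<nu> \<mu> = (1 - t) / (1 - q) * pieri \<nu> \<mu>"
proof -
  have "diagram \<mu> \<subseteq> diagram \<nu>" using assms by (auto simp: add_box_def)
  from mac_phi_eq_psi[OF this] mac_phi_add_box[OF assms] show ?thesis
    using bb_pos[of \<mu>] bb_pos[of \<nu>] q_bounds unfolding pieri_def by (auto simp: divide_simps mult_ac)
qed

end

section \<open>Products over pairs of indices\<close>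

lemma prod_triangle_le:
  fixes N :: nat
  shows "(\<Prod>i<N. \<Prod>r\<in>{i..<N}. g i r) = (\<Prod>i\<le>N. \<Prod>r<N. if i \<le> r then g i r else (1::'a::comm_monoid_mult))"
proof -
  have 1: "(\<Prod>r\<in>{i..<N}. g i r) = (\<Prod>r<N. if i \<le> r then g i r else 1)" for i
    by (rule prod.mono_neutral_cong_left) auto
  show ?thesis unfolding 1 lessThan_Suc_atMost[symmetric] by simp
qed

lemma prod_triangle_transpose:
  "(\<Prod>i<N. \<Prod>r\<in>{i..<N}. h (Suc r) i) = (\<Prod>i\<le>N. \<Prod>m<N. if m < i then h i m else (1::'a::comm_monoid_mult))"
proof -
  have "(\<Prod>i<N. \<Prod>r\<in>{i..<N}. h (Suc r) i) = (\<Prod>m<N. \<Prod>i\<le>N. if m < i then h i m else 1)"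
  proof (rule prod.cong, goal_cases)
    case (2 m)
    have "(\<Prod>r\<in>{m..<N}. h (Suc r) m) = (\<Prod>i\<in>Suc ` {m..<N}. h i m)"
      by (subst prod.reindex) auto
    also have "\<dots> = (\<Prod>i\<le>N. if m < i then h i m else 1)"
      by (rule prod.mono_neutral_cong_left) (auto simp: image_Suc_atLeastLessThan)
    finally show ?case .
  qed simp
  then show ?thesis by (simp add: prod.swap[of _ "{..<N}"])
qed

lemma prod_triangle_Suc:
  "(\<Prod>i<N. \<Prod>r\<in>{i..<N}. f i (Suc r)) = (\<Prod>a\<le>N. \<Prod>b\<le>N. if a < b then f a b else (1::'a::comm_monoid_mult))"
proof -
  have 1: "(\<Prod>r\<in>{i..<N}. f i (Suc r)) = (\<Prod>b\<le>N. if i < b then f i b else 1)" for i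
  proof -
    have "(\<Prod>r\<in>{i..<N}. f i (Suc r)) = (\<Prod>b\<in>Suc ` {i..<N}. f i b)" by (subst prod.reindex) auto
    also have "\<dots> = (\<Prod>b\<le>N. if i < b then f i b else 1)"
      by (rule prod.mono_neutral_cong_left) (auto simp: image_Suc_atLeastLessThan)
    finally show ?thesis .
  qed
  have "(\<Prod>b\<le>N. if N < b then f N b else 1) = 1" by (rule prod.neutral) auto
  then show ?thesis unfolding 1 lessThan_Suc_atMost[symmetric] by simp
qed

text \<open>
  A product over unordered pairs of a factor for each of the two orders is a product over
  ordered pairs. The weights of strips come in the first form, the terms of subset sums in the
  second.
\<close>

lemma prod_unordered_pairs:
  fixes G :: "nat \<Rightarrow> nat \<Rightarrow> 'a::comm_monoid_mult"
  assumes "\<And>a. G a a = 1" and fin: "finite A"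
  shows "(\<Prod>a\<in>A. \<Prod>b\<in>A. if a < b then G a b * G b a else 1) = (\<Prod>a\<in>A. \<Prod>b\<in>A. G a b)"
proof -
  have "(\<Prod>a\<in>A. \<Prod>b\<in>A. if a < b then G a b * G b a else 1) =
      (\<Prod>a\<in>A. \<Prod>b\<in>A. if a < b then G a b else 1) * (\<Prod>a\<in>A. \<Prod>b\<in>A. if a < b then G b a else 1)"
    unfolding prod.distrib[symmetric] by (intro prod.cong refl) auto
  also have "(\<Prod>a\<in>A. \<Prod>b\<in>A. if a < b then G b a else 1) = (\<Prod>a\<in>A. \<Prod>b\<in>A. if b < a then G a b else 1)"
    by (rule prod.swap)
  also have "(\<Prod>a\<in>A. \<Prod>b\<in>A. if a < b then G a b else 1) * \<dots> = (\<Prod>a\<in>A. \<Prod>b\<in>A. G a b)"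
    unfolding prod.distrib[symmetric]
    by (intro prod.cong refl) (use assms(1) in \<open>auto simp: not_less intro: antisym\<close>)
  finally show ?thesis .
qed

lemma prod_less_pairs_in:
  fixes z :: "'a::comm_monoid_mult"
  assumes "finite (I :: nat set)"
  shows "(\<Prod>i\<in>I. \<Prod>j\<in>I. if i < j then z else 1) = z ^ (card I choose 2)"
  using assms
proof (induction I rule: finite_linorder_max_induct)
  case (insert b A)
  have bA: "b \<notin> A" using insert by auto
  have 1: "(\<Prod>j\<in>insert b A. if i < j then z else 1) = z * (\<Prod>j\<in>A. if i < j then z else 1)" if "i \<in> A" for i
    using insert.hyps bA that by auto
  have 2: "(\<Prod>j\<in>insert b A. if b < j then z else 1) = 1"
    using insert.hyps by (intro prod.neutral) auto
  have "(\<Prod>i\<in>insert b A. \<Prod>j\<in>insert b A. if i < j then z else 1)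
      = (\<Prod>i\<in>A. z * (\<Prod>j\<in>A. if i < j then z else 1))"
    using insert bA by (subst prod.insert) (auto simp only: 1 2 mult_1 intro!: prod.cong)
  also have "\<dots> = z ^ (card A + (card A choose 2))"
    using insert by (simp add: prod.distrib power_add)
  also have "card A + (card A choose 2) = (card (insert b A) choose 2)"
    using insert bA by (simp add: numeral_2_eq_2)
  finally show ?case .
qed (simp add: numeral_2_eq_2)

lemma prod_split_subset:
  assumes "finite A" "I \<subseteq> A"
  shows "(\<Prod>j\<in>A. f j) = (\<Prod>j\<in>A - I. f j) * (\<Prod>j\<in>I. f j)"
  by (rule prod.subset_diff) (use assms in auto)

lemma prod_const_power: "finite A \<Longrightarrow> (\<Prod>j\<in>A. if P j then z else 1) = z ^ card {j \<in> A. P j}"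
  by (simp flip: prod_constant add: prod.inter_filter)

text \<open>
  Without the restriction to $j \notin I$, every $i \in I$ would contribute $N - i$ factors from
  the $j > i$ and $i$ factors from the $m < i$, so $N$ in total; the pairs inside $I$ are missing.
\<close>

lemma weight_exponent_x:
  fixes z :: "'a::comm_monoid_mult"
  assumes "I \<subseteq> {..N}"
  shows "(\<Prod>i\<in>I. (\<Prod>j\<in>{..N} - I. if i < j then z else 1) * (\<Prod>m<N. if m < i then z else 1))
    * z ^ (card I choose 2) = z ^ (card I * N)"
proof -
  have fI: "finite I" using assms finite_subset by blast
  have "(\<Prod>i\<in>I. (\<Prod>j\<in>{..N} - I. if i < j then z else 1) * (\<Prod>m<N. if m < i then z else 1))
    * z ^ (card I choose 2) =
    (\<Prod>i\<in>I. (\<Prod>j\<le>N. if i < j then z else 1) * (\<Prod>m<N. if m < i then z else 1))"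
    unfolding prod_less_pairs_in[OF fI, symmetric] prod_split_subset[OF finite_atMost assms]
    by (simp add: prod.distrib mult_ac)
  also have "\<dots> = (\<Prod>i\<in>I. z ^ N)"
  proof (rule prod.cong, goal_cases)
    case (2 i)
    then have i: "i \<le> N" using assms by auto
    have "{j \<in> {..N}. i < j} = {i<..N}" "{m \<in> {..<N}. m < i} = {..<i}" using i by auto
    then show ?case using i by (simp add: prod_const_power flip: power_add)
  qed simp
  also have "\<dots> = z ^ (card I * N)" by (simp add: power_mult mult.commute)
  finally show ?thesis .
qed

lemma weight_exponent_y:
  fixes z :: "'a::comm_monoid_mult"
  assumes "J \<subseteq> {..<N}"
  shows "(\<Prod>j\<in>J. (\<Prod>a\<in>{..<N} - J. if a < j then z else 1) * (\<Prod>i\<le>N. if j < i then z else 1))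
    * z ^ (card J choose 2) = z ^ (card J * N)"
proof -
  have fJ: "finite J" using assms finite_subset by blast
  have sw: "(\<Prod>j\<in>J. \<Prod>a\<in>J. if a < j then z else 1) = (\<Prod>i\<in>J. \<Prod>j\<in>J. if i < j then z else 1)"
    by (rule prod.swap)
  have "(\<Prod>j\<in>J. (\<Prod>a\<in>{..<N} - J. if a < j then z else 1) * (\<Prod>i\<le>N. if j < i then z else 1))
    * z ^ (card J choose 2) =
    (\<Prod>j\<in>J. (\<Prod>a<N. if a < j then z else 1) * (\<Prod>i\<le>N. if j < i then z else 1))"
    unfolding prod_less_pairs_in[OF fJ, symmetric] sw[symmetric] prod_split_subset[OF finite_lessThan assms]
    by (simp add: prod.distrib mult_ac)
  also have "\<dots> = (\<Prod>j\<in>J. z ^ N)"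
  proof (rule prod.cong, goal_cases)
    case (2 j)
    then have j: "j < N" using assms by auto
    have "{a \<in> {..<N}. a < j} = {..<j}" "{i \<in> {..N}. j < i} = {j<..N}" using j by auto
    then show ?case using j by (simp add: prod_const_power flip: power_add)
  qed simp
  also have "\<dots> = z ^ (card J * N)" by (simp add: power_mult mult.commute)
  finally show ?thesis .
qed

lemma prod_triangle_less:
  fixes N :: nat
  assumes "\<And>i. g i i = 1"
  shows "(\<Prod>i<N. \<Prod>r\<in>{i..<N}. g i r) = (\<Prod>a<N. \<Prod>b<N. if a < b then g a b else (1::'a::comm_monoid_mult))"
proof (rule prod.cong, goal_cases)
  case (2 i)
  show ?case
    by (rule prod.mono_neutral_cong_left) (use assms in \<open>auto simp: not_less intro: antisym\<close>)
qed simp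

lemma prod_indicator:
  fixes A :: "'a set"
  assumes "finite A" "I \<subseteq> A"
  shows "(\<Prod>i\<in>A. if i \<in> I then f i else (1::'b::comm_monoid_mult)) = (\<Prod>i\<in>I. f i)"
  using assms by (simp add: prod.inter_restrict[symmetric] inf_absorb2)

definition of_part :: "(nat \<Rightarrow> nat) \<Rightarrow> int_partition" where
  "of_part g = (THE \<nu>. part \<nu> = g)"

lemma part_of_part:
  assumes "\<And>i. g (Suc i) \<le> g i" "g n = 0"
  shows "part (of_part g) = g"
proof -
  obtain \<nu> where \<nu>: "part \<nu> = g" using ex_part[of g n] assms by blast
  have "of_part g = \<nu>" unfolding of_part_def
    by (rule the_equality[of _ \<nu>]) (use \<nu> in \<open>auto intro!: part_eqI dest: fun_cong\<close>)
  then show ?thesis using \<nu> by simp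
qed

lemma of_part_part [simp]: "of_part (part \<nu>) = \<nu>"
  unfolding of_part_def by (rule the_equality) (auto intro!: part_eqI dest: fun_cong)

section \<open>Strip weights as subset sums\<close>

text \<open>
  Two partitions that admit a common $\nu$ with $\nu / \mu$ a vertical and $\nu / \lambda$ a
  horizontal strip, or a common $\kappa$ with $\mu / \kappa$ horizontal and $\lambda / \kappa$
  vertical, must interlace as assumed here. Independence of $q$ and $t$ excludes all coincidences
  between the variables of the subset sums except those for the rows in \<open>S\<close> below.
\<close>

locale strip_pair = macdonald +
  fixes la mu :: int_partition and N :: nat
  assumes q0: "q \<noteq> 0" and t0: "t \<noteq> 0"
    and generic: "\<And>a b c d. q ^ a * t ^ b = q ^ c * t ^ d \<Longrightarrow> a = c \<and> b = d"
    and la_le: "\<And>i. part la i \<le> Suc (part mu i)"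
    and mu_le: "\<And>i. part mu (Suc i) \<le> part la i"
    and len_la: "plen la \<le> N" and len_mu: "plen mu \<le> N"
begin

definition X :: "nat \<Rightarrow> real" where "X i = q ^ part mu i / t ^ i"
definition Y :: "nat \<Rightarrow> real" where "Y j = q ^ part la j / (q * t ^ j)"

sublocale ss: subset_sums "t / q" X Y
proof
  show "t / q \<noteq> 0" using q0 t0 by simp
  fix n :: nat assume "n > 0"
  show "(t / q) ^ n \<noteq> 1"
  proof
    assume "(t / q) ^ n = 1"
    then have "q ^ 0 * t ^ n = q ^ n * t ^ 0" using q0 by (simp add: power_divide)
    from generic[OF this] show False using \<open>n > 0\<close> by simp
  qed
qed

text \<open>
  The rows in which $\lambda$ sticks out of $\mu$. They belong to every admissible set of rows, on
  both sides of the identity.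
\<close>

definition S :: "nat set" where "S = {i. part la i = Suc (part mu i)}"

text \<open>
  For $i \in S$ the variables $X_i$ and $Y_i$ coincide and the factor has a pole. It would occur
  in every term of both sums, so it may be replaced by 1.
\<close>

definition cross :: "nat \<Rightarrow> nat \<Rightarrow> real" where
  "cross i m = (if i = m \<and> i \<in> S then 1 else ss.v (X i) (Y m))"

lemma S_subset: "S \<subseteq> {..<N}"
proof
  fix i assume "i \<in> S"
  then have "part la i \<noteq> 0" by (simp add: S_def)
  then show "i \<in> {..<N}" using len_la part_eq_0[of la i] by (meson le_trans lessThan_iff not_less)
qed

lemma not_S: "i \<notin> S \<Longrightarrow> part la i \<le> part mu i"
  using la_le[of i] by (auto simp: S_def)

lemma mu_le': "i < j \<Longrightarrow> part mu j \<le> part la i"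
  using mu_le[of i] part_antimono[of "Suc i" j mu] by simp

lemma X_nz: "X i \<noteq> 0" and Y_nz: "Y i \<noteq> 0"
  using q0 t0 by (simp_all add: X_def Y_def)

lemma v_lower: "x \<noteq> 0 \<Longrightarrow> ss.v (w * x) x = (1 - (t / q) * w) / (1 - w)"
  unfolding ss.v_def by (cases "w = 1") (simp_all add: field_simps)

lemma v_upper: "x \<noteq> 0 \<Longrightarrow> ss.v x (w * x) = (w - t / q) / (w - 1)"
  unfolding ss.v_def by (cases "w = 1") (simp_all add: field_simps)

lemma arm_leg_eq: "arm_leg c l = (1 - (t / q) * (q ^ Suc c * t ^ l)) / (1 - q ^ Suc c * t ^ l)"
  using q0 by (simp add: arm_leg_def mult_ac)

lemma inverse_arm_leg_eq: "1 / arm_leg c l = (q ^ c * t ^ Suc l - t / q) / (q ^ c * t ^ Suc l - 1) * (q / t)"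
proof -
  have "1 - q ^ c * t ^ Suc l \<noteq> 0" "1 - q ^ Suc c * t ^ l \<noteq> 0" by (rule one_minus_qt_nz; simp)+
  then show ?thesis using q0 t0 by (simp add: arm_leg_def divide_simps) (simp add: algebra_simps)
qed

lemma X_ratio: "a \<le> b \<Longrightarrow> X a = q ^ (part mu a - part mu b) * t ^ (b - a) * X b"
proof -
  assume ab: "a \<le> b"
  then obtain c l where "part mu a = part mu b + c" "b = a + l"
    using part_antimono[OF ab, of mu] by (metis le_Suc_ex)
  then show ?thesis using t0 by (simp add: X_def power_add)
qed

lemma Y_ratio: "a \<le> b \<Longrightarrow> Y a = q ^ (part la a - part la b) * t ^ (b - a) * Y b"
proof -
  assume ab: "a \<le> b"
  then obtain c l where "part la a = part la b + c" "b = a + l"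
    using part_antimono[OF ab, of la] by (metis le_Suc_ex)
  then show ?thesis using t0 by (simp add: Y_def power_add)
qed

lemma XY_ratio: "i \<le> m \<Longrightarrow> part la m \<le> Suc (part mu i) \<Longrightarrow>
    X i = q ^ (Suc (part mu i) - part la m) * t ^ (m - i) * Y m"
proof -
  assume "i \<le> m" "part la m \<le> Suc (part mu i)"
  then obtain c l where c: "Suc (part mu i) = part la m + c" and l: "m = i + l"
    by (metis le_Suc_ex)
  have "q * q ^ part mu i = q ^ part la m * q ^ c" by (metis c power_Suc power_add)
  then have "q ^ part mu i = q ^ part la m * q ^ c / q" using q0 by (simp add: field_simps)
  then show ?thesis using t0 q0 c l by (simp add: X_def Y_def power_add)
qed

lemma YX_ratio: "m < i \<Longrightarrow> part mu i < part la m \<Longrightarrow>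
    Y m = q ^ (part la m - Suc (part mu i)) * t ^ (i - m) * X i"
proof -
  assume "m < i" "part mu i < part la m"
  then obtain c l where "part la m = Suc (part mu i + c)" "i = m + l"
    by (metis less_imp_Suc_add le_Suc_ex less_imp_le)
  then show ?thesis using t0 q0 by (simp add: X_def Y_def power_add)
qed

definition z :: real where "z = q / t"

lemma z_nz: "z \<noteq> 0"
  using q0 t0 by (simp add: z_def)

definition nuI :: "nat set \<Rightarrow> nat \<Rightarrow> nat" where
  "nuI I i = part mu i + (if i \<in> I then 1 else 0)"
definition kaJ :: "nat set \<Rightarrow> nat \<Rightarrow> nat" where
  "kaJ J j = part la j - (if j \<in> J then 1 else 0)"

definition validI :: "nat set \<Rightarrow> bool" where
  "validI I \<longleftrightarrow> S \<subseteq> I \<and> I \<subseteq> {..N} \<and> (\<forall>i. Suc i \<in> I \<longrightarrow> part mu (Suc i) < part la i)"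
definition validJ :: "nat set \<Rightarrow> bool" where
  "validJ J \<longleftrightarrow> S \<subseteq> J \<and> J \<subseteq> {..<N} \<and> (\<forall>j\<in>J. part mu (Suc j) < part la j)"

lemma validI_less: "validI I \<Longrightarrow> m < i \<Longrightarrow> i \<in> I \<Longrightarrow> part mu i < part la m"
proof -
  assume a: "validI I" "m < i" "i \<in> I"
  then obtain i' where i: "i = Suc i'" "m \<le> i'" by (metis less_Suc_eq_le not0_implies_Suc not_less0)
  then show ?thesis using a part_antimono[of m i' la] by (fastforce simp: validI_def)
qed

lemma validJ_less: "validJ J \<Longrightarrow> m < i \<Longrightarrow> m \<in> J \<Longrightarrow> part mu i < part la m"
  using part_antimono[of "Suc m" i mu] by (fastforce simp: validJ_def)

definition Gx :: "nat set \<Rightarrow> nat \<Rightarrow> nat \<Rightarrow> real" where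
  "Gx I i j = (if i \<in> I \<and> j \<notin> I then ss.v (X j) (X i) * (if i < j then z else 1) else 1)"
definition Gy :: "nat set \<Rightarrow> nat \<Rightarrow> nat \<Rightarrow> real" where
  "Gy J i j = (if i \<in> J \<and> j \<notin> J then ss.v (Y i) (Y j) * (if j < i then z else 1) else 1)"

text \<open>
  How the factors of the row pair $(a, b)$ change when the rows in $I$ grow by one box:
  if exactly one of the two rows grows, the result is one factor of the $x$-sum, up to a
  power of $z = q / t$.
\<close>

lemma xpair:
  assumes I: "validI I" and ab: "a < b"
  shows "(if a \<notin> I \<and> b \<in> I then vf (part mu a - part mu b) (nuI I a - nuI I b) (b - a) else 1)
      * ff (b - a - 1) (nuI I a - nuI I b) =
    ff (b - a - 1) (part mu a - part mu b) * (Gx I a b * Gx I b a)"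
proof -
  define l where "l = b - a - 1"
  have l: "b - a = Suc l" using ab by (simp add: l_def)
  define c where "c = part mu a - part mu b"
  have mu: "part mu a = part mu b + c" using part_antimono[of a b mu] ab by (simp add: c_def)
  have r: "X a = q ^ c * t ^ Suc l * X b" using X_ratio[of a b] ab by (simp add: c_def l)
  consider "a \<in> I \<longleftrightarrow> b \<in> I" | "a \<in> I" "b \<notin> I" | "a \<notin> I" "b \<in> I" by blast
  then show ?thesis
  proof cases
    case 1
    then show ?thesis by (auto simp: Gx_def nuI_def)
  next
    case 2
    have "nuI I a - nuI I b = Suc c" using 2 mu by (simp add: nuI_def)
    moreover have "ss.v (X b) (X a) * z = 1 / arm_leg c l"
      unfolding r v_upper[OF X_nz] inverse_arm_leg_eq z_def ..
    ultimately show ?thesis using 2 ab by (simp add: Gx_def ff_Suc mu l)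
  next
    case 3
    have "part mu b < part la a" using validI_less[OF I ab 3(2)] .
    also have "\<dots> \<le> part mu a" using I 3 by (intro not_S) (auto simp: validI_def)
    finally obtain c' where c': "c = Suc c'" using mu by (cases c) auto
    have "nuI I a - nuI I b = c'" using 3 mu c' by (simp add: nuI_def)
    moreover have "ss.v (X a) (X b) = arm_leg c' (Suc l)"
      unfolding r v_lower[OF X_nz] c' arm_leg_eq ..
    moreover have "arm_leg c' (Suc l) = vf (Suc c') c' (Suc l) * arm_leg c' l"
      using arm_leg_ratio[of c' l] arm_leg_pos[of c' l] by (simp add: field_simps)
    ultimately show ?thesis using 3 ab arm_leg_pos[of c' l] by (simp add: Gx_def ff_Suc mu l c')
  qed
qed

text \<open>
  The counterpart of \<open>xpair\<close> for the rows in $J$ that lose a box.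
\<close>

lemma ypair:
  assumes J: "validJ J" and ab: "a < b"
  shows "(if a \<notin> J \<and> b \<in> J then vf (kaJ J a - kaJ J b) (part la a - part la b) (b - a) else 1)
      * ff (b - a) (kaJ J a - kaJ J b) =
    ff (b - a) (part la a - part la b) * (Gy J a b * Gy J b a)"
proof -
  define l where "l = b - a - 1"
  have l: "b - a = Suc l" using ab by (simp add: l_def)
  define c where "c = part la a - part la b"
  have la: "part la a = part la b + c" using part_antimono[of a b la] ab by (simp add: c_def)
  have r: "Y a = q ^ c * t ^ Suc l * Y b" using Y_ratio[of a b] ab by (simp add: c_def l)
  have pos: "part la j > 0" if "j \<in> J" for j using J that by (auto simp: validJ_def)
  consider "a \<in> J \<longleftrightarrow> b \<in> J" | "a \<in> J" "b \<notin> J" | "a \<notin> J" "b \<in> J" by blast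
  then show ?thesis
  proof cases
    case 1
    then show ?thesis using pos[of a] pos[of b] by (auto simp: Gy_def kaJ_def)
  next
    case 2
    have "part la b \<le> part mu b" using J 2 by (intro not_S) (auto simp: validJ_def)
    also have "\<dots> < part la a" using validJ_less[OF J ab 2(1)] .
    finally obtain c' where c': "c = Suc c'" using la by (cases c) auto
    have "kaJ J a - kaJ J b = c'" using 2 la c' by (simp add: kaJ_def)
    moreover have "ss.v (Y a) (Y b) = arm_leg c' (Suc l)"
      unfolding r v_lower[OF Y_nz] c' arm_leg_eq ..
    ultimately show ?thesis using 2 ab arm_leg_pos[of c' "Suc l"] by (simp add: Gy_def ff_Suc la l c')
  next
    case 3
    have "kaJ J a - kaJ J b = Suc c" using 3 la pos[of b] by (simp add: kaJ_def)
    moreover have "ss.v (Y b) (Y a) * z = 1 / arm_leg c l"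
      unfolding r v_upper[OF Y_nz] inverse_arm_leg_eq z_def ..
    moreover have "vf (Suc c) c (Suc l) = arm_leg c (Suc l) / arm_leg c l" by (rule arm_leg_ratio[symmetric])
    ultimately show ?thesis using 3 ab arm_leg_pos[of c "Suc l"] by (simp add: Gy_def ff_Suc la l)
  qed
qed

text \<open>
  The denominator of $\psi$ that pairs row $i$ of $\mu$ with row $m$ of $\lambda$, before any box is
  added or removed. If $i \le m$ and $\lambda_m = \mu_i + 1$, then both rows lie in $S$ and must change, and
  the arm before the change would be negative; the entry $1 / $ \<open>cross\<close> is chosen such that the value
  after the change is the correct one, namely 1.
\<close>

definition B0 :: "nat \<Rightarrow> nat \<Rightarrow> real" where
  "B0 i m = (if i \<le> m then if part la m \<le> part mu i then 1 / ff (m - i) (part mu i - part la m)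
      else 1 / cross i m
    else 1 / ff (i - m - 1) (part la m - part mu i))"

lemma cross_upper:
  assumes im: "i \<le> m" and e: "e = 0 \<longrightarrow> part la m \<le> part mu i" "e \<le> 1"
  shows "1 / ff (m - i) (part mu i + e - part la m) = B0 i m * (if e = 1 then cross i m else 1)"
proof (cases "e = 0")
  case True
  then show ?thesis using e im by (simp add: B0_def)
next
  case False
  then have e1: "e = 1" using e by simp
  have le: "part la m \<le> Suc (part mu i)"
    using la_le[of i] part_antimono[OF im, of la] by simp
  have r: "X i = q ^ (Suc (part mu i) - part la m) * t ^ (m - i) * Y m"
    by (rule XY_ratio[OF im le])
  show ?thesis
  proof (cases "part la m \<le> part mu i")
    case True
    define c where "c = part mu i - part la m"
    have c: "Suc (part mu i) - part la m = Suc c" "part mu i + e - part la m = Suc c"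
      using True e1 by (simp_all add: c_def)
    have "i \<notin> S \<or> i \<noteq> m" using True by (auto simp: S_def)
    then have "cross i m = ss.v (X i) (Y m)" by (auto simp: cross_def)
    also have "\<dots> = arm_leg c (m - i)" unfolding r v_lower[OF Y_nz] c arm_leg_eq ..
    finally show ?thesis using True im e1 arm_leg_pos[of c "m - i"]
      unfolding c by (simp add: B0_def ff_Suc c_def)
  next
    case False
    then have eq: "part la m = Suc (part mu i)" using le by simp
    have "cross i m \<noteq> 0"
    proof (cases "i = m")
      case True
      then show ?thesis using eq by (simp add: cross_def S_def)
    next
      case False
      then have pos: "0 < m - i" using im by simp
      have "cross i m = ss.v (X i) (Y m)" using False by (simp add: cross_def)
      also have "\<dots> = (1 - (t / q) * t ^ (m - i)) / (1 - t ^ (m - i))"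
        unfolding r v_lower[OF Y_nz] eq by simp
      also have "\<dots> \<noteq> 0"
      proof
        assume "(1 - (t / q) * t ^ (m - i)) / (1 - t ^ (m - i)) = 0"
        moreover have "1 - t ^ (m - i) \<noteq> 0" using one_minus_qt_nz[of 0 "m - i"] pos by simp
        ultimately have "q ^ 1 * t ^ 0 = q ^ 0 * t ^ Suc (m - i)" using q0 by (simp add: field_simps)
        from generic[OF this] show False by simp
      qed
      finally show ?thesis .
    qed
    then show ?thesis using eq e1 im by (simp add: B0_def)
  qed
qed

lemma cross_lower:
  assumes mi: "m < i" and e: "e \<le> 1" "part mu i + e \<le> part la m"
  shows "1 / ff (i - m - 1) (part la m - (part mu i + e)) = B0 i m * (if e = 1 then cross i m * z else 1)"
proof (cases "e = 0")
  case True
  then show ?thesis using mi by (simp add: B0_def)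
next
  case False
  then have e1: "e = 1" using e by simp
  define l where "l = i - m - 1"
  have l: "i - m = Suc l" using mi by (simp add: l_def)
  define d where "d = part la m - Suc (part mu i)"
  have d: "part la m - part mu i = Suc d" using e e1 by (simp add: d_def)
  have "Y m = q ^ d * t ^ Suc l * X i" unfolding d_def using YX_ratio[OF mi] e e1 l by simp
  then have "cross i m * z = (q ^ d * t ^ Suc l - t / q) / (q ^ d * t ^ Suc l - 1) * (q / t)"
    using mi v_upper[OF X_nz, of i "q ^ d * t ^ Suc l"] by (simp add: cross_def z_def)
  also have "\<dots> = 1 / arm_leg d l" by (rule inverse_arm_leg_eq[symmetric])
  finally show ?thesis using e1 mi arm_leg_pos[of d l]
    by (simp add: B0_def d ff_Suc l d_def[symmetric])
qed

text \<open>
  The part of both weights that depends neither on $I$ nor on $J$.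
\<close>

definition Base :: real where
  "Base = (\<Prod>i<N. \<Prod>r\<in>{i..<N}. ff (r - i) (part la i - part la r))
    * (\<Prod>i<N. \<Prod>r\<in>{i..<N}. ff (r - i) (part mu i - part mu (Suc r)))
    * (\<Prod>i\<le>N. \<Prod>m<N. B0 i m)"

definition xi :: "nat set \<Rightarrow> real" where
  "xi I = (\<Prod>i\<in>I. (\<Prod>j\<in>{..N} - I. ss.v (X j) (X i)) * (\<Prod>m<N. cross i m))"
definition eta :: "nat set \<Rightarrow> real" where
  "eta J = (\<Prod>j\<in>J. (\<Prod>l\<in>{..<N} - J. ss.v (Y j) (Y l)) * (\<Prod>i\<le>N. cross i j))"

text \<open>
  The power of $z$ that collects from all pairs of rows; by \<open>weight_exponent_x\<close> and its
  counterpart it depends only on the number of boxes.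
\<close>

definition E :: "nat \<Rightarrow> real" where "E k = z ^ (k * N) / z ^ (k choose 2)"

lemma prod_Gx_cross:
  assumes I: "I \<subseteq> {..N}"
  shows "(\<Prod>a\<le>N. \<Prod>b\<le>N. Gx I a b) *
    (\<Prod>i\<le>N. \<Prod>m<N. if i \<in> I then cross i m * (if m < i then z else 1) else 1) = E (card I) * xi I"
proof -
  have 1: "(\<Prod>a\<le>N. \<Prod>b\<le>N. Gx I a b) =
      (\<Prod>i\<in>I. \<Prod>j\<in>{..N} - I. ss.v (X j) (X i) * (if i < j then z else 1))"
  proof -
    have "(\<Prod>a\<le>N. \<Prod>b\<le>N. Gx I a b) = (\<Prod>a\<le>N. if a \<in> I then
        \<Prod>b\<le>N. if b \<in> {..N} - I then ss.v (X b) (X a) * (if a < b then z else 1) else 1 else 1)"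
      by (rule prod.cong) (auto simp: Gx_def intro!: prod.cong)
    then show ?thesis by (simp only: prod_indicator[OF finite_atMost I] prod_indicator[OF finite_atMost Diff_subset])
  qed
  have 2: "(\<Prod>i\<le>N. \<Prod>m<N. if i \<in> I then cross i m * (if m < i then z else 1) else 1) =
      (\<Prod>i\<in>I. \<Prod>m<N. cross i m * (if m < i then z else 1))"
    by (subst prod_indicator[OF finite_atMost I, symmetric]) (auto intro!: prod.cong)
  have 3: "(\<Prod>i\<in>I. (\<Prod>j\<in>{..N} - I. if i < j then z else 1) * (\<Prod>m<N. if m < i then z else 1)) = E (card I)"
    using weight_exponent_x[OF I, of z] z_nz unfolding E_def by (simp add: field_simps)
  show ?thesis unfolding 1 2 3[symmetric] xi_def prod.distrib by (simp only: mult_ac)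
qed

lemma prod_Gy_cross:
  assumes J: "J \<subseteq> {..<N}"
  shows "(\<Prod>a<N. \<Prod>b<N. Gy J a b) *
    (\<Prod>i\<le>N. \<Prod>m<N. if m \<in> J then cross i m * (if m < i then z else 1) else 1) = E (card J) * eta J"
proof -
  have 1: "(\<Prod>a<N. \<Prod>b<N. Gy J a b) =
      (\<Prod>i\<in>J. \<Prod>j\<in>{..<N} - J. ss.v (Y i) (Y j) * (if j < i then z else 1))"
  proof -
    have "(\<Prod>a<N. \<Prod>b<N. Gy J a b) = (\<Prod>a<N. if a \<in> J then
        \<Prod>b<N. if b \<in> {..<N} - J then ss.v (Y a) (Y b) * (if b < a then z else 1) else 1 else 1)"
      by (rule prod.cong) (auto simp: Gy_def intro!: prod.cong)
    then show ?thesis by (simp only: prod_indicator[OF finite_lessThan J] prod_indicator[OF finite_lessThan Diff_subset])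
  qed
  have 2: "(\<Prod>i\<le>N. \<Prod>m<N. if m \<in> J then cross i m * (if m < i then z else 1) else 1) =
      (\<Prod>m\<in>J. \<Prod>i\<le>N. cross i m * (if m < i then z else 1))"
    unfolding prod.swap[of _ "{..N}"]
    by (subst prod_indicator[OF finite_lessThan J, symmetric]) (auto intro!: prod.cong)
  have 3: "(\<Prod>j\<in>J. (\<Prod>a\<in>{..<N} - J. if a < j then z else 1) * (\<Prod>i\<le>N. if j < i then z else 1)) = E (card J)"
    using weight_exponent_y[OF J, of z] z_nz unfolding E_def by (simp add: field_simps)
  show ?thesis unfolding 1 2 3[symmetric] eta_def prod.distrib by (simp only: mult_ac)
qed

lemma vpsi_eq:
  assumes "\<And>i. part nu i = part ka i \<or> part nu i = Suc (part ka i)"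
    and I: "\<And>i. i \<in> I \<longleftrightarrow> part nu i \<noteq> part ka i" and sub: "I \<subseteq> A" and A: "A = {..<M}"
  shows "vpsi nu ka = (\<Prod>a\<in>A. \<Prod>b\<in>A. if a < b then
      (if a \<notin> I \<and> b \<in> I then vf (part ka a - part ka b) (part nu a - part nu b) (b - a) else 1) else 1)"
proof -
  have finA: "finite A" using A by simp
  have 1: "{b. part nu b \<noteq> part ka b} = I" using I by blast
  have 2: "{a. a < b \<and> part nu a = part ka a} \<subseteq> A" if "b \<in> I" for b using that sub A by auto
  have "vpsi nu ka = (\<Prod>b\<in>A. if b \<in> I then \<Prod>a\<in>A. if a \<in> {a. a < b \<and> part nu a = part ka a} then
      vf (part ka a - part ka b) (part nu a - part nu b) (b - a) else 1 else 1)"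
    unfolding prod_indicator[OF finA sub] vpsi_def 1
    by (rule prod.cong[OF refl], rule prod_indicator[OF finA 2, symmetric])
  also have "\<dots> = (\<Prod>b\<in>A. \<Prod>a\<in>A. if a < b then
      (if a \<notin> I \<and> b \<in> I then vf (part ka a - part ka b) (part nu a - part nu b) (b - a) else 1) else 1)"
  proof (rule prod.cong[OF refl])
    fix b
    have eqI: "a \<in> {a. a < b \<and> part nu a = part ka a} \<longleftrightarrow> a < b \<and> a \<notin> I" for a using I by blast
    show "(if b \<in> I then \<Prod>a\<in>A. if a \<in> {a. a < b \<and> part nu a = part ka a} then
        vf (part ka a - part ka b) (part nu a - part nu b) (b - a) else 1 else 1) =
      (\<Prod>a\<in>A. if a < b then
        (if a \<notin> I \<and> b \<in> I then vf (part ka a - part ka b) (part nu a - part nu b) (b - a) else 1) else 1)"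
      unfolding eqI by (cases "b \<in> I") (simp_all cong: if_cong, meson)
  qed
  finally show ?thesis by (subst prod.swap)
qed

text \<open>
  The row pairs inside $\nu$ and $\mu$ are handled by \<open>xpair\<close>, those between $\lambda$ and $\nu$ by
  \<open>cross_upper\<close> and \<open>cross_lower\<close>.
\<close>

lemma weight_L:
  assumes I: "validI I" and nu: "part nu = nuI I"
  shows "vpsi nu mu * psi nu la = Base * (E (card I) * xi I)"
proof -
  have hs: "hstrip la nu"
  proof -
    have "part la i \<le> part nu i" for i
    proof (cases "i \<in> I")
      case True then show ?thesis using la_le[of i] by (simp add: nu nuI_def)
    next
      case False then show ?thesis using I not_S[of i] by (auto simp: nu nuI_def validI_def)
    qed
    moreover have "part nu (Suc i) \<le> part la i" for i
      using I mu_le[of i] by (auto simp: nu nuI_def validI_def Suc_le_eq)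
    ultimately show ?thesis by (simp add: hstrip_def)
  qed
  have IN: "I \<subseteq> {..N}" using I by (simp add: validI_def)
  let ?p = "\<lambda>a b. ff (b - a - 1) (part nu a - part nu b)"
  let ?w = "\<lambda>a b. ff (b - a - 1) (part mu a - part mu b)"
  let ?v = "\<lambda>a b. if a \<notin> I \<and> b \<in> I then vf (part mu a - part mu b) (part nu a - part nu b) (b - a) else 1"
  have vp: "vpsi nu mu = (\<Prod>a\<le>N. \<Prod>b\<le>N. if a < b then ?v a b else 1)"
    by (rule vpsi_eq[where M = "Suc N"]) (use IN in \<open>auto simp: nu nuI_def\<close>)
  have "psi nu la =
     (\<Prod>i<N. \<Prod>r\<in>{i..<N}. ff (r - i) (part la i - part la r))
     * (\<Prod>i<N. \<Prod>r\<in>{i..<N}. ?p i (Suc r))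
     * ((\<Prod>i<N. \<Prod>r\<in>{i..<N}. 1 / ff (r - i) (part nu i - part la r))
     * (\<Prod>i<N. \<Prod>r\<in>{i..<N}. (\<lambda>j m. 1 / ff (j - m - 1) (part la m - part nu j)) (Suc r) i))"
    unfolding mac_psi_hstrip[OF hs len_la] prod.distrib[symmetric]
    by (intro prod.cong refl) (simp add: diff_Suc_less)
  also have "(\<Prod>i<N. \<Prod>r\<in>{i..<N}. ?p i (Suc r)) = (\<Prod>a\<le>N. \<Prod>b\<le>N. if a < b then ?p a b else 1)"
    by (rule prod_triangle_Suc)
  also have "(\<Prod>i<N. \<Prod>r\<in>{i..<N}. 1 / ff (r - i) (part nu i - part la r)) =
      (\<Prod>i\<le>N. \<Prod>m<N. if i \<le> m then 1 / ff (m - i) (part nu i - part la m) else 1)"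
    by (rule prod_triangle_le)
  also have "(\<Prod>i<N. \<Prod>r\<in>{i..<N}. (\<lambda>j m. 1 / ff (j - m - 1) (part la m - part nu j)) (Suc r) i) =
      (\<Prod>i\<le>N. \<Prod>m<N. if m < i then 1 / ff (i - m - 1) (part la m - part nu i) else 1)"
    by (rule prod_triangle_transpose)
  also have "(\<Prod>i\<le>N. \<Prod>m<N. if i \<le> m then 1 / ff (m - i) (part nu i - part la m) else 1) *
      (\<Prod>i\<le>N. \<Prod>m<N. if m < i then 1 / ff (i - m - 1) (part la m - part nu i) else 1) =
      (\<Prod>i\<le>N. \<Prod>m<N. B0 i m * (if i \<in> I then cross i m * (if m < i then z else 1) else 1))"
    unfolding prod.distrib[symmetric]
  proof (intro prod.cong refl)
    fix i m
    define e :: nat where "e = (if i \<in> I then 1 else 0)"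
    have nue: "part nu i = part mu i + e" by (simp add: nu nuI_def e_def)
    show "(if i \<le> m then 1 / ff (m - i) (part nu i - part la m) else 1) *
        (if m < i then 1 / ff (i - m - 1) (part la m - part nu i) else 1) =
        B0 i m * (if i \<in> I then cross i m * (if m < i then z else 1) else 1)"
    proof (cases "i \<le> m")
      case True
      have "part la m \<le> part mu i" if "i \<notin> I"
        using not_S[of i] I that part_antimono[OF True, of la] by (force simp: validI_def)
      then show ?thesis using cross_upper[OF True, of e] True by (simp add: nue e_def)
    next
      case False
      then have mi: "m < i" by simp
      have "part mu i + e \<le> part la m" using validI_less[OF I mi] mu_le'[OF mi] by (simp add: e_def Suc_le_eq)
      then show ?thesis using cross_lower[OF mi, of e] mi by (simp add: nue e_def)
    qed
  qed
  finally have psi: "psi nu la =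
     (\<Prod>i<N. \<Prod>r\<in>{i..<N}. ff (r - i) (part la i - part la r))
     * (\<Prod>a\<le>N. \<Prod>b\<le>N. if a < b then ?p a b else 1)
     * ((\<Prod>i\<le>N. \<Prod>m<N. B0 i m) *
        (\<Prod>i\<le>N. \<Prod>m<N. if i \<in> I then cross i m * (if m < i then z else 1) else 1))"
    by (simp only: prod.distrib)
  have "vpsi nu mu * (\<Prod>a\<le>N. \<Prod>b\<le>N. if a < b then ?p a b else 1) =
      (\<Prod>a\<le>N. \<Prod>b\<le>N. (if a < b then ?w a b else 1) * (if a < b then Gx I a b * Gx I b a else 1))"
    unfolding vp prod.distrib[symmetric]
  proof (intro prod.cong refl)
    fix a b
    show "(if a < b then ?v a b else 1) * (if a < b then ?p a b else 1) =
        (if a < b then ?w a b else 1) * (if a < b then Gx I a b * Gx I b a else 1)"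
    proof (cases "a < b")
      case True
      then show ?thesis using xpair[OF I True] by (simp only: nu if_True)
    qed simp
  qed
  also have "\<dots> = (\<Prod>i<N. \<Prod>r\<in>{i..<N}. ?w i (Suc r)) * (\<Prod>a\<le>N. \<Prod>b\<le>N. Gx I a b)"
    unfolding prod.distrib prod_triangle_Suc[of "?w"]
    by (subst prod_unordered_pairs) (auto simp: Gx_def)
  finally show ?thesis
    unfolding psi Base_def prod_Gx_cross[OF IN, symmetric] by (simp add: mult_ac)
qed

text \<open>
  The same computation as in \<open>weight_L\<close> with \<open>ypair\<close>; the constant \<open>Base\<close> is the same, which is
  what makes the two sides comparable.
\<close>

lemma weight_R:
  assumes J: "validJ J" and ka: "part ka = kaJ J"
  shows "vpsi la ka * psi mu ka = Base * (E (card J) * eta J)"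
proof -
  have pos: "part la j > 0" if "j \<in> J" for j using J that by (auto simp: validJ_def)
  have hs: "hstrip ka mu"
  proof -
    have "part ka i \<le> part mu i" for i
    proof (cases "i \<in> J")
      case True then show ?thesis using la_le[of i] by (simp add: ka kaJ_def)
    next
      case False then show ?thesis using J not_S[of i] by (auto simp: ka kaJ_def validJ_def)
    qed
    moreover have "part mu (Suc i) \<le> part ka i" for i
      using J mu_le[of i] by (auto simp: ka kaJ_def validJ_def)
    ultimately show ?thesis by (simp add: hstrip_def)
  qed
  have len: "plen ka \<le> N" using hstrip_plen(1)[OF hs] len_mu by simp
  have JN: "J \<subseteq> {..<N}" using J by (simp add: validJ_def)
  let ?p = "\<lambda>a b. ff (b - a) (part ka a - part ka b)"
  let ?w = "\<lambda>a b. ff (b - a) (part la a - part la b)"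
  let ?v = "\<lambda>a b. if a \<notin> J \<and> b \<in> J then vf (part ka a - part ka b) (part la a - part la b) (b - a) else 1"
  have vp: "vpsi la ka = (\<Prod>a<N. \<Prod>b<N. if a < b then ?v a b else 1)"
  proof (rule vpsi_eq[where M = N])
    fix i
    show "part la i = part ka i \<or> part la i = Suc (part ka i)" by (auto simp: ka kaJ_def)
    show "i \<in> J \<longleftrightarrow> part la i \<noteq> part ka i" using pos[of i] by (auto simp: ka kaJ_def)
  qed (use JN in auto)
  have "psi mu ka =
     (\<Prod>i<N. \<Prod>r\<in>{i..<N}. ?p i r)
     * (\<Prod>i<N. \<Prod>r\<in>{i..<N}. ff (r - i) (part mu i - part mu (Suc r)))
     * ((\<Prod>i<N. \<Prod>r\<in>{i..<N}. 1 / ff (r - i) (part mu i - part ka r))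
     * (\<Prod>i<N. \<Prod>r\<in>{i..<N}. (\<lambda>j m. 1 / ff (j - m - 1) (part ka m - part mu j)) (Suc r) i))"
    unfolding mac_psi_hstrip[OF hs len] prod.distrib[symmetric]
    by (intro prod.cong refl) simp
  also have "(\<Prod>i<N. \<Prod>r\<in>{i..<N}. ?p i r) = (\<Prod>a<N. \<Prod>b<N. if a < b then ?p a b else 1)"
    by (rule prod_triangle_less) simp
  also have "(\<Prod>i<N. \<Prod>r\<in>{i..<N}. 1 / ff (r - i) (part mu i - part ka r)) =
      (\<Prod>i\<le>N. \<Prod>m<N. if i \<le> m then 1 / ff (m - i) (part mu i - part ka m) else 1)"
    by (rule prod_triangle_le)
  also have "(\<Prod>i<N. \<Prod>r\<in>{i..<N}. (\<lambda>j m. 1 / ff (j - m - 1) (part ka m - part mu j)) (Suc r) i) =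
      (\<Prod>i\<le>N. \<Prod>m<N. if m < i then 1 / ff (i - m - 1) (part ka m - part mu i) else 1)"
    by (rule prod_triangle_transpose)
  also have "(\<Prod>i\<le>N. \<Prod>m<N. if i \<le> m then 1 / ff (m - i) (part mu i - part ka m) else 1) *
      (\<Prod>i\<le>N. \<Prod>m<N. if m < i then 1 / ff (i - m - 1) (part ka m - part mu i) else 1) =
      (\<Prod>i\<le>N. \<Prod>m<N. B0 i m * (if m \<in> J then cross i m * (if m < i then z else 1) else 1))"
    unfolding prod.distrib[symmetric]
  proof (intro prod.cong refl)
    fix i m
    define e :: nat where "e = (if m \<in> J then 1 else 0)"
    have kae: "part la m = part ka m + e" using pos[of m] by (simp add: ka kaJ_def e_def)
    show "(if i \<le> m then 1 / ff (m - i) (part mu i - part ka m) else 1) *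
        (if m < i then 1 / ff (i - m - 1) (part ka m - part mu i) else 1) =
        B0 i m * (if m \<in> J then cross i m * (if m < i then z else 1) else 1)"
    proof (cases "i \<le> m")
      case True
      have "part la m \<le> part mu i" if "m \<notin> J"
        using not_S[of m] J that part_antimono[OF True, of mu] by (force simp: validJ_def)
      then show ?thesis using cross_upper[OF True, of e] True by (simp add: kae e_def)
    next
      case False
      then have mi: "m < i" by simp
      have "part mu i + e \<le> part la m" using validJ_less[OF J mi] mu_le'[OF mi] by (simp add: e_def Suc_le_eq)
      then show ?thesis using cross_lower[OF mi, of e] mi by (simp add: kae e_def)
    qed
  qed
  finally have psi: "psi mu ka =
     (\<Prod>a<N. \<Prod>b<N. if a < b then ?p a b else 1)
     * (\<Prod>i<N. \<Prod>r\<in>{i..<N}. ff (r - i) (part mu i - part mu (Suc r)))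
     * ((\<Prod>i\<le>N. \<Prod>m<N. B0 i m) *
        (\<Prod>i\<le>N. \<Prod>m<N. if m \<in> J then cross i m * (if m < i then z else 1) else 1))"
    by (simp only: prod.distrib)
  have "vpsi la ka * (\<Prod>a<N. \<Prod>b<N. if a < b then ?p a b else 1) =
      (\<Prod>a<N. \<Prod>b<N. (if a < b then ?w a b else 1) * (if a < b then Gy J a b * Gy J b a else 1))"
    unfolding vp prod.distrib[symmetric]
  proof (intro prod.cong refl)
    fix a b
    show "(if a < b then ?v a b else 1) * (if a < b then ?p a b else 1) =
        (if a < b then ?w a b else 1) * (if a < b then Gy J a b * Gy J b a else 1)"
    proof (cases "a < b")
      case True
      then show ?thesis using ypair[OF J True] by (simp only: ka if_True)
    qed simp
  qed
  also have "\<dots> = (\<Prod>i<N. \<Prod>r\<in>{i..<N}. ?w i r) * (\<Prod>a<N. \<Prod>b<N. Gy J a b)"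
  proof -
    have 1: "(\<Prod>i<N. \<Prod>r\<in>{i..<N}. ?w i r) = (\<Prod>a<N. \<Prod>b<N. if a < b then ?w a b else 1)"
      by (rule prod_triangle_less) simp
    show ?thesis unfolding prod.distrib 1 by (subst prod_unordered_pairs) (auto simp: Gy_def)
  qed
  finally show ?thesis
    unfolding psi Base_def prod_Gy_cross[OF JN, symmetric] by (simp add: mult_ac)
qed

definition A :: "nat set" where "A = {..N} - S"
definition B :: "nat set" where "B = {..<N} - S"

lemma S_le: "S \<subseteq> {..N}"
  using S_subset by auto

lemma fin [simp]: "finite A" "finite B" "finite S"
  using finite_subset[OF S_subset] by (simp_all add: A_def B_def)

lemma Y_eq_X: "i \<in> S \<Longrightarrow> Y i = X i"
  using q0 by (simp add: S_def X_def Y_def)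

lemma good_AB: "ss.good A B"
proof -
  have "inj X"
  proof
    fix i j assume "X i = X j"
    then have "q ^ part mu i * t ^ j = q ^ part mu j * t ^ i" using t0 by (simp add: X_def field_simps)
    from generic[OF this] show "i = j" by simp
  qed
  moreover have "inj Y"
  proof
    fix i j assume "Y i = Y j"
    then have "q ^ part la i * t ^ j = q ^ part la j * t ^ i" using t0 q0 by (simp add: Y_def field_simps)
    from generic[OF this] show "i = j" by simp
  qed
  moreover have "X i \<noteq> Y m" if "i \<in> A" for i m
  proof
    assume "X i = Y m"
    then have "q ^ Suc (part mu i) * t ^ m = q ^ part la m * t ^ i"
      using t0 q0 by (simp add: X_def Y_def field_simps)
    from generic[OF this] that show False by (auto simp: A_def S_def)
  qed
  ultimately show ?thesis
    unfolding ss.good_def using X_nz Y_nz by (auto intro: inj_on_subset)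
qed

lemma card_AB: "card A = Suc (card B)" "card B + card S = N"
proof -
  have "card A = Suc N - card S" using S_le by (simp add: A_def card_Diff_subset)
  moreover have "card B = N - card S" using S_subset by (simp add: B_def card_Diff_subset)
  moreover have "card S \<le> N" using card_mono[OF _ S_subset] by simp
  ultimately show "card A = Suc (card B)" "card B + card S = N" by simp_all
qed

text \<open>
  The contribution of the rows in $S$, the same on both sides.
\<close>

definition KS :: real where
  "KS = (\<Prod>s\<in>S. (\<Prod>j\<in>A. ss.v (X j) (X s)) * (\<Prod>m\<in>B. ss.v (X s) (Y m)) * (\<Prod>m\<in>S. cross s m))"

lemma prod_N_split: "(\<Prod>m<N. f m) = (\<Prod>m\<in>B. f m) * (\<Prod>m\<in>S. f m)"
  unfolding B_def by (rule prod.subset_diff) (use S_subset in auto)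

lemma prod_leN_split: "(\<Prod>m\<le>N. f m) = (\<Prod>m\<in>A. f m) * (\<Prod>m\<in>S. f m)"
  unfolding A_def by (rule prod.subset_diff) (use S_le in auto)

lemma cross_eq: "i \<notin> S \<or> i \<noteq> m \<Longrightarrow> cross i m = ss.v (X i) (Y m)"
  by (auto simp: cross_def)

text \<open>
  For $s \in S$ the product contains $v(x_j, x_s)$ only for $j \in A - I$. The factors with
  $j \in I$ are supplied by the terms $v(x_j, y_s)$, because $y_s = x_s$; so the rows in $S$
  contribute a factor that does not depend on $I$.
\<close>

lemma xi_split:
  assumes I: "I \<subseteq> A"
  shows "xi (S \<union> I) = KS * ss.xterm A B I"
proof -
  have dis: "S \<inter> I = {}" and finI: "finite I" using I finite_subset[OF I] by (auto simp: A_def)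
  have 1: "{..N} - (S \<union> I) = A - I" by (auto simp: A_def)
  have SI: "(\<Prod>i\<in>I. \<Prod>m<N. cross i m) = (\<Prod>i\<in>I. \<Prod>m\<in>B. ss.v (X i) (Y m)) * (\<Prod>m\<in>S. \<Prod>i\<in>I. ss.v (X i) (X m))"
  proof -
    have "(\<Prod>m<N. cross i m) = (\<Prod>m\<in>B. ss.v (X i) (Y m)) * (\<Prod>m\<in>S. ss.v (X i) (X m))" if "i \<in> I" for i
    proof -
      have "cross i m = ss.v (X i) (Y m)" for m using that dis by (intro cross_eq) auto
      then show ?thesis unfolding prod_N_split by (simp add: Y_eq_X)
    qed
    then have "(\<Prod>i\<in>I. \<Prod>m<N. cross i m) =
        (\<Prod>i\<in>I. \<Prod>m\<in>B. ss.v (X i) (Y m)) * (\<Prod>i\<in>I. \<Prod>m\<in>S. ss.v (X i) (X m))"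
      unfolding prod.distrib[symmetric] by simp
    also have "(\<Prod>i\<in>I. \<Prod>m\<in>S. ss.v (X i) (X m)) = (\<Prod>m\<in>S. \<Prod>i\<in>I. ss.v (X i) (X m))" by (rule prod.swap)
    finally show ?thesis .
  qed
  have SS: "(\<Prod>i\<in>S. \<Prod>m<N. cross i m) = (\<Prod>s\<in>S. \<Prod>m\<in>B. ss.v (X s) (Y m)) * (\<Prod>s\<in>S. \<Prod>m\<in>S. cross s m)"
    unfolding prod.distrib[symmetric] prod_N_split
    by (intro prod.cong refl arg_cong2[where f = "(*)"]) (auto simp: B_def intro!: cross_eq)
  have SA: "(\<Prod>i\<in>S. \<Prod>j\<in>A. ss.v (X j) (X i)) =
      (\<Prod>i\<in>S. \<Prod>j\<in>A - I. ss.v (X j) (X i)) * (\<Prod>i\<in>S. \<Prod>j\<in>I. ss.v (X j) (X i))"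
    unfolding prod.distrib[symmetric] by (intro prod.cong refl prod.subset_diff I) simp
  show ?thesis
    unfolding xi_def 1 prod.union_disjoint[OF fin(3) finI dis] KS_def ss.xterm_def prod.distrib SI SS SA
    by (simp only: mult_ac)
qed

lemma eta_split:
  assumes J: "J \<subseteq> B"
  shows "eta (S \<union> J) = KS * ss.yterm A B J"
proof -
  have dis: "S \<inter> J = {}" and finJ: "finite J" using J finite_subset[OF J] by (auto simp: B_def)
  have 1: "{..<N} - (S \<union> J) = B - J" by (auto simp: B_def)
  have SJ: "(\<Prod>j\<in>J. \<Prod>i\<le>N. cross i j) = (\<Prod>j\<in>J. \<Prod>i\<in>A. ss.v (X i) (Y j)) * (\<Prod>s\<in>S. \<Prod>j\<in>J. ss.v (X s) (Y j))"
  proof -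
    have "(\<Prod>i\<le>N. cross i j) = (\<Prod>i\<in>A. ss.v (X i) (Y j)) * (\<Prod>s\<in>S. ss.v (X s) (Y j))" if "j \<in> J" for j
      unfolding prod_leN_split using that dis
      by (intro arg_cong2[where f = "(*)"] prod.cong refl) (auto simp: A_def intro!: cross_eq)
    then have "(\<Prod>j\<in>J. \<Prod>i\<le>N. cross i j) =
        (\<Prod>j\<in>J. \<Prod>i\<in>A. ss.v (X i) (Y j)) * (\<Prod>j\<in>J. \<Prod>s\<in>S. ss.v (X s) (Y j))"
      unfolding prod.distrib[symmetric] by simp
    also have "(\<Prod>j\<in>J. \<Prod>s\<in>S. ss.v (X s) (Y j)) = (\<Prod>s\<in>S. \<Prod>j\<in>J. ss.v (X s) (Y j))" by (rule prod.swap)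
    finally show ?thesis .
  qed
  have SS: "(\<Prod>s\<in>S. \<Prod>i\<le>N. cross i s) = (\<Prod>s\<in>S. \<Prod>j\<in>A. ss.v (X j) (X s)) * (\<Prod>s\<in>S. \<Prod>m\<in>S. cross s m)"
  proof -
    have "(\<Prod>s\<in>S. \<Prod>i\<le>N. cross i s) = (\<Prod>s\<in>S. \<Prod>j\<in>A. ss.v (X j) (X s)) * (\<Prod>s\<in>S. \<Prod>i\<in>S. cross i s)"
      unfolding prod.distrib[symmetric] prod_leN_split
      by (intro prod.cong refl arg_cong2[where f = "(*)"]) (auto simp: A_def cross_eq Y_eq_X)
    also have "(\<Prod>s\<in>S. \<Prod>i\<in>S. cross i s) = (\<Prod>s\<in>S. \<Prod>m\<in>S. cross s m)" by (rule prod.swap)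
    finally show ?thesis .
  qed
  have SB: "(\<Prod>s\<in>S. \<Prod>m\<in>B. ss.v (X s) (Y m)) =
      (\<Prod>s\<in>S. \<Prod>m\<in>B - J. ss.v (Y s) (Y m)) * (\<Prod>s\<in>S. \<Prod>m\<in>J. ss.v (X s) (Y m))"
  proof -
    have "(\<Prod>m\<in>B. ss.v (X s) (Y m)) = (\<Prod>m\<in>B - J. ss.v (Y s) (Y m)) * (\<Prod>m\<in>J. ss.v (X s) (Y m))"
      if "s \<in> S" for s
      using that prod.subset_diff[OF J fin(2), of "\<lambda>m. ss.v (X s) (Y m)"] by (simp add: Y_eq_X)
    then show ?thesis unfolding prod.distrib[symmetric] by simp
  qed
  show ?thesis
    unfolding eta_def 1 prod.union_disjoint[OF fin(3) finJ dis] KS_def ss.yterm_def prod.distrib SJ SS SB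
    by (simp only: mult_ac)
qed

lemma sum_split_S:
  assumes C: "C \<inter> S = {}" and finC: "finite C"
  shows "(\<Sum>I | S \<subseteq> I \<and> I \<subseteq> C \<union> S \<and> card I = k. f I) =
    (if card S \<le> k then \<Sum>I' | I' \<subseteq> C \<and> card I' = k - card S. f (S \<union> I') else (0::real))"
proof (cases "card S \<le> k")
  case True
  have finI: "finite I'" if "I' \<subseteq> C" for I' using that finC finite_subset by blast
  have "(\<Sum>I | S \<subseteq> I \<and> I \<subseteq> C \<union> S \<and> card I = k. f I) =
      (\<Sum>I' | I' \<subseteq> C \<and> card I' = k - card S. f (S \<union> I'))"
  proof (rule sum.reindex_bij_witness[where i = "\<lambda>I'. S \<union> I'" and j = "\<lambda>I. I - S"])
    fix I assume I: "I \<in> {I. S \<subseteq> I \<and> I \<subseteq> C \<union> S \<and> card I = k}"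
    then show eq: "S \<union> (I - S) = I" by auto
    show "f (S \<union> (I - S)) = f I" unfolding eq ..
    show "I - S \<in> {I'. I' \<subseteq> C \<and> card I' = k - card S}"
      using I by (auto simp: card_Diff_subset)
  next
    fix I assume I: "I \<in> {I'. I' \<subseteq> C \<and> card I' = k - card S}"
    then have dis: "S \<inter> I = {}" using C by auto
    then show "S \<union> I - S = I" by auto
    have "card (S \<union> I) = card S + card I" using I finI dis by (auto simp: card_Un_disjoint)
    then show "S \<union> I \<in> {I. S \<subseteq> I \<and> I \<subseteq> C \<union> S \<and> card I = k}" using I True by auto
  qed
  then show ?thesis using True by simp
next
  case False
  have "{I. S \<subseteq> I \<and> I \<subseteq> C \<union> S \<and> card I = k} = {}"
  proof -
    have "card S \<le> card I" if "S \<subseteq> I" "I \<subseteq> C \<union> S" for I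
      using that finC by (intro card_mono) (auto intro: finite_subset)
    then show ?thesis using False by auto
  qed
  then show ?thesis using False by (simp only: sum.empty if_False)
qed

lemma part_nuI:
  assumes "validI I"
  shows "part (of_part (nuI I)) = nuI I"
proof (rule part_of_part)
  fix i
  show "nuI I (Suc i) \<le> nuI I i"
  proof (cases "Suc i \<in> I")
    case True
    then have less: "part mu (Suc i) < part la i" using assms by (simp add: validI_def)
    moreover have "part la i \<le> nuI I i"
      using assms la_le[of i] not_S[of i] by (auto simp: nuI_def validI_def)
    ultimately show ?thesis using True by (simp add: nuI_def)
  qed (simp add: nuI_def trans_le_add1 part_antimono)
  show "nuI I (Suc N) = 0"
    using assms len_mu by (auto simp: nuI_def validI_def)
qed

lemma part_kaJ:
  assumes "validJ J" shows "part (of_part (kaJ J)) = kaJ J"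
proof (rule part_of_part)
  fix i
  show "kaJ J (Suc i) \<le> kaJ J i"
  proof (cases "i \<in> J")
    case True
    then have less: "part mu (Suc i) < part la i" using assms by (simp add: validJ_def)
    moreover have "kaJ J (Suc i) \<le> part mu (Suc i)"
      using assms la_le[of "Suc i"] not_S[of "Suc i"] by (auto simp: kaJ_def validJ_def)
    ultimately show ?thesis using True by (simp add: kaJ_def)
  qed (simp add: kaJ_def le_diff_conv trans_le_add1 part_antimono)
  show "kaJ J N = 0" using len_la by (simp add: kaJ_def)
qed

lemma psize_part_sum: "(\<And>i. i > N \<Longrightarrow> part nu i = 0) \<Longrightarrow> psize nu = (\<Sum>i\<le>N. part nu i)"
proof -
  assume "\<And>i. i > N \<Longrightarrow> part nu i = 0"
  then have "plen nu \<le> Suc N" by (simp add: plen_le_iff)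
  from psize_eq_sum[OF this] show ?thesis by (simp add: lessThan_Suc_atMost)
qed

lemma psize_nuI:
  assumes "I \<subseteq> {..N}" "part nu = nuI I" shows "psize nu = psize mu + card I"
proof -
  have "psize nu = (\<Sum>i\<le>N. part nu i)"
    by (rule psize_part_sum) (use assms len_mu in \<open>auto simp: nuI_def\<close>)
  moreover have "psize mu = (\<Sum>i\<le>N. part mu i)" by (rule psize_part_sum) (use len_mu in auto)
  moreover have "(\<Sum>i\<le>N. if i \<in> I then 1 else 0) = card I"
    using assms(1) by (simp add: sum.inter_restrict[symmetric] inf_absorb2)
  ultimately show ?thesis unfolding assms(2) nuI_def by (simp add: sum.distrib)
qed

lemma psize_kaJ:
  assumes "J \<subseteq> {..<N}" "part ka = kaJ J" "\<And>j. j \<in> J \<Longrightarrow> part la j > 0"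
  shows "psize la = psize ka + card J"
proof -
  have "psize ka = (\<Sum>i\<le>N. part ka i)"
    by (rule psize_part_sum) (use assms len_la in \<open>auto simp: kaJ_def\<close>)
  moreover have "psize la = (\<Sum>i\<le>N. part la i)" by (rule psize_part_sum) (use len_la in auto)
  moreover have "(\<Sum>i\<le>N. if i \<in> J then 1 else 0) = card J"
    using assms(1) by (subst sum.inter_restrict[symmetric]) (auto simp: inf_absorb2 intro!: arg_cong[where f = card])
  moreover have "part la i = part ka i + (if i \<in> J then 1 else 0)" for i
    using assms(3)[of i] by (simp add: assms(2) kaJ_def)
  ultimately show ?thesis by (simp add: sum.distrib)
qed

text \<open>
  If adding boxes in the rows of $I$ does not give a horizontal strip over $\lambda$, then
  $\mu_{i+1} = \lambda_i$ for some $i + 1 \in I$. Then $y_i = \tau x_{i+1}$ and the term vanishes,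
  so the sum may run over all sets of rows.
\<close>

lemma xi_invalid:
  assumes "S \<subseteq> I" "I \<subseteq> {..N}" "\<not> validI I"
  shows "xi I = 0"
proof -
  obtain i where i: "Suc i \<in> I" "\<not> part mu (Suc i) < part la i"
    using assms by (auto simp: validI_def)
  then have i: "Suc i \<in> I" "part mu (Suc i) = part la i" using mu_le[of i] by auto
  have "cross (Suc i) i = 0"
    using i(2) q0 t0 by (simp add: cross_def ss.v_def X_def Y_def)
  moreover have "i < N" using i assms by auto
  ultimately have "(\<Prod>m<N. cross (Suc i) m) = 0" by (intro prod_zero) auto
  moreover have "finite I" using assms finite_subset by blast
  ultimately show ?thesis unfolding xi_def using i(1) by (intro prod_zero) auto
qed

lemma eta_invalid:
  assumes "S \<subseteq> J" "J \<subseteq> {..<N}" "\<not> validJ J"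
  shows "eta J = 0"
proof -
  obtain i where i: "i \<in> J" "\<not> part mu (Suc i) < part la i"
    using assms by (auto simp: validJ_def)
  then have i: "i \<in> J" "part mu (Suc i) = part la i" using mu_le[of i] by auto
  have "cross (Suc i) i = 0"
    using i(2) q0 t0 by (simp add: cross_def ss.v_def X_def Y_def)
  moreover have "Suc i \<le> N" using i assms by auto
  ultimately have "(\<Prod>m\<le>N. cross m i) = 0" by (intro prod_zero) auto
  moreover have "finite J" using assms finite_subset by blast
  ultimately show ?thesis unfolding eta_def using i(1) by (intro prod_zero) auto
qed

lemma sum_L:
  "(\<Sum>nu | vstrip mu nu \<and> hstrip la nu \<and> psize nu = psize mu + k.
      vpsi nu mu * psi nu la) =
    Base * E k * KS * (if card S \<le> k then ss.xsum A B (k - card S) else 0)"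
proof -
  have validI_char: "\<exists>I. validI I \<and> part nu = nuI I" if "vstrip mu nu" "hstrip la nu" for nu
  proof -
    define I where "I = {i. part nu i \<noteq> part mu i}"
    have nu: "part nu = nuI I"
    proof
      fix i show "part nu i = nuI I i"
        using that(1) unfolding vstrip_def nuI_def I_def by (auto dest!: spec[of _ i])
    qed
    have "S \<subseteq> I"
    proof
      fix i assume "i \<in> S"
      then show "i \<in> I" using hstripD(1)[OF that(2), of i] by (simp add: S_def I_def)
    qed
    moreover have "I \<subseteq> {..N}"
    proof
      fix i assume i: "i \<in> I"
      show "i \<in> {..N}"
      proof (rule ccontr)
        assume "i \<notin> {..N}"
        then obtain i' where i': "i = Suc i'" "N \<le> i'" by (cases i) auto
        have "part nu i \<le> part la i'" using that(2) i' by (simp add: hstrip_def)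
        also have "\<dots> = 0" using i' len_la by simp
        finally have "part nu i = 0" by simp
        moreover have "part mu i \<le> part nu i" using that(1) by (simp add: vstrip_def)
        ultimately show False using i by (simp add: I_def)
      qed
    qed
    moreover have "part mu (Suc i) < part la i" if "Suc i \<in> I" for i
    proof -
      have "part nu (Suc i) = Suc (part mu (Suc i))" using that by (simp add: nu nuI_def)
      then show ?thesis using \<open>hstrip la nu\<close> by (metis Suc_le_eq hstripD(2))
    qed
    ultimately show ?thesis using nu by (auto simp: validI_def)
  qed
  have I_of: "{i. part nu i \<noteq> part mu i} = I" if "part nu = nuI I" for I nu
    using that by (auto simp: nuI_def)
  have "(\<Sum>nu | vstrip mu nu \<and> hstrip la nu \<and> psize nu = psize mu + k.
      vpsi nu mu * psi nu la) =
    (\<Sum>I | validI I \<and> card I = k. Base * (E k * xi I))"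
  proof (rule sum.reindex_bij_witness[where i = "\<lambda>I. of_part (nuI I)" and j = "\<lambda>nu. {i. part nu i \<noteq> part mu i}"])
    fix nu assume "nu \<in> {nu. vstrip mu nu \<and> hstrip la nu \<and> psize nu = psize mu + k}"
    then obtain I where I: "validI I" "part nu = nuI I" and sz: "psize nu = psize mu + k" using validI_char by blast
    note io = I_of[OF I(2)]
    show "of_part (nuI {i. part nu i \<noteq> part mu i}) = nu" unfolding io I(2)[symmetric] by simp
    have c: "card I = k" using psize_nuI[OF _ I(2)] I(1) sz by (simp add: validI_def)
    then show "{i. part nu i \<noteq> part mu i} \<in> {I. validI I \<and> card I = k}" using I io by simp
    show "Base * (E k * xi {i. part nu i \<noteq> part mu i}) = vpsi nu mu * psi nu la"
      unfolding io weight_L[OF I] c ..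
  next
    fix I assume "I \<in> {I. validI I \<and> card I = k}"
    then have I: "validI I" "card I = k" by auto
    define nu where "nu = of_part (nuI I)"
    have nu: "part nu = nuI I" using part_nuI[OF I(1)] by (simp add: nu_def)
    show "{i. part (of_part (nuI I)) i \<noteq> part mu i} = I" using I_of[OF nu] by (simp add: nu_def)
    have "vstrip mu nu" by (simp add: vstrip_def nu nuI_def)
    moreover have "hstrip la nu"
    proof -
      have "part la i \<le> part nu i" for i
        using I la_le[of i] not_S[of i] by (auto simp: nu nuI_def validI_def)
      moreover have "part nu (Suc i) \<le> part la i" for i
        using I mu_le[of i] by (auto simp: nu nuI_def validI_def Suc_le_eq)
      ultimately show ?thesis by (simp add: hstrip_def)
    qed
    moreover have "psize nu = psize mu + k" using psize_nuI[OF _ nu] I by (simp add: validI_def)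
    ultimately show "of_part (nuI I) \<in> {nu. vstrip mu nu \<and> hstrip la nu \<and> psize nu = psize mu + k}"
      by (simp add: nu_def)
  qed
  also have "\<dots> = (\<Sum>I | S \<subseteq> I \<and> I \<subseteq> A \<union> S \<and> card I = k. Base * (E k * xi I))"
  proof (rule sum.mono_neutral_left)
    have "finite (A \<union> S)" by simp
    then show "finite {I. S \<subseteq> I \<and> I \<subseteq> A \<union> S \<and> card I = k}"
      by (rule finite_subset[rotated, OF finite_Pow_iff[THEN iffD2]]) auto
    have AS: "A \<union> S = {..N}" using S_le by (auto simp: A_def)
    then show "{I. validI I \<and> card I = k} \<subseteq> {I. S \<subseteq> I \<and> I \<subseteq> A \<union> S \<and> card I = k}"
      by (auto simp: validI_def)
    show "\<forall>I\<in>{I. S \<subseteq> I \<and> I \<subseteq> A \<union> S \<and> card I = k} - {I. validI I \<and> card I = k}. Base * (E k * xi I) = 0"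
      using xi_invalid unfolding AS by auto
  qed
  also have "\<dots> = (if card S \<le> k then
      \<Sum>I | I \<subseteq> A \<and> card I = k - card S. Base * (E k * xi (S \<union> I)) else 0)"
    by (rule sum_split_S) (auto simp: A_def)
  also have "\<dots> = Base * E k * KS * (if card S \<le> k then ss.xsum A B (k - card S) else 0)"
    by (simp add: xi_split ss.xsum_def sum_distrib_left mult_ac)
  finally show ?thesis .
qed

lemma sum_R:
  "(\<Sum>ka | hstrip ka mu \<and> vstrip ka la \<and> psize la = psize ka + k.
      vpsi la ka * psi mu ka) =
    Base * E k * KS * (if card S \<le> k then ss.ysum A B (k - card S) else 0)"
proof -
  have validJ_char: "\<exists>J. validJ J \<and> part ka = kaJ J" if "hstrip ka mu" "vstrip ka la" for ka
  proof -
    define J where "J = {i. part la i \<noteq> part ka i}"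
    have laJ: "part la i = part ka i + (if i \<in> J then 1 else 0)" for i
      using that(2) unfolding vstrip_def J_def by (auto dest!: spec[of _ i])
    then have ka: "part ka = kaJ J" by (auto simp: kaJ_def)
    have "S \<subseteq> J"
    proof
      fix i assume "i \<in> S"
      then show "i \<in> J" using hstripD(1)[OF that(1), of i] by (simp add: S_def J_def)
    qed
    moreover have "J \<subseteq> {..<N}"
    proof
      fix i assume "i \<in> J"
      then have "part la i \<noteq> 0" using laJ[of i] by simp
      then show "i \<in> {..<N}" using len_la part_eq_0[of la i] by (meson le_trans lessThan_iff not_less)
    qed
    moreover have "part mu (Suc j) < part la j" if "j \<in> J" for j
      using laJ[of j] that hstripD(2)[OF \<open>hstrip ka mu\<close>, of j] by simp
    ultimately show ?thesis using ka by (auto simp: validJ_def)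
  qed
  have pos: "part la j > 0" if "validJ J" "j \<in> J" for j J using that by (auto simp: validJ_def)
  have J_of: "{i. part la i \<noteq> part ka i} = J" if "part ka = kaJ J" "validJ J" for J ka
  proof (rule set_eqI)
    fix i
    show "i \<in> {i. part la i \<noteq> part ka i} \<longleftrightarrow> i \<in> J"
      using pos[OF that(2), of i] by (cases "i \<in> J") (simp_all add: that(1) kaJ_def)
  qed
  have "(\<Sum>ka | hstrip ka mu \<and> vstrip ka la \<and> psize la = psize ka + k.
      vpsi la ka * psi mu ka) =
    (\<Sum>J | validJ J \<and> card J = k. Base * (E k * eta J))"
  proof (rule sum.reindex_bij_witness[where i = "\<lambda>J. of_part (kaJ J)" and j = "\<lambda>ka. {i. part la i \<noteq> part ka i}"])
    fix ka assume "ka \<in> {ka. hstrip ka mu \<and> vstrip ka la \<and> psize la = psize ka + k}"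
    then obtain J where J: "validJ J" "part ka = kaJ J" and sz: "psize la = psize ka + k" using validJ_char by blast
    note jo = J_of[OF J(2,1)]
    show "of_part (kaJ {i. part la i \<noteq> part ka i}) = ka" unfolding jo J(2)[symmetric] by simp
    have c: "card J = k" using psize_kaJ[OF _ J(2) pos[OF J(1)]] J(1) sz by (simp add: validJ_def)
    then show "{i. part la i \<noteq> part ka i} \<in> {J. validJ J \<and> card J = k}" using J jo by simp
    show "Base * (E k * eta {i. part la i \<noteq> part ka i}) = vpsi la ka * psi mu ka"
      unfolding jo weight_R[OF J] c ..
  next
    fix J assume "J \<in> {J. validJ J \<and> card J = k}"
    then have J: "validJ J" "card J = k" by auto
    define ka where "ka = of_part (kaJ J)"
    have ka: "part ka = kaJ J" using part_kaJ[OF J(1)] by (simp add: ka_def)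
    show "{i. part la i \<noteq> part (of_part (kaJ J)) i} = J" using J_of[OF ka J(1)] by (simp add: ka_def)
    have "vstrip ka la" by (auto simp: vstrip_def ka kaJ_def)
    moreover have "hstrip ka mu"
    proof -
      have "part ka i \<le> part mu i" for i
        using J la_le[of i] not_S[of i] by (auto simp: ka kaJ_def validJ_def)
      moreover have "part mu (Suc i) \<le> part ka i" for i
        using J mu_le[of i] by (auto simp: ka kaJ_def validJ_def)
      ultimately show ?thesis by (simp add: hstrip_def)
    qed
    moreover have "psize la = psize ka + k" using psize_kaJ[OF _ ka pos[OF J(1)]] J by (simp add: validJ_def)
    ultimately show "of_part (kaJ J) \<in> {ka. hstrip ka mu \<and> vstrip ka la \<and> psize la = psize ka + k}"
      by (simp add: ka_def)
  qed
  also have "\<dots> = (\<Sum>J | S \<subseteq> J \<and> J \<subseteq> B \<union> S \<and> card J = k. Base * (E k * eta J))"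
  proof (rule sum.mono_neutral_left)
    have "finite (B \<union> S)" by simp
    then show "finite {J. S \<subseteq> J \<and> J \<subseteq> B \<union> S \<and> card J = k}"
      by (rule finite_subset[rotated, OF finite_Pow_iff[THEN iffD2]]) auto
    have BS: "B \<union> S = {..<N}" using S_subset by (auto simp: B_def)
    then show "{J. validJ J \<and> card J = k} \<subseteq> {J. S \<subseteq> J \<and> J \<subseteq> B \<union> S \<and> card J = k}"
      by (auto simp: validJ_def)
    show "\<forall>J\<in>{J. S \<subseteq> J \<and> J \<subseteq> B \<union> S \<and> card J = k} - {J. validJ J \<and> card J = k}. Base * (E k * eta J) = 0"
      using eta_invalid unfolding BS by auto
  qed
  also have "\<dots> = (if card S \<le> k then
      \<Sum>J | J \<subseteq> B \<and> card J = k - card S. Base * (E k * eta (S \<union> J)) else 0)"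
    by (rule sum_split_S) (auto simp: B_def)
  also have "\<dots> = Base * E k * KS * (if card S \<le> k then ss.ysum A B (k - card S) else 0)"
    by (simp add: eta_split ss.ysum_def sum_distrib_left mult_ac)
  finally show ?thesis .
qed

lemma E_Suc: "E (Suc n) * (t / q) powi (int N - int n) = E n"
proof -
  have "E (Suc n) = E n * z ^ N / z ^ n"
    by (simp add: E_def numeral_2_eq_2 power_add mult_ac)
  moreover have "(t / q) powi (int N - int n) = z ^ n / z ^ N"
  proof -
    have "(t / q) powi (int N - int n) = (t / q) ^ N / (t / q) ^ n"
      by (subst power_int_diff) (use q0 t0 in auto)
    then show ?thesis using q0 t0 by (simp add: z_def power_divide mult_ac)
  qed
  ultimately show ?thesis using z_nz by simp
qed

text \<open>
  After removal of the rows in $S$ there is one $x$ more than $y$: row $N$ of $\mu$ is empty and may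
  receive a box. So the two-term case of the subset identity applies, and its second term is
  the extra term here.
\<close>

lemma strip_commutation_interlacing:
  "(\<Sum>nu | vstrip mu nu \<and> hstrip la nu \<and> psize nu = psize mu + k.
      vpsi nu mu * psi nu la) =
   (\<Sum>ka | hstrip ka mu \<and> vstrip ka la \<and> psize la = psize ka + k.
      vpsi la ka * psi mu ka) +
   (\<Sum>ka | hstrip ka mu \<and> vstrip ka la \<and> Suc (psize la) = psize ka + k.
      vpsi la ka * psi mu ka)"
proof (cases k)
  case 0
  have "psize ka \<le> psize la" if "vstrip ka la" for ka using that by (intro psize_mono) (simp add: vstrip_def)
  then have e: "{ka. hstrip ka mu \<and> vstrip ka la \<and> Suc (psize la) = psize ka + k} = {}"
    using 0 by fastforce
  show ?thesis unfolding e sum_L sum_R sum.empty using 0 ss.xsum_eq_ysum_Suc[OF good_AB card_AB(1), of 0] by simp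
next
  case (Suc n)
  have eq: "{ka. hstrip ka mu \<and> vstrip ka la \<and> Suc (psize la) = psize ka + k} =
      {ka. hstrip ka mu \<and> vstrip ka la \<and> psize la = psize ka + n}" using Suc by auto
  consider "k < card S" | "k = card S" | "card S \<le> n" using Suc by linarith
  then show ?thesis
  proof cases
    case 1
    then show ?thesis unfolding sum_L eq sum_R using Suc by simp
  next
    case 2
    then show ?thesis unfolding sum_L eq sum_R
      using Suc ss.xsum_eq_ysum_Suc[OF good_AB card_AB(1), of 0] by simp
  next
    case 3
    have m: "k - card S = Suc (n - card S)" using 3 Suc by simp
    \<comment> \<open>the rows in \<open>S\<close> shift the exponent of the two-term identity exactly so that it cancels against \<open>E n / E k\<close>\<close>
    have "int (card B) - int (Suc (n - card S)) + 1 = int N - int n" using card_AB(2) 3 by simp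
    then have "ss.xsum A B (k - card S) = ss.ysum A B (k - card S)
        + (t / q) powi (int N - int n) * ss.ysum A B (n - card S)"
      using ss.xsum_eq_ysum_Suc[OF good_AB card_AB(1), of "k - card S"] m by simp
    moreover have En: "E n = E k * (t / q) powi (int N - int n)" using E_Suc Suc by simp
    moreover have "card S \<le> k" using 3 Suc by simp
    ultimately show ?thesis unfolding sum_L eq sum_R En using 3
      by (simp only: if_True distrib_left mult_ac)
  qed
qed

end

section \<open>Commutation of horizontal and vertical strips\<close>

lemma finite_power_coincidence:
  fixes q :: real
  assumes "(a, b) \<noteq> (c, d)" "q \<noteq> 0" "\<bar>q\<bar> < 1"
  shows "finite {t. t \<noteq> 0 \<and> q ^ a * t ^ b = q ^ c * t ^ d}"
proof -
  define p where "p = monom (q ^ a) b - monom (q ^ c) d"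
  have "p \<noteq> 0"
  proof
    assume "p = 0"
    then have eq: "monom (q ^ a) b = monom (q ^ c) d" by (simp add: p_def)
    then have "b = d" using assms(2) by (metis degree_monom_eq power_not_zero)
    then have "\<bar>q\<bar> ^ a = \<bar>q\<bar> ^ c" using eq \<open>b = d\<close> by (simp flip: power_abs)
    then have "a = c" using assms(2,3)
      by (metis less_irrefl linorder_neqE_nat power_strict_decreasing zero_less_abs_iff)
    then show False using assms(1) \<open>b = d\<close> by simp
  qed
  then have "finite {t. poly p t = 0}" by (rule poly_roots_finite)
  then show ?thesis by (rule rev_finite_subset) (auto simp: p_def poly_monom)
qed

definition multiplicatively_independent :: "real \<Rightarrow> real \<Rightarrow> bool" where
  "multiplicatively_independent q t \<longleftrightarrow> q \<noteq> 0 \<and> t \<noteq> 0 \<and>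
    (\<forall>a b c d. q ^ a * t ^ b = q ^ c * t ^ d \<longrightarrow> a = c \<and> b = d)"

text \<open>
  For a fixed $q$ different from 0, each of the countably many nontrivial coincidences of monomials
  excludes only finitely many $t$.
\<close>

lemma ex_independent_near:
  fixes q t e :: real
  assumes "e > 0" "- 1 < q" "q < 1" "- 1 < t" "t < 1"
  shows "\<exists>q' t'. \<bar>q' - q\<bar> < e \<and> \<bar>t' - t\<bar> < e \<and> -1 < q' \<and> q' < 1 \<and> -1 < t' \<and> t' < 1
    \<and> multiplicatively_independent q' t'"
proof -
  have int: "\<exists>x'. \<bar>x' - x\<bar> < e \<and> - 1 < x' \<and> x' < 1 \<and> x' \<notin> C"
    if C: "countable C" and x: "- 1 < x" "x < 1" for x and C :: "real set"
  proof -
    have "max (-1) (x - e) < min 1 (x + e)" using x assms(1) by auto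
    then have "uncountable {max (-1) (x - e)<..<min 1 (x + e)}" by (simp add: uncountable_open_interval)
    then have "\<not> {max (-1) (x - e)<..<min 1 (x + e)} \<subseteq> C"
      using C countable_subset by metis
    then obtain x' where "x' \<in> {max (-1) (x - e)<..<min 1 (x + e)}" "x' \<notin> C" by blast
    then show ?thesis by (intro exI[of _ x']) (auto simp: abs_less_iff)
  qed
  obtain q' where q': "\<bar>q' - q\<bar> < e" "- 1 < q'" "q' < 1" "q' \<notin> {0}"
    using int[of "{0}" q] assms by auto
  define T where "T = (\<lambda>(a, b, c, d). {t. t \<noteq> 0 \<and> q' ^ a * t ^ b = q' ^ c * t ^ d})"
  define C where "C = insert 0 (\<Union>x\<in>{(a, b, c, d). (a, b) \<noteq> (c, d)}. T x)"
  have "countable (T x)" if "x \<in> {(a, b, c, d). (a, b) \<noteq> (c, d)}" for x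
  proof -
    obtain a b c d where "x = (a, b, c, d)" by (cases x rule: prod_cases4)
    then have x: "x = (a, b, c, d)" "(a, b) \<noteq> (c, d)" using that by auto
    have "finite (T x)" unfolding x(1) T_def prod.case
      by (rule finite_power_coincidence) (use x q' in auto)
    then show ?thesis by (rule countable_finite)
  qed
  then have "countable C" unfolding C_def by (intro countable_insert countable_UN) auto
  then obtain t' where t': "\<bar>t' - t\<bar> < e" "- 1 < t'" "t' < 1" "t' \<notin> C"
    using int[of C t] assms by auto
  have "a = c \<and> b = d" if eq: "q' ^ a * t' ^ b = q' ^ c * t' ^ d" for a b c d
  proof (rule ccontr)
    assume "\<not> (a = c \<and> b = d)"
    then have "(a, b, c, d) \<in> {(a, b, c, d). (a, b) \<noteq> (c, d)}" by auto
    moreover have "t' \<in> T (a, b, c, d)" using eq t' by (simp add: T_def C_def)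
    ultimately show False using t' unfolding C_def by blast
  qed
  then have "multiplicatively_independent q' t'"
    using q' t' by (auto simp: multiplicatively_independent_def C_def)
  then show ?thesis using q' t' by blast
qed

context macdonald
begin

lemma tendsto_one_minus:
  assumes "(Q \<longlongrightarrow> q) F" "(T \<longlongrightarrow> t) F"
  shows "((\<lambda>n. 1 - Q n ^ a * T n ^ b) \<longlongrightarrow> 1 - q ^ a * t ^ b) F"
  using assms by (intro tendsto_intros)

lemma tendsto_mac_b:
  assumes "(Q \<longlongrightarrow> q) F" "(T \<longlongrightarrow> t) F"
  shows "((\<lambda>n. mac_b (Q n) (T n) D s) \<longlongrightarrow> mac_b q t D s) F"
proof (cases "s \<in> D")
  case True
  obtain i j where "s = (i, j)" by (cases s) auto
  then show ?thesis using True unfolding mac_b_def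
    by (auto intro!: tendsto_divide tendsto_one_minus assms one_minus_qt_nz simp del: power_Suc)
qed (simp add: mac_b_def)

lemma tendsto_mac_psi:
  assumes "(Q \<longlongrightarrow> q) F" "(T \<longlongrightarrow> t) F"
  shows "((\<lambda>n. mac_psi (Q n) (T n) (diagram \<nu>) (diagram \<mu>)) \<longlongrightarrow> psi \<nu> \<mu>) F"
  unfolding mac_psi_def
  by (intro tendsto_prod tendsto_divide tendsto_mac_b assms) (use mac_b_pos[of \<nu>] in \<open>auto simp: less_le\<close>)

end

lemma tendsto_vpsi:
  assumes m: "macdonald q t" and mn: "\<And>n. macdonald (Q n) (T n)"
    and lim: "(Q \<longlongrightarrow> q) F" "(T \<longlongrightarrow> t) F" and "vstrip \<mu> \<nu>"
  shows "((\<lambda>n. macdonald.vpsi (Q n) (T n) \<nu> \<mu>) \<longlongrightarrow> macdonald.vpsi q t \<nu> \<mu>) F"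
proof -
  interpret macdonald q t by (rule m)
  have "((\<lambda>n. macdonald.vf (Q n) (T n) c d l) \<longlongrightarrow> vf c d l) F" if "l > 0" for c d l
    unfolding vf_def macdonald.vf_def[OF mn]
    by (intro tendsto_divide tendsto_mult tendsto_one_minus lim)
      (use that one_minus_qt_nz[of c l] one_minus_qt_nz[of d l] in simp)
  then show ?thesis
    unfolding vpsi_def macdonald.vpsi_def[OF mn] by (intro tendsto_prod) auto
qed

lemma strip_pair_iff_independent:
  "strip_pair q t la mu N \<longleftrightarrow> macdonald q t \<and> multiplicatively_independent q t
    \<and> (\<forall>i. part la i \<le> Suc (part mu i)) \<and> (\<forall>i. part mu (Suc i) \<le> part la i)
    \<and> plen la \<le> N \<and> plen mu \<le> N"
  unfolding strip_pair_def strip_pair_axioms_def multiplicatively_independent_def by auto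

text \<open>
  The difference of the two sides of the commutation identity, as a function of $q$ and $t$, so
  that its continuity can be expressed.
\<close>

definition comm_defect :: "real \<Rightarrow> real \<Rightarrow> int_partition \<Rightarrow> int_partition \<Rightarrow> nat \<Rightarrow> real" where
  "comm_defect q t la mu k =
   (\<Sum>nu | vstrip mu nu \<and> hstrip la nu \<and> psize nu = psize mu + k.
      macdonald.vpsi q t nu mu * mac_psi q t (diagram nu) (diagram la)) -
   ((\<Sum>ka | hstrip ka mu \<and> vstrip ka la \<and> psize la = psize ka + k.
      macdonald.vpsi q t la ka * mac_psi q t (diagram mu) (diagram ka)) +
   (\<Sum>ka | hstrip ka mu \<and> vstrip ka la \<and> Suc (psize la) = psize ka + k.
      macdonald.vpsi q t la ka * mac_psi q t (diagram mu) (diagram ka)))"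

text \<open>
  If the two partitions do not interlace, then no term occurs in any of the sums.
\<close>

lemma comm_defect_independent:
  assumes "macdonald q t" "multiplicatively_independent q t"
  shows "comm_defect q t la mu k = 0"
proof -
  interpret macdonald q t by (rule assms)
  consider "\<forall>i. part la i \<le> Suc (part mu i)" "\<forall>i. part mu (Suc i) \<le> part la i"
    | i where "part la i > Suc (part mu i)" | i where "part mu (Suc i) > part la i"
    by (meson not_less)
  then show ?thesis
  proof cases
    case 1
    then interpret strip_pair q t la mu "max (plen la) (plen mu)"
      using assms by (simp add: strip_pair_iff_independent)
    show ?thesis unfolding comm_defect_def strip_commutation_interlacing by simp
  next
    case (2 i)
    have no1: "\<not> (vstrip mu nu \<and> hstrip la nu)" for nu
      using 2 unfolding vstrip_def hstrip_def by (metis le_trans not_less)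
    have no2: "\<not> (hstrip ka mu \<and> vstrip ka la)" for ka
      using 2 unfolding vstrip_def hstrip_def by (metis Suc_le_mono le_trans not_less)
    have "{nu. vstrip mu nu \<and> hstrip la nu \<and> P nu} = {}" "{ka. hstrip ka mu \<and> vstrip ka la \<and> P ka} = {}"
      for P using no1 no2 by blast+
    then show ?thesis unfolding comm_defect_def by (simp only: sum.empty)
  next
    case (3 i)
    have no1: "\<not> (vstrip mu nu \<and> hstrip la nu)" for nu
      using 3 unfolding vstrip_def hstrip_def by (metis le_trans not_less)
    have no2: "\<not> (hstrip ka mu \<and> vstrip ka la)" for ka
      using 3 unfolding vstrip_def hstrip_def by (metis le_trans not_less)
    have "{nu. vstrip mu nu \<and> hstrip la nu \<and> P nu} = {}" "{ka. hstrip ka mu \<and> vstrip ka la \<and> P ka} = {}"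
      for P using no1 no2 by blast+
    then show ?thesis unfolding comm_defect_def by (simp only: sum.empty)
  qed
qed

context macdonald
begin

text \<open>
  The independent pairs $(q, t)$ are dense and both sides are continuous.
\<close>

theorem strip_commutation:
  "(\<Sum>nu | vstrip mu nu \<and> hstrip la nu \<and> psize nu = psize mu + k.
      vpsi nu mu * psi nu la) =
   (\<Sum>ka | hstrip ka mu \<and> vstrip ka la \<and> psize la = psize ka + k.
      vpsi la ka * psi mu ka) +
   (\<Sum>ka | hstrip ka mu \<and> vstrip ka la \<and> Suc (psize la) = psize ka + k.
      vpsi la ka * psi mu ka)"
proof -
  have "\<exists>q' t'. \<bar>q' - q\<bar> < 1 / real (Suc n) \<and> \<bar>t' - t\<bar> < 1 / real (Suc n) \<and>
      macdonald q' t' \<and> multiplicatively_independent q' t'" for n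
  proof -
    have "1 / real (Suc n) > 0" by simp
    from ex_independent_near[OF this q_bounds t_bounds] show ?thesis
      unfolding macdonald_def by (elim exE conjE) (intro exI conjI)
  qed
  then have "\<forall>n. \<exists>p. \<bar>fst p - q\<bar> < 1 / real (Suc n) \<and> \<bar>snd p - t\<bar> < 1 / real (Suc n) \<and>
      macdonald (fst p) (snd p) \<and> multiplicatively_independent (fst p) (snd p)" by auto
  from choice[OF this] obtain p where p: "\<And>n. \<bar>fst (p n) - q\<bar> < 1 / real (Suc n) \<and>
      \<bar>snd (p n) - t\<bar> < 1 / real (Suc n) \<and> macdonald (fst (p n)) (snd (p n)) \<and>
      multiplicatively_independent (fst (p n)) (snd (p n))" by blast
  define Q T where "Q n = fst (p n)" and "T n = snd (p n)" for n
  have QT: "\<bar>Q n - q\<bar> < 1 / real (Suc n)" "\<bar>T n - t\<bar> < 1 / real (Suc n)"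
      "macdonald (Q n) (T n)" "multiplicatively_independent (Q n) (T n)" for n
    using p[of n] by (simp_all add: Q_def T_def)
  have lim0: "(\<lambda>n. 1 / real (Suc n)) \<longlonglongrightarrow> 0" using LIMSEQ_inverse_real_of_nat by (simp add: inverse_eq_divide)
  have "norm (Q n - q) \<le> 1 / real (Suc n)" "norm (T n - t) \<le> 1 / real (Suc n)" for n
    using QT(1,2)[of n] by (simp_all only: real_norm_def less_imp_le)
  then have "(\<lambda>n. Q n - q) \<longlonglongrightarrow> 0" "(\<lambda>n. T n - t) \<longlonglongrightarrow> 0"
    by (intro Lim_null_comparison[OF always_eventually lim0] allI; blast)+
  then have lim: "Q \<longlonglongrightarrow> q" "T \<longlonglongrightarrow> t" by (simp_all only: LIM_zero_iff)
  have "(\<lambda>n. comm_defect (Q n) (T n) la mu k) \<longlonglongrightarrow> comm_defect q t la mu k"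
    unfolding comm_defect_def
    by (intro tendsto_diff tendsto_add tendsto_sum tendsto_mult tendsto_mac_psi lim
        tendsto_vpsi[OF macdonald_axioms QT(3)]) auto
  then have "(\<lambda>n::nat. 0::real) \<longlonglongrightarrow> comm_defect q t la mu k"
    by (simp add: comm_defect_independent QT)
  then have "comm_defect q t la mu k = 0" by (simp add: LIMSEQ_const_iff)
  then show ?thesis by (simp add: comm_defect_def)
qed

end

section \<open>Tableaux as chains of horizontal strips\<close>

lemma ex_diagram:
  assumes fin: "finite D" and pos: "\<And>i j. (i, j) \<in> D \<Longrightarrow> 1 \<le> i \<and> 1 \<le> j"
    and down: "\<And>i j i' j'. (i, j) \<in> D \<Longrightarrow> 1 \<le> i' \<Longrightarrow> i' \<le> i \<Longrightarrow> 1 \<le> j' \<Longrightarrow> j' \<le> j \<Longrightarrow> (i', j') \<in> D"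
  shows "\<exists>\<kappa>. diagram \<kappa> = D"
proof -
  define R where "R i = {j. (Suc i, Suc j) \<in> D}" for i
  define g where "g i = card (R i)" for i
  have finR: "finite (R i)" for i
  proof (rule finite_subset)
    show "R i \<subseteq> (\<lambda>s. snd s - 1) ` D" by (force simp: R_def)
  qed (use fin in simp)
  have R: "R i = {..<g i}" for i
  proof -
    have dn: "j' \<in> R i" if "j \<in> R i" "j' \<le> j" for j j'
      using that down[of "Suc i" "Suc j" "Suc i" "Suc j'"] by (simp add: R_def)
    have "j < g i" if "j \<in> R i" for j
    proof -
      have "{..j} \<subseteq> R i" using dn that by auto
      from card_mono[OF finR this] show ?thesis by (simp add: g_def)
    qed
    then have "R i \<subseteq> {..<g i}" by auto
    then show ?thesis by (intro card_subset_eq) (simp_all add: g_def)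
  qed
  have "g (Suc i) \<le> g i" for i
  proof -
    have "R (Suc i) \<subseteq> R i" using down by (fastforce simp: R_def)
    then show ?thesis unfolding g_def by (rule card_mono[OF finR])
  qed
  moreover have "\<exists>n. g n = 0"
  proof -
    obtain n where n: "\<forall>x\<in>fst ` D. x \<le> n" using fin finite_nat_set_iff_bounded_le by (metis finite_imageI)
    have "R n = {}" using n by (force simp: R_def)
    then have "g n = 0" by (simp add: g_def)
    then show ?thesis by blast
  qed
  ultimately obtain \<kappa> where \<kappa>: "part \<kappa> = g" using ex_part by blast
  have "s \<in> diagram \<kappa> \<longleftrightarrow> s \<in> D" for s
  proof (cases s)
    case (Pair a b)
    show ?thesis
    proof (cases "a = 0 \<or> b = 0")
      case True
      then show ?thesis using Pair pos[of a b] by auto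
    next
      case False
      then obtain i j where ij: "a = Suc i" "b = Suc j" by (meson not0_implies_Suc)
      have "s \<in> diagram \<kappa> \<longleftrightarrow> j \<in> R i" by (simp add: Pair ij \<kappa> R)
      then show ?thesis by (simp add: R_def Pair ij)
    qed
  qed
  then show ?thesis by blast
qed

definition part_of_diagram :: "(nat \<times> nat) set \<Rightarrow> int_partition" where
  "part_of_diagram D = (THE \<kappa>. diagram \<kappa> = D)"

lemma part_of_diagram_diagram [simp]: "part_of_diagram (diagram \<kappa>) = \<kappa>"
  unfolding part_of_diagram_def by (rule the_equality) (auto simp: diagram_inject)

lemma diagram_down: "(i, j) \<in> diagram \<nu> \<Longrightarrow> 1 \<le> i' \<Longrightarrow> i' \<le> i \<Longrightarrow> 1 \<le> j' \<Longrightarrow> j' \<le> j \<Longrightarrow> (i', j') \<in> diagram \<nu>"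
proof -
  assume a: "(i, j) \<in> diagram \<nu>" "1 \<le> i'" "i' \<le> i" "1 \<le> j'" "j' \<le> j"
  obtain a b where ab: "i = Suc a" "j = Suc b" "b < part \<nu> a" using a(1) by (auto elim: diagramE)
  obtain c d where cd: "i' = Suc c" "j' = Suc d" using a by (metis Suc_le_D One_nat_def)
  have "part \<nu> a \<le> part \<nu> c" using a(3) ab cd by (intro part_antimono) simp
  then show ?thesis using ab cd a by simp
qed

lemma ssyt_row: "T \<in> ssyt \<nu> \<Longrightarrow> (i, j) \<in> diagram \<nu> \<Longrightarrow> (i, j') \<in> diagram \<nu> \<Longrightarrow> j \<le> j' \<Longrightarrow>
    T (i, j) \<le> T (i, j')"
  by (cases "j = j'") (simp_all add: ssyt_def)

lemma ssyt_col: "T \<in> ssyt \<nu> \<Longrightarrow> (i, j) \<in> diagram \<nu> \<Longrightarrow> (i', j) \<in> diagram \<nu> \<Longrightarrow> i < i' \<Longrightarrow>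
    T (i, j) < T (i', j)"
  by (simp add: ssyt_def)

text \<open>
  Entries increase along rows and columns, so the boxes with small entries are closed under moving
  left and up.
\<close>

lemma subshape_is_diagram:
  assumes T: "T \<in> ssyt \<nu>"
  shows "diagram (part_of_diagram (subshape \<nu> T n)) = subshape \<nu> T n"
proof -
  note row = ssyt_row[OF T]
  have col: "T (i, j) \<le> T (i', j)" if "(i, j) \<in> diagram \<nu>" "(i', j) \<in> diagram \<nu>" "i \<le> i'" for i i' j
    using ssyt_col[OF T that(1,2)] that(3) by (cases "i = i'") simp_all
  have "\<exists>\<kappa>. diagram \<kappa> = subshape \<nu> T n"
  proof (rule ex_diagram)
    show "finite (subshape \<nu> T n)" by (simp add: subshape_def)
    show "1 \<le> i \<and> 1 \<le> j" if "(i, j) \<in> subshape \<nu> T n" for i j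
      using that by (auto simp: subshape_def diagram_def)
    fix i j i' j' assume a: "(i, j) \<in> subshape \<nu> T n" "1 \<le> i'" "i' \<le> i" "1 \<le> j'" "j' \<le> j"
    have d: "(i, j) \<in> diagram \<nu>" using a by (simp add: subshape_def)
    have d1: "(i', j) \<in> diagram \<nu>" using diagram_down[OF d, of i' j] a by simp
    have d2: "(i', j') \<in> diagram \<nu>" using diagram_down[OF d, of i' j'] a by simp
    have "T (i', j') \<le> T (i', j)" using row d1 d2 a by simp
    also have "\<dots> \<le> T (i, j)" using col d d1 a by simp
    finally show "(i', j') \<in> subshape \<nu> T n" using a d2 by (simp add: subshape_def)
  qed
  then show ?thesis by (metis part_of_diagram_diagram)
qed

text \<open>
  The tableaux with entries below $n$ and content $c$.
\<close>

definition tabs :: "nat \<Rightarrow> int_partition \<Rightarrow> (nat \<Rightarrow> nat) \<Rightarrow> (nat \<times> nat \<Rightarrow> nat) set" where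
  "tabs n \<nu> c = {T \<in> ssyt \<nu>. (\<forall>s\<in>diagram \<nu>. T s < n) \<and>
     (\<forall>i<n. c i = card (subshape \<nu> T (Suc i)) - card (subshape \<nu> T i))}"

lemma finite_tabs: "finite (tabs n \<nu> c)"
proof (rule finite_subset)
  show "tabs n \<nu> c \<subseteq> PiE (diagram \<nu>) (\<lambda>_. {..<n})"
    by (auto simp: tabs_def ssyt_def PiE_def)
qed (auto intro: finite_PiE)

lemma finite_hstrip: "finite {\<kappa>. hstrip \<kappa> \<nu> \<and> P \<kappa>}"
  by (rule finite_subset[OF _ finite_psize[of "psize \<nu>"]]) (auto intro: psize_mono simp: hstrip_def)

text \<open>
  Fills the boxes of $\nu$ outside $\kappa$ with the entry $n$, and is the inverse of
  the restriction to $\kappa$.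
\<close>

definition extend_tab :: "int_partition \<Rightarrow> int_partition \<Rightarrow> nat \<Rightarrow> (nat \<times> nat \<Rightarrow> nat) \<Rightarrow> nat \<times> nat \<Rightarrow> nat" where
  "extend_tab \<nu> \<kappa> n T s = (if s \<in> diagram \<kappa> then T s else if s \<in> diagram \<nu> then n else undefined)"

lemma subshape_restrict:
  assumes "diagram \<kappa> = subshape \<nu> T n" "i \<le> n"
  shows "subshape \<kappa> (restrict T (diagram \<kappa>)) i = subshape \<nu> T i"
proof -
  have "s \<in> diagram \<kappa> \<longleftrightarrow> s \<in> diagram \<nu> \<and> T s < n" for s
    unfolding assms(1) by (simp add: subshape_def)
  then have "s \<in> subshape \<kappa> (restrict T (diagram \<kappa>)) i \<longleftrightarrow> s \<in> subshape \<nu> T i" for s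
    using assms(2) unfolding subshape_def by (cases "s \<in> diagram \<kappa>") auto
  then show ?thesis by blast
qed

lemma subshape_extend:
  assumes "diagram \<kappa> \<subseteq> diagram \<nu>" "\<forall>s\<in>diagram \<kappa>. T s < n" "i \<le> n"
  shows "subshape \<nu> (extend_tab \<nu> \<kappa> n T) i = subshape \<kappa> T i"
  using assms by (auto simp: subshape_def extend_tab_def)

lemma hstrip_of_tab:
  assumes T: "T \<in> tabs (Suc n) \<nu> c" and k: "diagram \<kappa> = subshape \<nu> T n"
  shows "hstrip \<kappa> \<nu>" "psize \<nu> = psize \<kappa> + c n" "restrict T (diagram \<kappa>) \<in> tabs n \<kappa> c"
proof -
  have sT: "T \<in> ssyt \<nu>" and lt: "\<And>s. s \<in> diagram \<nu> \<Longrightarrow> T s < Suc n"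
    and c: "\<And>i. i < Suc n \<Longrightarrow> c i = card (subshape \<nu> T (Suc i)) - card (subshape \<nu> T i)"
    using T by (auto simp: tabs_def)
  have sub: "diagram \<kappa> \<subseteq> diagram \<nu>" using k by (auto simp: subshape_def)
  show "hstrip \<kappa> \<nu>"
    unfolding hstrip_def
  proof (intro allI conjI)
    fix i
    show "part \<kappa> i \<le> part \<nu> i" using sub by (simp add: diagram_subset_iff)
    show "part \<nu> (Suc i) \<le> part \<kappa> i"
    proof (rule ccontr)
      assume "\<not> part \<nu> (Suc i) \<le> part \<kappa> i"
      then have l: "part \<kappa> i < part \<nu> (Suc i)" by simp
      let ?j = "Suc (part \<kappa> i)"
      have 1: "(Suc (Suc i), ?j) \<in> diagram \<nu>" using l by simp
      have 2: "(Suc i, ?j) \<in> diagram \<nu>" using l part_antimono[of i "Suc i" \<nu>] by simp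
      have "T (Suc i, ?j) < T (Suc (Suc i), ?j)" using ssyt_col[OF sT 2 1] by simp
      then have "T (Suc i, ?j) < n" using lt[OF 1] by simp
      then have "(Suc i, ?j) \<in> diagram \<kappa>" using 2 k by (simp add: subshape_def)
      then show False by simp
    qed
  qed
  have full: "subshape \<nu> T (Suc n) = diagram \<nu>" using lt by (auto simp: subshape_def)
  have "card (diagram \<kappa>) \<le> card (diagram \<nu>)" using sub by (intro card_mono) auto
  then show "psize \<nu> = psize \<kappa> + c n" using c[of n] full by (simp add: psize_def k)
  have "restrict T (diagram \<kappa>) \<in> ssyt \<kappa>"
    using sT sub unfolding ssyt_def by (auto simp: subset_iff)
  moreover have "\<forall>s\<in>diagram \<kappa>. restrict T (diagram \<kappa>) s < n" using k by (simp add: subshape_def)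
  ultimately show "restrict T (diagram \<kappa>) \<in> tabs n \<kappa> c"
    using c by (simp add: tabs_def subshape_restrict[OF k])
qed

lemma tab_of_hstrip:
  assumes hs: "hstrip \<kappa> \<nu>" and sz: "psize \<nu> = psize \<kappa> + c n" and T: "T \<in> tabs n \<kappa> c"
  shows "extend_tab \<nu> \<kappa> n T \<in> tabs (Suc n) \<nu> c" "subshape \<nu> (extend_tab \<nu> \<kappa> n T) n = diagram \<kappa>"
    "restrict (extend_tab \<nu> \<kappa> n T) (diagram \<kappa>) = T"
proof -
  let ?E = "extend_tab \<nu> \<kappa> n T"
  have sT: "T \<in> ssyt \<kappa>" and lt: "\<forall>s\<in>diagram \<kappa>. T s < n"
    and c: "\<And>i. i < n \<Longrightarrow> c i = card (subshape \<kappa> T (Suc i)) - card (subshape \<kappa> T i)"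
    using T by (auto simp: tabs_def)
  have sub: "diagram \<kappa> \<subseteq> diagram \<nu>" using hs by (simp add: diagram_subset_iff hstrip_def)
  have "T \<in> extensional (diagram \<kappa>)" using sT by (simp add: ssyt_def)
  then show "restrict ?E (diagram \<kappa>) = T" by (auto simp: extend_tab_def fun_eq_iff extensional_def)
  show sn: "subshape \<nu> ?E n = diagram \<kappa>"
    using sub lt by (auto simp: subshape_def extend_tab_def)
  have le: "?E s \<le> n" if "s \<in> diagram \<nu>" for s
    using that lt by (auto simp: extend_tab_def less_imp_le)
  have "?E \<in> ssyt \<nu>"
    unfolding ssyt_def
  proof (intro CollectI conjI allI impI; (elim conjE)?)
    show "?E \<in> extensional (diagram \<nu>)" using sub by (auto simp: extend_tab_def extensional_def)
  next
    fix i j j' assume a: "(i, j) \<in> diagram \<nu>" "(i, j') \<in> diagram \<nu>" "j < j'"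
    show "?E (i, j) \<le> ?E (i, j')"
    proof (cases "(i, j') \<in> diagram \<kappa>")
      case True
      then have "(i, j) \<in> diagram \<kappa>" using diagram_down[OF True, of i j] a by (auto simp: diagram_def)
      then show ?thesis using ssyt_row[OF sT _ True, of j] True a by (simp add: extend_tab_def)
    next
      case False
      then show ?thesis using a le[OF a(1)] by (simp add: extend_tab_def)
    qed
  next
    fix i i' j assume a: "(i, j) \<in> diagram \<nu>" "(i', j) \<in> diagram \<nu>" "i < i'"
    obtain r s where rs: "i = Suc r" "j = Suc s" using a(1) by (auto elim: diagramE)
    obtain r' where r': "i' = Suc r'" "r < r'" using a(3) rs by (cases i') auto
    have "s < part \<nu> r'" using a(2) rs r' by simp
    also have "\<dots> \<le> part \<nu> (Suc r)" using r' by (intro part_antimono) simp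
    also have "\<dots> \<le> part \<kappa> r" using hs by (rule hstripD(2))
    finally have ik: "(i, j) \<in> diagram \<kappa>" using rs by simp
    show "?E (i, j) < ?E (i', j)"
    proof (cases "(i', j) \<in> diagram \<kappa>")
      case True
      then show ?thesis using ssyt_col[OF sT ik True] a ik by (simp add: extend_tab_def)
    next
      case False
      then show ?thesis using a lt ik by (simp add: extend_tab_def)
    qed
  qed
  moreover have "\<forall>s\<in>diagram \<nu>. ?E s < Suc n" using le by (simp add: less_Suc_eq_le)
  moreover have "c i = card (subshape \<nu> ?E (Suc i)) - card (subshape \<nu> ?E i)" if "i < Suc n" for i
  proof (cases "i = n")
    case True
    have "subshape \<nu> ?E (Suc n) = diagram \<nu>" using le by (auto simp: subshape_def less_Suc_eq_le)
    then show ?thesis using sn sz True by (simp add: psize_def)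
  next
    case False
    then show ?thesis using that c[of i] subshape_extend[OF sub lt] by simp
  qed
  ultimately show "?E \<in> tabs (Suc n) \<nu> c" by (simp add: tabs_def)
qed

lemma extend_restrict:
  assumes T: "T \<in> tabs (Suc n) \<nu> c" and k: "diagram \<kappa> = subshape \<nu> T n"
  shows "extend_tab \<nu> \<kappa> n (restrict T (diagram \<kappa>)) = T"
proof
  fix s
  have "T \<in> extensional (diagram \<nu>)" using T by (simp add: tabs_def ssyt_def)
  then have "T s = undefined" if "s \<notin> diagram \<nu>" using that by (rule extensional_arb)
  moreover have "T s < Suc n" if "s \<in> diagram \<nu>" using T that by (simp add: tabs_def)
  ultimately show "extend_tab \<nu> \<kappa> n (restrict T (diagram \<kappa>)) s = T s"
    unfolding extend_tab_def k by (auto simp: subshape_def)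
qed

context macdonald
begin

text \<open>
  The sum of $\phi(T)$ over tableaux with content $c$, organised by the largest entry: the boxes
  that carry it form a horizontal strip.
\<close>

primrec tabsum :: "nat \<Rightarrow> int_partition \<Rightarrow> (nat \<Rightarrow> nat) \<Rightarrow> real" where
  "tabsum 0 \<nu> c = (if \<nu> = empty_partition then 1 else 0)"
| "tabsum (Suc n) \<nu> c = (\<Sum>\<kappa> | hstrip \<kappa> \<nu> \<and> psize \<nu> = psize \<kappa> + c n. phi \<nu> \<kappa> * tabsum n \<kappa> c)"

lemma sum_tabs: "(\<Sum>T\<in>tabs n \<nu> c. \<Prod>i<n. mac_phi q t (subshape \<nu> T (Suc i)) (subshape \<nu> T i)) = tabsum n \<nu> c"
proof (induction n arbitrary: \<nu>)
  case 0
  show ?case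
  proof (cases "\<nu> = empty_partition")
    case True
    have "tabs 0 \<nu> c = {\<lambda>_. undefined}" using True by (auto simp: tabs_def ssyt_def)
    then show ?thesis using True by simp
  next
    case False
    then have "diagram \<nu> \<noteq> {}" by (metis diagram_empty diagram_inject)
    then have "tabs 0 \<nu> c = {}" by (auto simp: tabs_def)
    then show ?thesis using False by simp
  qed
next
  case (Suc n)
  let ?K = "{\<kappa>. hstrip \<kappa> \<nu> \<and> psize \<nu> = psize \<kappa> + c n}"
  let ?w = "\<lambda>n \<nu> T. \<Prod>i<n. mac_phi q t (subshape \<nu> T (Suc i)) (subshape \<nu> T i)"
  let ?k = "\<lambda>T. part_of_diagram (subshape \<nu> T n)"
  have kd: "diagram (?k T) = subshape \<nu> T n" if "T \<in> tabs (Suc n) \<nu> c" for T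
    using that by (intro subshape_is_diagram) (simp add: tabs_def)
  have "(\<Sum>T\<in>tabs (Suc n) \<nu> c. ?w (Suc n) \<nu> T) = (\<Sum>(\<kappa>, T)\<in>Sigma ?K (\<lambda>\<kappa>. tabs n \<kappa> c). phi \<nu> \<kappa> * ?w n \<kappa> T)"
  proof (rule sum.reindex_bij_witness[where i = "\<lambda>(\<kappa>, T). extend_tab \<nu> \<kappa> n T"
        and j = "\<lambda>T. (?k T, restrict T (diagram (?k T)))"])
    fix T assume T: "T \<in> tabs (Suc n) \<nu> c"
    note k = kd[OF T]
    show "(case (?k T, restrict T (diagram (?k T))) of (\<kappa>, T) \<Rightarrow> extend_tab \<nu> \<kappa> n T) = T"
      using extend_restrict[OF T k] by simp
    show "(?k T, restrict T (diagram (?k T))) \<in> Sigma ?K (\<lambda>\<kappa>. tabs n \<kappa> c)"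
      using hstrip_of_tab[OF T k] by simp
    have full: "subshape \<nu> T (Suc n) = diagram \<nu>" using T by (auto simp: tabs_def subshape_def)
    have "?w n (?k T) (restrict T (diagram (?k T))) = ?w n \<nu> T"
      by (intro prod.cong refl) (simp only: lessThan_iff subshape_restrict[OF k] Suc_leI less_imp_le)
    then show "(case (?k T, restrict T (diagram (?k T))) of (\<kappa>, T) \<Rightarrow> phi \<nu> \<kappa> * ?w n \<kappa> T) = ?w (Suc n) \<nu> T"
      by (simp add: full k)
  next
    fix p assume "p \<in> Sigma ?K (\<lambda>\<kappa>. tabs n \<kappa> c)"
    then obtain \<kappa> T where p: "p = (\<kappa>, T)" "hstrip \<kappa> \<nu>" "psize \<nu> = psize \<kappa> + c n" "T \<in> tabs n \<kappa> c" by auto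
    note th = tab_of_hstrip[OF p(2-4)]
    have pk: "?k (extend_tab \<nu> \<kappa> n T) = \<kappa>" unfolding th(2) by simp
    show "(?k (case p of (\<kappa>, T) \<Rightarrow> extend_tab \<nu> \<kappa> n T),
        restrict (case p of (\<kappa>, T) \<Rightarrow> extend_tab \<nu> \<kappa> n T) (diagram (?k (case p of (\<kappa>, T) \<Rightarrow> extend_tab \<nu> \<kappa> n T)))) = p"
      unfolding p(1) prod.case pk th(3) ..
    show "(case p of (\<kappa>, T) \<Rightarrow> extend_tab \<nu> \<kappa> n T) \<in> tabs (Suc n) \<nu> c" using th(1) p(1) by simp
  qed
  also have "\<dots> = (\<Sum>\<kappa>\<in>?K. phi \<nu> \<kappa> * (\<Sum>T\<in>tabs n \<kappa> c. ?w n \<kappa> T))"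
    unfolding sum_distrib_left by (rule sum.Sigma[symmetric]) (auto simp: finite_tabs finite_hstrip)
  finally show ?case by (simp only: Suc.IH tabsum.simps)
qed

lemma mac_phi_self: "mac_phi q t D D = 1"
  by (simp add: mac_phi_def skew_cols_def)

text \<open>
  All tableaux with the content of a monomial in the first $n$ variables have entries below $n$, and
  the entries that do not occur contribute the factor 1.
\<close>

lemma mcoeff_mac_Q:
  assumes M: "set_mset M \<subseteq> {..<n}"
  shows "mcoeff (mac_Q q t \<nu>) M = tabsum n \<nu> (count M)"
proof -
  have ss: "subshape \<nu> T (Suc i) = subshape \<nu> T i \<union> {s \<in> diagram \<nu>. T s = i}" for T i
    by (auto simp: subshape_def)
  have tabs_eq: "{T \<in> ssyt \<nu>. \<forall>i. count M i = card (subshape \<nu> T (Suc i)) - card (subshape \<nu> T i)} =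
      tabs n \<nu> (count M)"
  proof (intro equalityI subsetI)
    fix T assume "T \<in> {T \<in> ssyt \<nu>. \<forall>i. count M i = card (subshape \<nu> T (Suc i)) - card (subshape \<nu> T i)}"
    then have T: "T \<in> ssyt \<nu>" "\<And>i. count M i = card (subshape \<nu> T (Suc i)) - card (subshape \<nu> T i)" by auto
    have "T s < n" if s: "s \<in> diagram \<nu>" for s
    proof -
      have "subshape \<nu> T (T s) \<subset> subshape \<nu> T (Suc (T s))" using s by (auto simp: subshape_def)
      then have "card (subshape \<nu> T (T s)) < card (subshape \<nu> T (Suc (T s)))"
        by (intro psubset_card_mono) (auto simp: subshape_def)
      then have "T s \<in># M" using T(2)[of "T s"] by (metis count_eq_zero_iff less_nat_zero_code zero_less_diff)
      then show ?thesis using M by auto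
    qed
    then show "T \<in> tabs n \<nu> (count M)" using T by (auto simp: tabs_def)
  next
    fix T assume T: "T \<in> tabs n \<nu> (count M)"
    have "count M i = card (subshape \<nu> T (Suc i)) - card (subshape \<nu> T i)" for i
    proof (cases "i < n")
      case True
      then show ?thesis using T by (simp add: tabs_def)
    next
      case False
      have "subshape \<nu> T (Suc i) = subshape \<nu> T i" using T False by (force simp: tabs_def subshape_def)
      moreover have "count M i = 0" using M False by (metis count_eq_zero_iff lessThan_iff subsetD)
      ultimately show ?thesis by simp
    qed
    then show "T \<in> {T \<in> ssyt \<nu>. \<forall>i. count M i = card (subshape \<nu> T (Suc i)) - card (subshape \<nu> T i)}"
      using T by (simp add: tabs_def)
  qed
  have "mac_phi_tableau q t \<nu> T = (\<Prod>i<n. mac_phi q t (subshape \<nu> T (Suc i)) (subshape \<nu> T i))"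
    if T: "T \<in> tabs n \<nu> (count M)" for T
    unfolding mac_phi_tableau_def
  proof (rule prod.mono_neutral_left)
    show "T ` diagram \<nu> \<subseteq> {..<n}" using T by (auto simp: tabs_def)
    show "\<forall>i\<in>{..<n} - T ` diagram \<nu>. mac_phi q t (subshape \<nu> T (Suc i)) (subshape \<nu> T i) = 1"
    proof
      fix i assume "i \<in> {..<n} - T ` diagram \<nu>"
      then have "subshape \<nu> T (Suc i) = subshape \<nu> T i" unfolding ss by auto
      then show "mac_phi q t (subshape \<nu> T (Suc i)) (subshape \<nu> T i) = 1" by (simp add: mac_phi_self)
    qed
  qed simp
  then show ?thesis unfolding mac_Q_def mcoeff_Abs tabs_eq sum_tabs[symmetric] by simp
qed

section \<open>The Pieri rule for elementary symmetric functions\<close>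

lemma tabsum_cong: "(\<And>i. i < n \<Longrightarrow> c i = c' i) \<Longrightarrow> tabsum n \<nu> c = tabsum n \<nu> c'"
  by (induction n arbitrary: \<nu>) auto

lemma phi_eq: "hstrip \<kappa> \<nu> \<Longrightarrow> phi \<nu> \<kappa> = psi \<nu> \<kappa> * bb \<nu> / bb \<kappa>"
  by (rule mac_phi_eq_psi) (simp add: diagram_subset_iff hstrip_def)

text \<open>
  In the $Q$ normalisation all terms of the commutation identity are multiplied by the same
  factor.
\<close>

lemma strip_commutation_Q:
  "(\<Sum>nu | vstrip mu nu \<and> hstrip la nu \<and> psize nu = psize mu + k. pieri nu mu * phi nu la) =
   (\<Sum>ka | hstrip ka mu \<and> vstrip ka la \<and> psize la = psize ka + k. pieri la ka * phi mu ka) +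
   (\<Sum>ka | hstrip ka mu \<and> vstrip ka la \<and> Suc (psize la) = psize ka + k. pieri la ka * phi mu ka)"
proof -
  have nz: "bb \<nu> \<noteq> 0" for \<nu> using bb_pos[of \<nu>] by simp
  have L: "pieri nu mu * phi nu la = bb mu / bb la * (vpsi nu mu * psi nu la)"
    if "hstrip la nu" for nu
    using that nz[of nu] by (simp add: phi_eq pieri_def)
  have R: "pieri la ka * phi mu ka = bb mu / bb la * (vpsi la ka * psi mu ka)"
    if "hstrip ka mu" for ka
    using that nz[of ka] by (simp add: phi_eq pieri_def)
  have "(\<Sum>nu | vstrip mu nu \<and> hstrip la nu \<and> psize nu = psize mu + k. pieri nu mu * phi nu la) =
      bb mu / bb la * (\<Sum>nu | vstrip mu nu \<and> hstrip la nu \<and> psize nu = psize mu + k.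
        vpsi nu mu * psi nu la)"
    unfolding sum_distrib_left by (rule sum.cong) (auto simp: L)
  also note strip_commutation
  also have "bb mu / bb la * ((\<Sum>ka | hstrip ka mu \<and> vstrip ka la \<and> psize la = psize ka + k.
        vpsi la ka * psi mu ka) +
      (\<Sum>ka | hstrip ka mu \<and> vstrip ka la \<and> Suc (psize la) = psize ka + k.
        vpsi la ka * psi mu ka)) =
    (\<Sum>ka | hstrip ka mu \<and> vstrip ka la \<and> psize la = psize ka + k. pieri la ka * phi mu ka) +
    (\<Sum>ka | hstrip ka mu \<and> vstrip ka la \<and> Suc (psize la) = psize ka + k. pieri la ka * phi mu ka)"
    unfolding distrib_left sum_distrib_left
    by (intro arg_cong2[where f = "(+)"] sum.cong) (auto simp: R)
  finally show ?thesis .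
qed

lemma pieri_self [simp]: "pieri \<nu> \<nu> = 1"
  using bb_pos[of \<nu>] by (simp add: pieri_def vpsi_def)

text \<open>
  This is the coefficient form of the Pieri rule: the left-hand side is a coefficient of $e_k Q_\mu$,
  where $C$ is the set of variables used by $e_k$. In the induction on the number of variables,
  the horizontal strip of the last variable is moved past the vertical strip; the two terms of the
  commutation identity are the cases that the last variable is not, or is, in $C$.
\<close>

lemma tabsum_Pieri:
  "(\<Sum>C | C \<subseteq> {i. i < n \<and> 0 < c i} \<and> card C = k. tabsum n \<mu> (\<lambda>i. c i - (if i \<in> C then 1 else 0))) =
   (\<Sum>\<nu> | vstrip \<mu> \<nu> \<and> psize \<nu> = psize \<mu> + k. pieri \<nu> \<mu> * tabsum n \<nu> c)"
proof (induction n arbitrary: \<mu> k)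
  case 0
  have e: "vstrip \<mu> empty_partition \<longleftrightarrow> \<mu> = empty_partition"
    by (auto simp: vstrip_def intro: part_eqI)
  show ?case
  proof (cases "k = 0 \<and> \<mu> = empty_partition")
    case True
    have "{C. C \<subseteq> {i. i < 0 \<and> 0 < c i} \<and> card C = k} = {{}}" using True by auto
    moreover have "{\<nu>. vstrip \<mu> \<nu> \<and> psize \<nu> = psize \<mu> + k} = {empty_partition}"
      using True by (auto simp: psize_0_iff vstrip_def)
    ultimately show ?thesis using True by simp
  next
    case False
    have "(\<Sum>C | C \<subseteq> {i. i < 0 \<and> 0 < c i} \<and> card C = k. tabsum 0 \<mu> (\<lambda>i. c i - (if i \<in> C then 1 else 0))) = 0"
      by (rule sum.neutral) (use False in auto)
    moreover have "(\<Sum>\<nu> | vstrip \<mu> \<nu> \<and> psize \<nu> = psize \<mu> + k. pieri \<nu> \<mu> * tabsum 0 \<nu> c) = 0"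
      by (rule sum.neutral) (use False e in auto)
    ultimately show ?thesis by simp
  qed
next
  case (Suc n)
  define Z where "Z = {i. i < n \<and> 0 < c i}"
  define sub where "sub C = (\<lambda>i. c i - (if i \<in> C then 1 else 0))" for C
  define W where "W j k' = (\<Sum>\<kappa> | hstrip \<kappa> \<mu> \<and> psize \<mu> = psize \<kappa> + j.
      phi \<mu> \<kappa> * (\<Sum>C | C \<subseteq> Z \<and> card C = k'. tabsum n \<kappa> (sub C)))" for j k'
  have finZ: "finite Z" by (simp add: Z_def)
  have IH: "(\<Sum>C | C \<subseteq> Z \<and> card C = k. tabsum n \<mu> (sub C)) =
    (\<Sum>\<nu> | vstrip \<mu> \<nu> \<and> psize \<nu> = psize \<mu> + k. pieri \<nu> \<mu> * tabsum n \<nu> c)" for k \<mu>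
    using Suc.IH[of \<mu> k] by (simp only: Z_def sub_def)
  let ?A = "{\<nu>. vstrip \<mu> \<nu> \<and> psize \<nu> = psize \<mu> + k}"
  \<comment> \<open>move the horizontal strip of the last variable past the vertical strip; each of the two terms of the commutation identity becomes a \<open>W\<close>\<close>
  let ?B = "{\<rho>. psize \<rho> + c n = psize \<mu> + k}"
  have finA: "finite ?A" by (rule finite_subset[OF _ finite_psize_eq[of "psize \<mu> + k"]]) auto
  have finB: "finite ?B" by (rule finite_subset[OF _ finite_psize[of "psize \<mu> + k"]]) auto
  have "(\<Sum>\<nu>\<in>?A. pieri \<nu> \<mu> * tabsum (Suc n) \<nu> c) =
      (\<Sum>\<nu>\<in>?A. \<Sum>\<rho> | \<rho> \<in> ?B \<and> hstrip \<rho> \<nu>. pieri \<nu> \<mu> * phi \<nu> \<rho> * tabsum n \<rho> c)"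
  proof (rule sum.cong[OF refl])
    fix \<nu> assume "\<nu> \<in> ?A"
    then have "{\<kappa>. hstrip \<kappa> \<nu> \<and> psize \<nu> = psize \<kappa> + c n} = {\<rho>. \<rho> \<in> ?B \<and> hstrip \<rho> \<nu>}" by auto
    then show "pieri \<nu> \<mu> * tabsum (Suc n) \<nu> c = (\<Sum>\<rho> | \<rho> \<in> ?B \<and> hstrip \<rho> \<nu>. pieri \<nu> \<mu> * phi \<nu> \<rho> * tabsum n \<rho> c)"
      by (simp only: tabsum.simps sum_distrib_left mult.assoc)
  qed
  also have "\<dots> = (\<Sum>\<rho>\<in>?B. \<Sum>\<nu> | \<nu> \<in> ?A \<and> hstrip \<rho> \<nu>. pieri \<nu> \<mu> * phi \<nu> \<rho> * tabsum n \<rho> c)"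
    by (rule sum.swap_restrict[OF finA finB])
  also have "\<dots> = (\<Sum>\<rho>\<in>?B. (\<Sum>\<nu> | vstrip \<mu> \<nu> \<and> hstrip \<rho> \<nu> \<and> psize \<nu> = psize \<mu> + k. pieri \<nu> \<mu> * phi \<nu> \<rho>) * tabsum n \<rho> c)"
    unfolding sum_distrib_right by (intro sum.cong refl) auto
  also have "\<dots> = (\<Sum>\<rho>\<in>?B. \<Sum>\<kappa> | hstrip \<kappa> \<mu> \<and> vstrip \<kappa> \<rho> \<and> psize \<rho> = psize \<kappa> + k. pieri \<rho> \<kappa> * phi \<mu> \<kappa> * tabsum n \<rho> c)
    + (\<Sum>\<rho>\<in>?B. \<Sum>\<kappa> | hstrip \<kappa> \<mu> \<and> vstrip \<kappa> \<rho> \<and> Suc (psize \<rho>) = psize \<kappa> + k. pieri \<rho> \<kappa> * phi \<mu> \<kappa> * tabsum n \<rho> c)"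
    unfolding strip_commutation_Q distrib_right sum.distrib sum_distrib_right ..
  also have "(\<Sum>\<rho>\<in>?B. \<Sum>\<kappa> | hstrip \<kappa> \<mu> \<and> vstrip \<kappa> \<rho> \<and> psize \<rho> = psize \<kappa> + k. pieri \<rho> \<kappa> * phi \<mu> \<kappa> * tabsum n \<rho> c) = W (c n) k"
  proof -
    let ?K = "{\<kappa>. hstrip \<kappa> \<mu> \<and> psize \<mu> = psize \<kappa> + c n}"
    have "(\<Sum>\<rho>\<in>?B. \<Sum>\<kappa> | hstrip \<kappa> \<mu> \<and> vstrip \<kappa> \<rho> \<and> psize \<rho> = psize \<kappa> + k. pieri \<rho> \<kappa> * phi \<mu> \<kappa> * tabsum n \<rho> c) =
       (\<Sum>\<rho>\<in>?B. \<Sum>\<kappa> | \<kappa> \<in> ?K \<and> (vstrip \<kappa> \<rho> \<and> psize \<rho> = psize \<kappa> + k). pieri \<rho> \<kappa> * phi \<mu> \<kappa> * tabsum n \<rho> c)"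
      by (intro sum.cong refl) auto
    also have "\<dots> = (\<Sum>\<kappa>\<in>?K. \<Sum>\<rho> | \<rho> \<in> ?B \<and> (vstrip \<kappa> \<rho> \<and> psize \<rho> = psize \<kappa> + k). pieri \<rho> \<kappa> * phi \<mu> \<kappa> * tabsum n \<rho> c)"
      by (rule sum.swap_restrict[OF finB finite_hstrip])
    also have "\<dots> = W (c n) k"
      unfolding W_def IH sum_distrib_left by (intro sum.cong) (auto simp: mult_ac)
    finally show ?thesis .
  qed
  also have "(\<Sum>\<rho>\<in>?B. \<Sum>\<kappa> | hstrip \<kappa> \<mu> \<and> vstrip \<kappa> \<rho> \<and> Suc (psize \<rho>) = psize \<kappa> + k. pieri \<rho> \<kappa> * phi \<mu> \<kappa> * tabsum n \<rho> c) =
      (if 0 < c n \<and> 0 < k then W (c n - 1) (k - 1) else 0)"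
  proof (cases "0 < c n \<and> 0 < k")
    case True
    let ?K = "{\<kappa>. hstrip \<kappa> \<mu> \<and> psize \<mu> = psize \<kappa> + (c n - 1)}"
    have "(\<Sum>\<rho>\<in>?B. \<Sum>\<kappa> | hstrip \<kappa> \<mu> \<and> vstrip \<kappa> \<rho> \<and> Suc (psize \<rho>) = psize \<kappa> + k. pieri \<rho> \<kappa> * phi \<mu> \<kappa> * tabsum n \<rho> c) =
       (\<Sum>\<rho>\<in>?B. \<Sum>\<kappa> | \<kappa> \<in> ?K \<and> (vstrip \<kappa> \<rho> \<and> psize \<rho> = psize \<kappa> + (k - 1)). pieri \<rho> \<kappa> * phi \<mu> \<kappa> * tabsum n \<rho> c)"
      using True by (intro sum.cong refl) auto
    also have "\<dots> = (\<Sum>\<kappa>\<in>?K. \<Sum>\<rho> | \<rho> \<in> ?B \<and> (vstrip \<kappa> \<rho> \<and> psize \<rho> = psize \<kappa> + (k - 1)). pieri \<rho> \<kappa> * phi \<mu> \<kappa> * tabsum n \<rho> c)"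
      by (rule sum.swap_restrict[OF finB finite_hstrip])
    also have "\<dots> = W (c n - 1) (k - 1)"
      unfolding W_def IH sum_distrib_left using True by (intro sum.cong) (auto simp: mult_ac)
    finally show ?thesis using True by simp
  next
    case False
    have "{\<kappa>. hstrip \<kappa> \<mu> \<and> vstrip \<kappa> \<rho> \<and> Suc (psize \<rho>) = psize \<kappa> + k} = {}" if "\<rho> \<in> ?B" for \<rho>
    proof -
      have "psize \<kappa> \<le> psize \<mu>" if "hstrip \<kappa> \<mu>" for \<kappa> using that by (intro psize_mono) (simp add: hstrip_def)
      moreover have "psize \<kappa> \<le> psize \<rho>" if "vstrip \<kappa> \<rho>" for \<kappa> using that by (intro psize_mono) (simp add: vstrip_def)
      ultimately show ?thesis using False that by fastforce
    qed
    then have "(\<Sum>\<rho>\<in>?B. \<Sum>\<kappa> | hstrip \<kappa> \<mu> \<and> vstrip \<kappa> \<rho> \<and> Suc (psize \<rho>) = psize \<kappa> + k. pieri \<rho> \<kappa> * phi \<mu> \<kappa> * tabsum n \<rho> c) = 0"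
      by (rule_tac sum.neutral, rule_tac ballI) (simp only: sum.empty)
    then show ?thesis using False by auto
  qed
  finally have rhs: "(\<Sum>\<nu>\<in>?A. pieri \<nu> \<mu> * tabsum (Suc n) \<nu> c) =
      W (c n) k + (if 0 < c n \<and> 0 < k then W (c n - 1) (k - 1) else 0)" .
  \<comment> \<open>the two terms are the subsets without and with the last variable\<close>
  let ?Z' = "{i. i < Suc n \<and> 0 < c i}"
  have Z': "?Z' = (if 0 < c n then insert n Z else Z)" by (auto simp: Z_def less_Suc_eq)
  have finZ': "finite {C. C \<subseteq> ?Z' \<and> P C}" for P by (rule finite_subset[of _ "Pow ?Z'"]) auto
  have W_alt: "(\<Sum>C | C \<subseteq> Z \<and> card C = k'. \<Sum>\<kappa> | hstrip \<kappa> \<mu> \<and> psize \<mu> = psize \<kappa> + j. phi \<mu> \<kappa> * tabsum n \<kappa> (sub C)) = W j k'" for j k'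
    unfolding W_def sum_distrib_left by (rule sum.swap)
  have nZ: "n \<notin> C" if "C \<subseteq> Z" for C using that by (auto simp: Z_def)
  have "(\<Sum>C | C \<subseteq> ?Z' \<and> card C = k. tabsum (Suc n) \<mu> (sub C)) =
      (\<Sum>C | (C \<subseteq> ?Z' \<and> card C = k) \<and> n \<notin> C. tabsum (Suc n) \<mu> (sub C)) +
      (\<Sum>C | (C \<subseteq> ?Z' \<and> card C = k) \<and> n \<in> C. tabsum (Suc n) \<mu> (sub C))"
    by (subst sum.union_disjoint[symmetric]) (auto intro!: sum.cong finite_subset[OF _ finZ'[of "\<lambda>_. True"]])
  also have "(\<Sum>C | (C \<subseteq> ?Z' \<and> card C = k) \<and> n \<notin> C. tabsum (Suc n) \<mu> (sub C)) = W (c n) k"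
  proof -
    have "{C. (C \<subseteq> ?Z' \<and> card C = k) \<and> n \<notin> C} = {C. C \<subseteq> Z \<and> card C = k}"
      using nZ unfolding Z' by auto
    moreover have "tabsum (Suc n) \<mu> (sub C) = (\<Sum>\<kappa> | hstrip \<kappa> \<mu> \<and> psize \<mu> = psize \<kappa> + c n. phi \<mu> \<kappa> * tabsum n \<kappa> (sub C))"
      if "C \<subseteq> Z" for C using nZ[OF that] by (simp add: sub_def)
    ultimately have "(\<Sum>C | (C \<subseteq> ?Z' \<and> card C = k) \<and> n \<notin> C. tabsum (Suc n) \<mu> (sub C)) =
        (\<Sum>C | C \<subseteq> Z \<and> card C = k. \<Sum>\<kappa> | hstrip \<kappa> \<mu> \<and> psize \<mu> = psize \<kappa> + c n. phi \<mu> \<kappa> * tabsum n \<kappa> (sub C))"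
      by (intro sum.cong) auto
    then show ?thesis by (simp only: W_alt)
  qed
  also have "(\<Sum>C | (C \<subseteq> ?Z' \<and> card C = k) \<and> n \<in> C. tabsum (Suc n) \<mu> (sub C)) =
      (if 0 < c n \<and> 0 < k then W (c n - 1) (k - 1) else 0)"
  proof (cases "0 < c n \<and> 0 < k")
    case True
    have "(\<Sum>C | (C \<subseteq> ?Z' \<and> card C = k) \<and> n \<in> C. tabsum (Suc n) \<mu> (sub C)) =
        (\<Sum>C | C \<subseteq> Z \<and> card C = k - 1. \<Sum>\<kappa> | hstrip \<kappa> \<mu> \<and> psize \<mu> = psize \<kappa> + (c n - 1). phi \<mu> \<kappa> * tabsum n \<kappa> (sub C))"
    proof (rule sum.reindex_bij_witness[where i = "insert n" and j = "\<lambda>C. C - {n}"])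
      fix C assume C: "C \<in> {C. (C \<subseteq> ?Z' \<and> card C = k) \<and> n \<in> C}"
      then show "insert n (C - {n}) = C" by auto
      have "finite C" using C by (intro finite_subset[of C ?Z']) auto
      then show "C - {n} \<in> {C. C \<subseteq> Z \<and> card C = k - 1}"
        using C by (auto simp: Z_def less_Suc_eq)
      have "tabsum n \<kappa> (sub (C - {n})) = tabsum n \<kappa> (sub C)" for \<kappa>
        by (rule tabsum_cong) (simp add: sub_def)
      moreover have "sub C n = c n - 1" using C by (simp add: sub_def)
      ultimately show "(\<Sum>\<kappa> | hstrip \<kappa> \<mu> \<and> psize \<mu> = psize \<kappa> + (c n - 1). phi \<mu> \<kappa> * tabsum n \<kappa> (sub (C - {n}))) = tabsum (Suc n) \<mu> (sub C)"
        by simp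
    next
      fix C assume C: "C \<in> {C. C \<subseteq> Z \<and> card C = k - 1}"
      then have n: "n \<notin> C" "finite C" using nZ finZ finite_subset by auto
      then show "insert n C - {n} = C" by simp
      show "insert n C \<in> {C. (C \<subseteq> ?Z' \<and> card C = k) \<and> n \<in> C}"
        using C n True unfolding Z' by auto
    qed
    then show ?thesis unfolding W_alt using True by (simp only: if_True simp_thms)
  next
    case False
    have "{C. (C \<subseteq> ?Z' \<and> card C = k) \<and> n \<in> C} = {}"
    proof -
      have "finite C" if "C \<subseteq> ?Z'" for C using that by (rule finite_subset) simp
      then show ?thesis using False by (auto simp: card_eq_0_iff)
    qed
    then show ?thesis using False by (simp only: sum.empty if_False)
  qed
  finally show ?case using rhs by (simp only: sub_def)
qed

end

section \<open>The algebra of symmetric functions\<close>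

lemma mcoeff_zero [simp]: "mcoeff 0 M = 0" by (simp add: zero_mpowser_def)
lemma mcoeff_one: "mcoeff 1 M = (if M = {#} then 1 else 0)" by (simp add: one_mpowser_def)
lemma mcoeff_add [simp]: "mcoeff (F + G) M = mcoeff F M + mcoeff G M" by (simp add: plus_mpowser_def)
lemma mcoeff_diff [simp]: "mcoeff (F - G) M = mcoeff F M - mcoeff G M" by (simp add: minus_mpowser_def)
lemma mcoeff_scaleR [simp]: "mcoeff (c *\<^sub>R F) M = c * mcoeff F M" by (simp add: scaleR_mpowser_def)
lemma mcoeff_mult: "mcoeff (F * G) M = (\<Sum>(A, B) \<in> {(A, B). A + B = M}. mcoeff F A * mcoeff G B)"
  by (simp add: times_mpowser_def)

lemma mcoeff_sum: "mcoeff (\<Sum>x\<in>S. f x) M = (\<Sum>x\<in>S. mcoeff (f x) M)"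
  by (induction S rule: infinite_finite_induct) auto

lemma LambdaI:
  assumes "\<And>p M. bij p \<Longrightarrow> mcoeff F (image_mset p M) = mcoeff F M"
    and "\<And>M. mcoeff F M \<noteq> 0 \<Longrightarrow> size M \<le> d"
  shows "F \<in> Lambda"
  using assms unfolding Lambda_def by blast

lemma Lambda_sym: "F \<in> Lambda \<Longrightarrow> bij p \<Longrightarrow> mcoeff F (image_mset p M) = mcoeff F M"
  by (auto simp: Lambda_def)

lemma Lambda_bounded: "F \<in> Lambda \<Longrightarrow> \<exists>d. \<forall>M. mcoeff F M \<noteq> 0 \<longrightarrow> size M \<le> d"
  by (auto simp: Lambda_def)

lemma Lambda_zero [intro, simp]: "0 \<in> Lambda"
  by (rule LambdaI[of _ 0]) auto

lemma Lambda_one [intro, simp]: "1 \<in> Lambda"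
  by (rule LambdaI[of _ 0]) (auto simp: mcoeff_one split: if_splits)

lemma Lambda_add [intro]: "F \<in> Lambda \<Longrightarrow> G \<in> Lambda \<Longrightarrow> F + G \<in> Lambda"
proof -
  assume FG: "F \<in> Lambda" "G \<in> Lambda"
  obtain d e where de: "\<And>M. mcoeff F M \<noteq> 0 \<Longrightarrow> size M \<le> d" "\<And>M. mcoeff G M \<noteq> 0 \<Longrightarrow> size M \<le> e"
    using Lambda_bounded[OF FG(1)] Lambda_bounded[OF FG(2)] by blast
  show ?thesis
  proof (rule LambdaI)
    fix M assume "mcoeff (F + G) M \<noteq> 0"
    then have "mcoeff F M \<noteq> 0 \<or> mcoeff G M \<noteq> 0" by auto
    then show "size M \<le> max d e" using de[of M] by linarith
  qed (simp add: Lambda_sym FG)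
qed

lemma Lambda_scaleR [intro]: "F \<in> Lambda \<Longrightarrow> c *\<^sub>R F \<in> Lambda"
proof -
  assume F: "F \<in> Lambda"
  obtain d where "\<And>M. mcoeff F M \<noteq> 0 \<Longrightarrow> size M \<le> d" using Lambda_bounded[OF F] by blast
  then show ?thesis by (intro LambdaI[of _ d]) (simp_all add: Lambda_sym F)
qed

lemma Lambda_mult [intro]: "F \<in> Lambda \<Longrightarrow> G \<in> Lambda \<Longrightarrow> F * G \<in> Lambda"
proof -
  assume FG: "F \<in> Lambda" "G \<in> Lambda"
  obtain d e where de: "\<And>M. mcoeff F M \<noteq> 0 \<Longrightarrow> size M \<le> d" "\<And>M. mcoeff G M \<noteq> 0 \<Longrightarrow> size M \<le> e"
    using Lambda_bounded[OF FG(1)] Lambda_bounded[OF FG(2)] by blast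
  show ?thesis
  proof (rule LambdaI)
    fix M assume nz: "mcoeff (F * G) M \<noteq> 0"
    have "\<exists>x\<in>{(A, B). A + B = M}. (case x of (A, B) \<Rightarrow> mcoeff F A * mcoeff G B) \<noteq> 0"
      using nz unfolding mcoeff_mult by (rule contrapos_np) (auto intro!: sum.neutral)
    then obtain A B where "A + B = M" "mcoeff F A \<noteq> 0" "mcoeff G B \<noteq> 0" by auto
    then show "size M \<le> d + e" using de(1)[of A] de(2)[of B] by auto
  next
    fix p :: "nat \<Rightarrow> nat" and M assume p: "bij p"
    then have q: "bij (inv p)" by (rule bij_imp_bij_inv)
    have inv: "image_mset p (image_mset (inv p) A) = A" "image_mset (inv p) (image_mset p A) = A" for A
      using p by (simp_all add: multiset.map_comp comp_def bij_is_surj surj_f_inv_f bij_is_inj)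
    show "mcoeff (F * G) (image_mset p M) = mcoeff (F * G) M"
      unfolding mcoeff_mult
    proof (rule sum.reindex_bij_witness[where i = "\<lambda>(A, B). (image_mset p A, image_mset p B)"
          and j = "\<lambda>(A, B). (image_mset (inv p) A, image_mset (inv p) B)"])
      fix a assume "a \<in> {(A, B). A + B = image_mset p M}"
      then obtain A B where a: "a = (A, B)" "A + B = image_mset p M" by auto
      have "image_mset (inv p) A + image_mset (inv p) B = M"
        unfolding image_mset_union[symmetric] a(2) inv ..
      then show "(case a of (A, B) \<Rightarrow> (image_mset (inv p) A, image_mset (inv p) B)) \<in> {(A, B). A + B = M}"
        by (simp add: a)
      show "(case case a of (A, B) \<Rightarrow> (image_mset (inv p) A, image_mset (inv p) B) of
          (A, B) \<Rightarrow> mcoeff F A * mcoeff G B) = (case a of (A, B) \<Rightarrow> mcoeff F A * mcoeff G B)"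
        by (simp add: a Lambda_sym[OF _ q] FG)
    qed (auto simp: inv)
  qed
qed

lemma Lambda_sum [intro]: "(\<And>x. x \<in> S \<Longrightarrow> f x \<in> Lambda) \<Longrightarrow> (\<Sum>x\<in>S. f x) \<in> Lambda"
  by (induction S rule: infinite_finite_induct) auto

lemma Lambda_diff [intro]: "F \<in> Lambda \<Longrightarrow> G \<in> Lambda \<Longrightarrow> F - G \<in> Lambda"
  using Lambda_add[of F "(-1) *\<^sub>R G"] Lambda_scaleR[of G "-1"] by simp

lemma count_image_mset_inj: "inj f \<Longrightarrow> count (image_mset f M) (f x) = count M x"
  by (induction M) (auto dest: injD)

definition elem :: "nat \<Rightarrow> mpowser" where
  "elem k = Abs_mpowser (\<lambda>M. if size M = k \<and> (\<forall>i. count M i \<le> 1) then 1 else 0)"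

lemma mcoeff_elem: "mcoeff (elem k) M = (if size M = k \<and> (\<forall>i. count M i \<le> 1) then 1 else 0)"
  by (simp add: elem_def)

lemma elem_Lambda [intro, simp]: "elem k \<in> Lambda"
proof (rule LambdaI[of _ k])
  fix p :: "nat \<Rightarrow> nat" and M assume p: "bij p"
  have "(\<forall>i. count (image_mset p M) i \<le> 1) \<longleftrightarrow> (\<forall>i. count M i \<le> 1)"
  proof -
    have "(\<forall>i. count (image_mset p M) i \<le> 1) \<longleftrightarrow> (\<forall>i. count (image_mset p M) (p i) \<le> 1)"
      using p by (metis bij_pointE)
    then show ?thesis using p by (simp add: count_image_mset_inj bij_is_inj)
  qed
  then show "mcoeff (elem k) (image_mset p M) = mcoeff (elem k) M"
    unfolding mcoeff_elem by simp
qed (auto simp: mcoeff_elem split: if_splits)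

lemma elem_1: "elem 1 = h1"
proof (rule mpowser_eqI)
  fix M :: "nat multiset"
  have "count M i \<le> 1" if "size M = 1" for i :: nat and M using count_le_size[of M i] that by simp
  then show "mcoeff (elem 1) M = mcoeff h1 M" by (auto simp: mcoeff_elem h1_def)
qed

lemma mcoeff_elem_mult:
  "mcoeff (elem k * F) M = (\<Sum>C | C \<subseteq> set_mset M \<and> card C = k. mcoeff F (M - mset_set C))"
proof -
  have fC: "finite C" if "C \<subseteq> set_mset M" for C using that by (rule finite_subset) simp
  have sub: "mset_set C \<subseteq># M" if "C \<subseteq> set_mset M" for C
    using that fC[OF that] by (auto simp: subseteq_mset_def count_mset_set')
  have sq: "mset_set (set_mset A) = A" if "\<forall>i. count A i \<le> 1" for A :: "nat multiset"
  proof (rule multiset_eqI)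
    fix i show "count (mset_set (set_mset A)) i = count A i"
      using that[rule_format, of i] by (cases "i \<in># A") (auto simp: not_in_iff intro: antisym)
  qed
  have "mcoeff (elem k * F) M = (\<Sum>x \<in> {(A, B). A + B = M}. mcoeff (elem k) (fst x) * mcoeff F (snd x))"
    by (simp add: mcoeff_mult case_prod_beta)
  also have "\<dots> = (\<Sum>x \<in> {(A, B). A + B = M \<and> size A = k \<and> (\<forall>i. count A i \<le> 1)}. mcoeff F (snd x))"
    by (rule sum.mono_neutral_cong_right) (auto simp: finite_mset_splits mcoeff_elem split: if_splits)
  also have "\<dots> = (\<Sum>C | C \<subseteq> set_mset M \<and> card C = k. mcoeff F (M - mset_set C))"
  proof (rule sum.reindex_bij_witness[where i = "\<lambda>C. (mset_set C, M - mset_set C)" and j = "\<lambda>x. set_mset (fst x)"])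
    fix x assume "x \<in> {(A, B). A + B = M \<and> size A = k \<and> (\<forall>i. count A i \<le> 1)}"
    then obtain A B where x: "x = (A, B)" "A + B = M" "size A = k" "\<forall>i. count A i \<le> 1" by auto
    note sA = sq[OF x(4)]
    have MB: "M - A = B" using x(2) by auto
    show "(mset_set (set_mset (fst x)), M - mset_set (set_mset (fst x))) = x"
      by (simp add: x(1) sA MB)
    show "set_mset (fst x) \<in> {C. C \<subseteq> set_mset M \<and> card C = k}"
      using x sA by (auto simp flip: size_mset_set)
    show "mcoeff F (M - mset_set (set_mset (fst x))) = mcoeff F (snd x)"
      by (simp add: x(1) sA MB)
  next
    fix C assume C: "C \<in> {C. C \<subseteq> set_mset M \<and> card C = k}"
    then show "set_mset (fst (mset_set C, M - mset_set C)) = C" using fC by auto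
    show "(mset_set C, M - mset_set C) \<in> {(A, B). A + B = M \<and> size A = k \<and> (\<forall>i. count A i \<le> 1)}"
      using C sub fC by (auto simp: count_mset_set')
  qed
  finally show ?thesis .
qed

text \<open>
  The polynomials in the $e_k$, generated from 1 by multiplication with one $e_k$ at a
  time so that the Pieri rule fits the induction.
\<close>

inductive_set elem_algebra :: "mpowser set" where
  one: "1 \<in> elem_algebra"
| add: "F \<in> elem_algebra \<Longrightarrow> G \<in> elem_algebra \<Longrightarrow> F + G \<in> elem_algebra"
| scale: "F \<in> elem_algebra \<Longrightarrow> c *\<^sub>R F \<in> elem_algebra"
| mult: "F \<in> elem_algebra \<Longrightarrow> elem k * F \<in> elem_algebra"

lemma elem_algebra_Lambda: "F \<in> elem_algebra \<Longrightarrow> F \<in> Lambda"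
  by (induction rule: elem_algebra.induct) auto

lemma elem_algebra_sum: "(\<And>x. x \<in> S \<Longrightarrow> f x \<in> elem_algebra) \<Longrightarrow> (\<Sum>x\<in>S. f x) \<in> elem_algebra"
proof (induction S rule: infinite_finite_induct)
  have "0 \<in> elem_algebra" using elem_algebra.scale[OF elem_algebra.one, of 0] by simp
  then show "(\<Sum>x\<in>{}. f x) \<in> elem_algebra" "\<And>S. infinite S \<Longrightarrow> (\<Sum>x\<in>S. f x) \<in> elem_algebra" by simp_all
qed (auto intro: elem_algebra.add)

section \<open>Monomials of partitions\<close>

definition mset_of_part :: "int_partition \<Rightarrow> nat multiset" where
  "mset_of_part \<mu> = (\<Sum>i<plen \<mu>. replicate_mset (part \<mu> i) i)"

lemma count_mset_of_part [simp]: "count (mset_of_part \<mu>) = part \<mu>"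
proof
  fix j
  have "count (mset_of_part \<mu>) j = (\<Sum>i<plen \<mu>. if i = j then part \<mu> i else 0)"
    unfolding mset_of_part_def count_sum by (intro sum.cong) auto
  also have "\<dots> = part \<mu> j" by (auto simp: not_less)
  finally show "count (mset_of_part \<mu>) j = part \<mu> j" .
qed

lemma size_mset_of_part: "size (mset_of_part \<mu>) = psize \<mu>"
  by (simp add: mset_of_part_def psize_eq_sum[OF order_refl])

lemma set_mset_of_part: "plen \<mu> \<le> n \<Longrightarrow> set_mset (mset_of_part \<mu>) \<subseteq> {..<n}"
  by (auto simp: set_mset_def not_less intro!: not_le_imp_less)

lemma ex_bij_extending:
  assumes "distinct (xs :: nat list)"
  shows "\<exists>p. bij p \<and> (\<forall>i<length xs. p (xs ! i) = i)"
proof -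
  define A where "A = - set xs"
  define B where "B = {length xs..}"
  have infA: "infinite A" unfolding A_def by (metis finite_compl finite_set infinite_UNIV_nat)
  have infB: "infinite B" unfolding B_def by (rule infinite_Ici)
  have "bij_betw (from_nat_into B \<circ> to_nat_on A) A B"
    using infA infB by (intro bij_betw_trans[OF to_nat_on_infinite bij_betw_from_nat_into]) auto
  then obtain g where g: "bij_betw g A B" by blast
  have f0: "bij_betw (\<lambda>i. xs ! i) {..<length xs} (set xs)"
    using assms by (rule bij_betw_nth) auto
  define f where "f = the_inv_into {..<length xs} (\<lambda>i. xs ! i)"
  have f: "bij_betw f (set xs) {..<length xs}" unfolding f_def by (rule bij_betw_the_inv_into[OF f0])
  have fv: "f (xs ! i) = i" if "i < length xs" for i
    unfolding f_def using f0 that by (intro the_inv_into_f_f) (auto simp: bij_betw_def)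
  define p where "p x = (if x \<in> set xs then f x else g x)" for x
  have "bij_betw p (set xs \<union> A) ({..<length xs} \<union> B)"
    unfolding p_def by (rule bij_betw_disjoint_Un) (use f g in \<open>auto simp: A_def B_def\<close>)
  moreover have "set xs \<union> A = UNIV" "{..<length xs} \<union> B = UNIV" by (auto simp: A_def B_def)
  ultimately have "bij p" by simp
  moreover have "p (xs ! i) = i" if "i < length xs" for i using that fv by (simp add: p_def)
  ultimately show ?thesis by blast
qed

text \<open>
  Sorting the exponents turns every monomial into the monomial of a partition, by a
  permutation of the variables.
\<close>

lemma ex_mset_of_part:
  fixes M :: "nat multiset"
  shows "\<exists>\<mu> p. bij p \<and> image_mset p M = mset_of_part \<mu>"
proof -
  define xs where "xs = rev (sort_key (count M) (sorted_list_of_set (set_mset M)))"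
  have dist: "distinct xs" and set: "set xs = set_mset M" by (simp_all add: xs_def)
  have srt: "sorted_wrt (\<ge>) (map (count M) xs)"
  proof -
    have "sorted (map (count M) (sort_key (count M) (sorted_list_of_set (set_mset M))))"
      by (rule sorted_sort_key)
    then show ?thesis unfolding xs_def by (simp add: sorted_wrt_rev flip: rev_map)
  qed
  define \<mu> where "\<mu> = Abs_int_partition (map (count M) xs)"
  have "0 \<notin> set (map (count M) xs)" using set by (auto simp: count_eq_zero_iff)
  then have parts: "parts \<mu> = map (count M) xs" using srt by (simp add: \<mu>_def Abs_int_partition_inverse)
  obtain p where p: "bij p" "\<And>i. i < length xs \<Longrightarrow> p (xs ! i) = i"
    using ex_bij_extending[OF dist] by blast
  have "image_mset p M = mset_of_part \<mu>"
  proof (rule multiset_eqI)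
    fix j
    obtain x where x: "j = p x" using p(1) by (metis bij_pointE)
    have "count (image_mset p M) j = count M x"
      unfolding x by (rule count_image_mset_inj) (rule bij_is_inj[OF p(1)])
    also have "\<dots> = part \<mu> j"
    proof (cases "x \<in> set xs")
      case True
      then obtain i where "i < length xs" "x = xs ! i" by (metis in_set_conv_nth)
      then show ?thesis using p(2)[of i] x by (simp add: part_def parts)
    next
      case False
      have "\<not> j < length xs"
      proof
        assume "j < length xs"
        then have "p (xs ! j) = p x" using p(2) x by simp
        then have "xs ! j = x" using p(1) by (simp add: bij_is_inj inj_eq)
        then show False using False \<open>j < length xs\<close> nth_mem by blast
      qed
      then show ?thesis using False set by (simp add: part_def parts count_eq_zero_iff)
    qed
    finally show "count (image_mset p M) j = count (mset_of_part \<mu>) j" by simp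
  qed
  then show ?thesis using p(1) by blast
qed

lemma Lambda_eq_0I:
  assumes "F \<in> Lambda" "\<And>\<mu>. mcoeff F (mset_of_part \<mu>) = 0"
  shows "F = 0"
proof (rule mpowser_eqI)
  fix M :: "nat multiset"
  obtain \<mu> p where "bij p" "image_mset p M = mset_of_part \<mu>" using ex_mset_of_part by blast
  then show "mcoeff F M = mcoeff 0 M" using Lambda_sym[OF assms(1), of p M] assms(2) by simp
qed

text \<open>
  A function to the natural numbers that is strictly monotone for the dominance order on partitions
  of size at most $d$. It replaces induction along that partial order.
\<close>

definition rank :: "nat \<Rightarrow> int_partition \<Rightarrow> nat" where
  "rank d \<mu> = (\<Sum>i\<le>d. \<Sum>j<i. part \<mu> j)"

lemma part_sum_le_psize: "(\<Sum>j<i. part \<mu> j) \<le> psize \<mu>"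
proof -
  have "(\<Sum>j<i. part \<mu> j) \<le> (\<Sum>j<i + plen \<mu>. part \<mu> j)" by (rule sum_mono2) auto
  then show ?thesis using psize_eq_sum[of \<mu> "i + plen \<mu>"] by simp
qed

lemma rank_mono:
  assumes "\<And>i. (\<Sum>j<i. part \<mu> j) \<le> (\<Sum>j<i. part \<rho> j)"
  shows "rank d \<mu> \<le> rank d \<rho>"
  unfolding rank_def by (rule sum_mono) (rule assms)

lemma rank_eq_imp_eq:
  assumes le: "\<And>i. (\<Sum>j<i. part \<mu> j) \<le> (\<Sum>j<i. part \<rho> j)"
    and sz: "psize \<mu> \<le> d" "psize \<rho> \<le> d" and eq: "rank d \<mu> = rank d \<rho>"
  shows "\<mu> = \<rho>"
proof (rule part_eqI)
  have partial: "(\<Sum>j<i. part \<mu> j) = (\<Sum>j<i. part \<rho> j)" if "i \<le> d" for i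
  proof (rule ccontr)
    assume "(\<Sum>j<i. part \<mu> j) \<noteq> (\<Sum>j<i. part \<rho> j)"
    then have "(\<Sum>j<i. part \<mu> j) < (\<Sum>j<i. part \<rho> j)" using le[of i] by simp
    then have "rank d \<mu> < rank d \<rho>" unfolding rank_def
      by (intro sum_strict_mono_ex1) (use le that in auto)
    then show False using eq by simp
  qed
  fix i
  show "part \<mu> i = part \<rho> i"
  proof (cases "i < d")
    case True
    then show ?thesis using partial[of i] partial[of "Suc i"] by simp
  next
    case False
    then show ?thesis using psize_ge_plen[of \<mu>] psize_ge_plen[of \<rho>] sz by simp
  qed
qed

context macdonald
begin

abbreviation Q :: "int_partition \<Rightarrow> mpowser" where
  "Q \<equiv> mac_Q q t"

text \<open>
  The symmetry of $Q_\mu$ will be deduced from this identity, so it is proved by comparing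
  the coefficients of all monomials, with \<open>tabsum_Pieri\<close>.
\<close>

theorem Pieri_elem:
  "elem k * Q \<mu> = (\<Sum>\<nu> | vstrip \<mu> \<nu> \<and> psize \<nu> = psize \<mu> + k. pieri \<nu> \<mu> *\<^sub>R Q \<nu>)"
proof (rule mpowser_eqI)
  fix M :: "nat multiset"
  obtain n where n: "set_mset M \<subseteq> {..<n}"
    using finite_nat_set_iff_bounded[of "set_mset M"] by auto
  have sub: "set_mset (M - mset_set C) \<subseteq> {..<n}" for C using n in_diffD[of _ M "mset_set C"] by blast
  have S: "{i. i < n \<and> 0 < count M i} = set_mset M" using n by auto
  have "mcoeff (elem k * Q \<mu>) M = (\<Sum>C | C \<subseteq> set_mset M \<and> card C = k. tabsum n \<mu> (count (M - mset_set C)))"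
    unfolding mcoeff_elem_mult mcoeff_mac_Q[OF sub] ..
  also have "\<dots> = (\<Sum>C | C \<subseteq> set_mset M \<and> card C = k. tabsum n \<mu> (\<lambda>i. count M i - (if i \<in> C then 1 else 0)))"
  proof (intro sum.cong refl tabsum_cong)
    fix C i assume "C \<in> {C. C \<subseteq> set_mset M \<and> card C = k}"
    then have "finite C" using finite_subset[of C "set_mset M"] by simp
    then show "count (M - mset_set C) i = count M i - (if i \<in> C then 1 else 0)"
      by (simp add: count_mset_set')
  qed
  also have "\<dots> = (\<Sum>\<nu> | vstrip \<mu> \<nu> \<and> psize \<nu> = psize \<mu> + k. pieri \<nu> \<mu> * tabsum n \<nu> (count M))"
    using tabsum_Pieri[where n = n and c = "count M" and k = k and \<mu> = \<mu>] unfolding S .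
  also have "\<dots> = mcoeff (\<Sum>\<nu> | vstrip \<mu> \<nu> \<and> psize \<nu> = psize \<mu> + k. pieri \<nu> \<mu> *\<^sub>R Q \<nu>) M"
    by (simp add: mcoeff_sum mcoeff_mac_Q[OF n])
  finally show "mcoeff (elem k * Q \<mu>) M = \<dots>" .
qed

section \<open>The Macdonald functions form a basis\<close>

lemma tabsum_nonneg: "tabsum n \<nu> c \<ge> 0"
  by (induction n arbitrary: \<nu>) (auto intro!: sum_nonneg mult_nonneg_nonneg less_imp_le[OF mac_phi_pos])

text \<open>
  In a tableau the entries less than $i$ lie in the first $i$ rows, because columns
  increase strictly. Hence the shape dominates the content.
\<close>

lemma tabsum_nonzero:
  "tabsum n \<nu> c \<noteq> 0 \<Longrightarrow> plen \<nu> \<le> n \<and> psize \<nu> = (\<Sum>j<n. c j) \<and>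
    (\<forall>i\<le>n. (\<Sum>j<i. c j) \<le> (\<Sum>j<i. part \<nu> j))"
proof (induction n arbitrary: \<nu>)
  case 0
  then show ?case by (auto split: if_splits)
next
  case (Suc n)
  obtain \<kappa> where k: "hstrip \<kappa> \<nu>" "psize \<nu> = psize \<kappa> + c n" "tabsum n \<kappa> c \<noteq> 0"
    using Suc.prems by (auto elim!: sum.not_neutral_contains_not_neutral)
  note IH = Suc.IH[OF k(3)]
  have len: "plen \<nu> \<le> Suc n" using hstrip_plen(2)[OF k(1)] IH by simp
  have sz: "psize \<nu> = (\<Sum>j<Suc n. c j)" using k(2) IH by simp
  have "(\<Sum>j<i. c j) \<le> (\<Sum>j<i. part \<nu> j)" if "i \<le> Suc n" for i
  proof (cases "i = Suc n")
    case True
    then show ?thesis using sz psize_eq_sum[OF len] by simp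
  next
    case False
    then have "(\<Sum>j<i. c j) \<le> (\<Sum>j<i. part \<kappa> j)" using IH that by simp
    also have "\<dots> \<le> (\<Sum>j<i. part \<nu> j)" by (rule sum_mono) (rule hstripD(1)[OF k(1)])
    finally show ?thesis .
  qed
  then show ?case using len sz by blast
qed

text \<open>
  The tableau with entry $i$ throughout row $i$ contributes a positive term.
\<close>

lemma tabsum_diag_pos: "plen \<nu> \<le> n \<Longrightarrow> tabsum n \<nu> (part \<nu>) > 0"
proof (induction n arbitrary: \<nu>)
  case 0
  then have "\<nu> = empty_partition" by (intro part_eqI) simp
  then show ?case by simp
next
  case (Suc n)
  define g where "g i = (if i < n then part \<nu> i else 0)" for i
  define \<kappa> where "\<kappa> = of_part g"
  have g: "part \<kappa> = g" unfolding \<kappa>_def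
    by (rule part_of_part[of _ n]) (auto simp: g_def part_antimono)
  have hs: "hstrip \<kappa> \<nu>" unfolding hstrip_def g g_def
    using Suc.prems by (auto simp: part_antimono)
  have lenk: "plen \<kappa> \<le> n" by (simp add: plen_le_iff g g_def)
  have sz: "psize \<nu> = psize \<kappa> + part \<nu> n"
    using psize_eq_sum[OF Suc.prems] psize_eq_sum[OF lenk] by (simp add: g g_def)
  have "tabsum n \<kappa> (part \<nu>) = tabsum n \<kappa> (part \<kappa>)" by (rule tabsum_cong) (simp add: g g_def)
  then have pos: "tabsum n \<kappa> (part \<nu>) > 0" using Suc.IH[OF lenk] by simp
  have "0 < phi \<nu> \<kappa> * tabsum n \<kappa> (part \<nu>)" using pos mac_phi_pos by simp
  also have "\<dots> \<le> tabsum (Suc n) \<nu> (part \<nu>)"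
    unfolding tabsum.simps
    by (rule member_le_sum)
      (use hs sz in \<open>auto intro!: mult_nonneg_nonneg tabsum_nonneg less_imp_le[OF mac_phi_pos] finite_hstrip\<close>)
  finally show ?case .
qed

lemma mcoeff_Q_mset: "plen \<mu> \<le> n \<Longrightarrow> mcoeff (Q \<nu>) (mset_of_part \<mu>) = tabsum n \<nu> (part \<mu>)"
  using mcoeff_mac_Q[OF set_mset_of_part, of \<mu> n \<nu>] by simp

lemma mcoeff_Q_diag: "mcoeff (Q \<nu>) (mset_of_part \<nu>) > 0"
  using mcoeff_Q_mset[of \<nu> "plen \<nu>" \<nu>] tabsum_diag_pos[of \<nu> "plen \<nu>"] by simp

lemma mcoeff_Q_nonzero:
  assumes "mcoeff (Q \<nu>) (mset_of_part \<mu>) \<noteq> 0"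
  shows "psize \<mu> = psize \<nu>" "\<And>i. (\<Sum>j<i. part \<mu> j) \<le> (\<Sum>j<i. part \<nu> j)"
proof -
  have *: "psize \<nu> = (\<Sum>j<n. part \<mu> j) \<and> (\<forall>i\<le>n. (\<Sum>j<i. part \<mu> j) \<le> (\<Sum>j<i. part \<nu> j))"
    if "plen \<mu> \<le> n" for n
    using tabsum_nonzero[of n \<nu> "part \<mu>"] mcoeff_Q_mset[OF that, of \<nu>] assms by simp
  show "psize \<mu> = psize \<nu>" using *[of "plen \<mu>"] psize_eq_sum[of \<mu> "plen \<mu>"] by simp
  show "(\<Sum>j<i. part \<mu> j) \<le> (\<Sum>j<i. part \<nu> j)" for i using *[of "max i (plen \<mu>)"] by simp
qed

lemma Q_empty: "Q empty_partition = 1"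
proof (rule mpowser_eqI)
  fix M :: "nat multiset"
  obtain n where n: "set_mset M \<subseteq> {..<n}"
    using finite_nat_set_iff_bounded[of "set_mset M"] by auto
  have cf0: "tabsum n empty_partition c = (if \<forall>i<n. c i = 0 then 1 else 0)" for n c
  proof (induction n)
    case (Suc n)
    have "{\<kappa>. hstrip \<kappa> empty_partition \<and> psize empty_partition = psize \<kappa> + c n} =
        (if c n = 0 then {empty_partition} else {})"
      by (auto simp: psize_0_iff hstrip_def)
    then show ?case using Suc by (auto simp: mac_phi_self less_Suc_eq)
  qed simp
  have "(\<forall>i<n. count M i = 0) \<longleftrightarrow> M = {#}"
  proof
    assume "\<forall>i<n. count M i = 0"
    then have "set_mset M = {}" using n by (auto simp: count_eq_zero_iff)
    then show "M = {#}" by simp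
  qed simp
  then show "mcoeff (Q empty_partition) M = mcoeff 1 M"
    by (simp add: mcoeff_mac_Q[OF n] cf0 mcoeff_one)
qed

lemma vf_pos:
  assumes "c > 0" "l > 0"
  shows "vf c d l > 0"
  unfolding vf_def using assms
  by (intro divide_pos_pos mult_pos_pos one_minus_qt_pos) auto

lemma vpsi_pos:
  assumes "vstrip \<mu> \<nu>"
  shows "vpsi \<nu> \<mu> > 0"
  unfolding vpsi_def
proof (intro prod_pos vf_pos ballI)
  fix b a assume b: "b \<in> {b. part \<nu> b \<noteq> part \<mu> b}" and a: "a \<in> {a. a < b \<and> part \<nu> a = part \<mu> a}"
  have "part \<mu> b < part \<nu> b" using b assms by (simp add: vstrip_def le_neq_implies_less)
  also have "\<dots> \<le> part \<nu> a" using a by (intro part_antimono) simp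
  finally show "part \<mu> a - part \<mu> b > 0" using a by simp
  show "b - a > 0" using a by simp
qed

lemma pieri_pos: "vstrip \<mu> \<nu> \<Longrightarrow> pieri \<nu> \<mu> > 0"
  unfolding pieri_def using vpsi_pos bb_pos by simp

lemma finite_vstrip: "finite {\<nu>. vstrip \<mu> \<nu> \<and> psize \<nu> = psize \<mu> + k}"
  by (rule finite_subset[OF _ finite_psize_eq[of "psize \<mu> + k"]]) auto

text \<open>
  Let $\mu$ be $\nu$ without its first column, which has length $k$. Adding a vertical strip of
  size $k$ to $\mu$ without creating new rows below row $k$ is only possible in one way and gives
  $\nu$; all other terms of $e_k Q_\mu$ have more rows than $\nu$. So induction on the size
  and then on the difference of size and length expresses $Q_\nu$ through $e_k Q_\mu$.
\<close>

lemma Q_elem_algebra: "Q \<nu> \<in> elem_algebra"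
proof (induction \<nu> rule: wf_induct[where r = "measures [psize, \<lambda>\<nu>. psize \<nu> - plen \<nu>]"])
  case 1
  show ?case by (rule wf_measures)
next
  case (2 \<nu>)
  then have IH: "Q \<rho> \<in> elem_algebra"
    if "psize \<rho> < psize \<nu> \<or> psize \<rho> = psize \<nu> \<and> psize \<rho> - plen \<rho> < psize \<nu> - plen \<nu>" for \<rho>
    using that by auto
  show ?case
  proof (cases "\<nu> = empty_partition")
    case True
    then show ?thesis by (simp add: Q_empty elem_algebra.one)
  next
    case False
    define k where "k = plen \<nu>"
    define \<mu> where "\<mu> = of_part (\<lambda>i. part \<nu> i - 1)"
    have m: "part \<mu> i = part \<nu> i - 1" for i
      unfolding \<mu>_def by (subst part_of_part[of _ k]) (auto simp: part_antimono diff_le_mono k_def)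
    have k0: "k > 0" using False by (metis gr0I k_def part_empty part_eqI part_eq_0 zero_le)
    have nz: "part \<nu> i > 0 \<longleftrightarrow> i < k" for i using part_eq_0_iff[of \<nu> i] by (auto simp: k_def)
    have vs: "vstrip \<mu> \<nu>" unfolding vstrip_def m by auto
    have "(\<Sum>i<k. part \<nu> i) = (\<Sum>i<k. part \<mu> i + 1)"
      by (rule sum.cong) (use nz in \<open>auto simp: m\<close>)
    also have "\<dots> = (\<Sum>i<k. part \<mu> i) + k" by (subst sum.distrib) simp
    finally have "(\<Sum>i<k. part \<nu> i) = (\<Sum>i<k. part \<mu> i) + k" .
    moreover have "plen \<mu> \<le> k" by (simp add: plen_le_iff m k_def)
    ultimately have sz: "psize \<nu> = psize \<mu> + k"
      using psize_eq_sum[of \<nu> k] psize_eq_sum[of \<mu> k] by (simp add: k_def)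
    let ?V = "{\<rho>. vstrip \<mu> \<rho> \<and> psize \<rho> = psize \<mu> + k}"
    have "Q \<rho> \<in> elem_algebra" if \<rho>: "\<rho> \<in> ?V - {\<nu>}" for \<rho>
    proof (rule IH)
      have "plen \<rho> > k"
      proof (rule ccontr)
        assume "\<not> plen \<rho> > k"
        have "part \<rho> i \<le> part \<nu> i" for i
        proof (cases "i < k")
          case True
          have "part \<rho> i \<le> Suc (part \<mu> i)" using \<rho> by (simp add: vstrip_def)
          then show ?thesis using nz[of i] True by (simp add: m)
        next
          case False
          then show ?thesis using \<open>\<not> plen \<rho> > k\<close> by simp
        qed
        then have "\<rho> = \<nu>" by (rule psize_eq_imp_eq) (use \<rho> sz in simp)
        then show False using \<rho> by simp
      qed
      then show "psize \<rho> < psize \<nu> \<or> psize \<rho> = psize \<nu> \<and> psize \<rho> - plen \<rho> < psize \<nu> - plen \<nu>"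
        using \<rho> sz psize_ge_plen[of \<rho>] by (auto simp: k_def)
    qed
    then have rest: "(\<Sum>\<rho>\<in>?V - {\<nu>}. pieri \<rho> \<mu> *\<^sub>R Q \<rho>) \<in> elem_algebra"
      by (intro elem_algebra_sum elem_algebra.scale)
    have mem: "elem k * Q \<mu> \<in> elem_algebra" by (intro elem_algebra.mult IH) (use sz k0 in simp)
    have "elem k * Q \<mu> = pieri \<nu> \<mu> *\<^sub>R Q \<nu> + (\<Sum>\<rho>\<in>?V - {\<nu>}. pieri \<rho> \<mu> *\<^sub>R Q \<rho>)"
      unfolding Pieri_elem by (rule sum.remove) (use finite_vstrip vs sz in auto)
    then have "pieri \<nu> \<mu> *\<^sub>R Q \<nu> \<in> elem_algebra"
      using elem_algebra.add[OF mem elem_algebra.scale[OF rest, of "- 1"]] by simp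
    from elem_algebra.scale[OF this, of "1 / pieri \<nu> \<mu>"]
    show ?thesis using pieri_pos[OF vs] by simp
  qed
qed

lemma Q_Lambda [intro, simp]: "Q \<nu> \<in> Lambda"
  by (rule elem_algebra_Lambda[OF Q_elem_algebra])

text \<open>
  Let $\rho$ have the largest rank among the partitions with nonzero coefficient. By
  triangularity, only $Q_\rho$ contributes to the monomial of $\rho$.
\<close>

lemma sum_Q_eq_0:
  assumes fin: "finite P" and sum: "(\<Sum>\<nu>\<in>P. c \<nu> *\<^sub>R Q \<nu>) = 0" and "\<mu> \<in> P"
  shows "c \<mu> = 0"
proof (rule ccontr)
  assume "c \<mu> \<noteq> 0"
  define P' where "P' = {\<nu> \<in> P. c \<nu> \<noteq> 0}"
  have fin': "finite P'" "P' \<noteq> {}" using fin \<open>\<mu> \<in> P\<close> \<open>c \<mu> \<noteq> 0\<close> by (auto simp: P'_def)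
  define d where "d = Max (psize ` P')"
  have d: "psize \<nu> \<le> d" if "\<nu> \<in> P'" for \<nu> using fin' that by (simp add: d_def)
  have "Max (rank d ` P') \<in> rank d ` P'" using fin' by (intro Max_in) auto
  then obtain \<rho> where \<rho>: "\<rho> \<in> P'" "rank d \<rho> = Max (rank d ` P')" by force
  have max: "rank d \<nu> \<le> rank d \<rho>" if "\<nu> \<in> P'" for \<nu> using fin' that by (simp add: \<rho>)
  have zero: "c \<nu> * mcoeff (Q \<nu>) (mset_of_part \<rho>) = 0" if "\<nu> \<in> P - {\<rho>}" for \<nu>
  proof (rule ccontr)
    assume "c \<nu> * mcoeff (Q \<nu>) (mset_of_part \<rho>) \<noteq> 0"
    then have nz: "c \<nu> \<noteq> 0" "mcoeff (Q \<nu>) (mset_of_part \<rho>) \<noteq> 0" by auto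
    then have \<nu>: "\<nu> \<in> P'" using that by (simp add: P'_def)
    note dom = mcoeff_Q_nonzero[OF nz(2)]
    have "rank d \<rho> = rank d \<nu>" using rank_mono[OF dom(2)] max[OF \<nu>] by (rule antisym)
    then have "\<rho> = \<nu>" by (intro rank_eq_imp_eq[OF dom(2) d[OF \<rho>(1)] d[OF \<nu>]])
    then show False using that by simp
  qed
  have "0 = mcoeff (\<Sum>\<nu>\<in>P. c \<nu> *\<^sub>R Q \<nu>) (mset_of_part \<rho>)" by (simp add: sum)
  also have "\<dots> = (\<Sum>\<nu>\<in>P. c \<nu> * mcoeff (Q \<nu>) (mset_of_part \<rho>))" by (simp add: mcoeff_sum)
  also have "\<dots> = c \<rho> * mcoeff (Q \<rho>) (mset_of_part \<rho>) + (\<Sum>\<nu>\<in>P - {\<rho>}. c \<nu> * mcoeff (Q \<nu>) (mset_of_part \<rho>))"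
    by (rule sum.remove) (use fin \<rho> in \<open>auto simp: P'_def\<close>)
  also have "(\<Sum>\<nu>\<in>P - {\<rho>}. c \<nu> * mcoeff (Q \<nu>) (mset_of_part \<rho>)) = 0"
    by (rule sum.neutral) (use zero in blast)
  finally show False using \<rho>(1) mcoeff_Q_diag[of \<rho>] by (auto simp: P'_def)
qed

lemma inj_Q: "inj Q"
proof
  fix \<mu> \<nu> assume eq: "Q \<mu> = Q \<nu>"
  show "\<mu> = \<nu>"
  proof (rule ccontr)
    assume ne: "\<mu> \<noteq> \<nu>"
    have "(\<Sum>\<rho>\<in>{\<mu>, \<nu>}. (if \<rho> = \<mu> then 1 else - 1) *\<^sub>R Q \<rho>) = 0" using ne eq by simp
    from sum_Q_eq_0[OF _ this, of \<mu>] show False by simp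
  qed
qed

lemma independent_Q: "independent (range Q)"
  unfolding real_vector.independent_explicit_finite_subsets
proof (intro allI impI ballI)
  fix S u v assume S: "S \<subseteq> range Q" "finite S" and sum: "(\<Sum>v\<in>S. u v *\<^sub>R v) = 0" and v: "v \<in> S"
  define P where "P = Q -` S"
  have SP: "S = Q ` P" using S(1) by (auto simp: P_def)
  have finP: "finite P" unfolding P_def using S(2) inj_Q by (rule finite_vimageI)
  have "(\<Sum>\<nu>\<in>P. u (Q \<nu>) *\<^sub>R Q \<nu>) = 0"
    using sum unfolding SP by (subst (asm) sum.reindex) (auto intro: inj_on_subset[OF inj_Q])
  then have "u (Q \<nu>) = 0" if "\<nu> \<in> P" for \<nu> using sum_Q_eq_0[OF finP, of "\<lambda>\<nu>. u (Q \<nu>)"] that by simp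
  then show "u v = 0" using v SP by auto
qed

text \<open>
  A symmetric function is determined by its coefficients at the monomials of partitions. Subtracting
  suitable multiples of the $Q_\mu$ of the highest rank removes all coefficients of that
  rank and, by triangularity, creates only coefficients of smaller rank.
\<close>

lemma Lambda_span_rank:
  "F \<in> Lambda \<Longrightarrow> (\<And>\<mu>. mcoeff F (mset_of_part \<mu>) \<noteq> 0 \<Longrightarrow> psize \<mu> \<le> d \<and> rank d \<mu> < k) \<Longrightarrow> F \<in> span (range Q)"
proof (induction k arbitrary: F)
  case 0
  then have "F = 0" by (intro Lambda_eq_0I) auto
  then show ?case by (simp add: span_zero)
next
  case (Suc k)
  define R where "R = {\<mu>. psize \<mu> \<le> d \<and> rank d \<mu> = k}"
  have finR: "finite R" by (rule finite_subset[OF _ finite_psize[of d]]) (auto simp: R_def)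
  \<comment> \<open>two different partitions of the same rank do not contribute to each other, so the coefficients can be read off separately\<close>
  define c where "c \<mu> = mcoeff F (mset_of_part \<mu>) / mcoeff (Q \<mu>) (mset_of_part \<mu>)" for \<mu>
  define G where "G = F - (\<Sum>\<mu>\<in>R. c \<mu> *\<^sub>R Q \<mu>)"
  have Gc: "mcoeff G M = mcoeff F M - (\<Sum>\<mu>\<in>R. c \<mu> * mcoeff (Q \<mu>) M)" for M
    by (simp add: G_def mcoeff_sum)
  have "G \<in> Lambda" unfolding G_def using Suc.prems(1) by (intro Lambda_diff Lambda_sum Lambda_scaleR) auto
  moreover have "psize \<nu> \<le> d \<and> rank d \<nu> < k" if nz: "mcoeff G (mset_of_part \<nu>) \<noteq> 0" for \<nu>
  proof -
    have supp: "psize \<nu> \<le> d \<and> rank d \<nu> \<le> k"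
    proof (cases "mcoeff F (mset_of_part \<nu>) = 0")
      case False
      then show ?thesis using Suc.prems(2) by (simp add: less_Suc_eq_le)
    next
      case True
      then have "(\<Sum>\<mu>\<in>R. c \<mu> * mcoeff (Q \<mu>) (mset_of_part \<nu>)) \<noteq> 0" using nz by (simp add: Gc)
      then obtain \<mu> where "\<mu> \<in> R" "c \<mu> * mcoeff (Q \<mu>) (mset_of_part \<nu>) \<noteq> 0"
        by (rule sum.not_neutral_contains_not_neutral)
      then have \<mu>: "\<mu> \<in> R" "mcoeff (Q \<mu>) (mset_of_part \<nu>) \<noteq> 0" by auto
      show ?thesis using mcoeff_Q_nonzero(1)[OF \<mu>(2)] rank_mono[OF mcoeff_Q_nonzero(2)[OF \<mu>(2)], of d] \<mu>(1)
        by (simp add: R_def)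
    qed
    moreover have "rank d \<nu> \<noteq> k"
    proof
      assume eq: "rank d \<nu> = k"
      then have \<nu>R: "\<nu> \<in> R" using supp by (simp add: R_def)
      have "c \<mu> * mcoeff (Q \<mu>) (mset_of_part \<nu>) = 0" if \<mu>: "\<mu> \<in> R - {\<nu>}" for \<mu>
      proof (rule ccontr)
        assume "c \<mu> * mcoeff (Q \<mu>) (mset_of_part \<nu>) \<noteq> 0"
        then have "mcoeff (Q \<mu>) (mset_of_part \<nu>) \<noteq> 0" by auto
        from rank_eq_imp_eq[OF mcoeff_Q_nonzero(2)[OF this], of d] have "\<nu> = \<mu>"
          using supp \<mu> eq by (simp add: R_def)
        then show False using \<mu> by simp
      qed
      then have "(\<Sum>\<mu>\<in>R - {\<nu>}. c \<mu> * mcoeff (Q \<mu>) (mset_of_part \<nu>)) = 0" by (intro sum.neutral) blast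
      then have "(\<Sum>\<mu>\<in>R. c \<mu> * mcoeff (Q \<mu>) (mset_of_part \<nu>)) = mcoeff F (mset_of_part \<nu>)"
        using finR \<nu>R mcoeff_Q_diag[of \<nu>] by (simp add: sum.remove[of R \<nu>] c_def)
      then show False using nz by (simp add: Gc)
    qed
    ultimately show ?thesis by simp
  qed
  ultimately have "G \<in> span (range Q)" by (rule Suc.IH)
  moreover have "(\<Sum>\<mu>\<in>R. c \<mu> *\<^sub>R Q \<mu>) \<in> span (range Q)"
    by (intro span_sum span_scale span_base) auto
  ultimately have "G + (\<Sum>\<mu>\<in>R. c \<mu> *\<^sub>R Q \<mu>) \<in> span (range Q)" by (rule span_add)
  then show ?case by (simp add: G_def)
qed

lemma Lambda_eq_span: "Lambda = span (range Q)"
proof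
  show "Lambda \<subseteq> span (range Q)"
  proof
    fix F assume F: "F \<in> Lambda"
    obtain d where d: "\<And>M. mcoeff F M \<noteq> 0 \<Longrightarrow> size M \<le> d" using Lambda_bounded[OF F] by blast
    have "rank d \<mu> < Suc (Suc d * d)" if "psize \<mu> \<le> d" for \<mu>
    proof -
      have "rank d \<mu> \<le> (\<Sum>i\<le>d. d)" unfolding rank_def
        by (rule sum_mono) (use part_sum_le_psize[of \<mu>] that le_trans in blast)
      then show ?thesis by simp
    qed
    then show "F \<in> span (range Q)"
      using d[of "mset_of_part _"] by (intro Lambda_span_rank[OF F, of d "Suc (Suc d * d)"]) (simp add: size_mset_of_part)
  qed
  have "subspace Lambda" by (rule subspaceI) auto
  then show "span (range Q) \<subseteq> Lambda" by (intro span_minimal) auto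
qed

lemma span_induct_Q [consumes 1, case_names Q add scale]:
  assumes "F \<in> Lambda" "\<And>\<mu>. P (Q \<mu>)"
    "\<And>F G. F \<in> Lambda \<Longrightarrow> G \<in> Lambda \<Longrightarrow> P F \<Longrightarrow> P G \<Longrightarrow> P (F + G)"
    "\<And>c F. F \<in> Lambda \<Longrightarrow> P F \<Longrightarrow> P (c *\<^sub>R F)"
  shows "P F"
proof -
  have "F \<in> span (range Q)" using assms(1) Lambda_eq_span by simp
  then have "F \<in> Lambda \<and> P F"
  proof (rule span_induct)
    show "subspace {x. x \<in> Lambda \<and> P x}"
      using assms(2-4) assms(4)[of "Q empty_partition" 0] by (intro subspaceI) auto
  qed (use assms(2) in auto)
  then show ?thesis by simp
qed

end

section \<open>Functionals on symmetric functions\<close>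

lemma Lambda_linear_add: "\<theta> \<in> Lambda_linear \<Longrightarrow> F \<in> Lambda \<Longrightarrow> G \<in> Lambda \<Longrightarrow> \<theta> (F + G) = \<theta> F + \<theta> G"
  by (simp add: Lambda_linear_def)

lemma Lambda_linear_scale: "\<theta> \<in> Lambda_linear \<Longrightarrow> F \<in> Lambda \<Longrightarrow> \<theta> (c *\<^sub>R F) = c * \<theta> F"
  by (simp add: Lambda_linear_def)

lemma Lambda_linear_zero: "\<theta> \<in> Lambda_linear \<Longrightarrow> \<theta> 0 = 0"
  using Lambda_linear_scale[of \<theta> 0 0] by simp

lemma Lambda_linear_sum:
  assumes "\<theta> \<in> Lambda_linear" "\<And>x. x \<in> S \<Longrightarrow> G x \<in> Lambda"
  shows "\<theta> (\<Sum>x\<in>S. c x *\<^sub>R G x) = (\<Sum>x\<in>S. c x * \<theta> (G x))"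
  using assms(2)
proof (induction S rule: infinite_finite_induct)
  case (insert x S)
  then have "\<theta> (c x *\<^sub>R G x + (\<Sum>x\<in>S. c x *\<^sub>R G x)) = c x * \<theta> (G x) + (\<Sum>x\<in>S. c x * \<theta> (G x))"
    using assms(1) by (subst Lambda_linear_add) (auto simp: Lambda_linear_scale)
  then show ?case using insert by simp
qed (simp_all add: Lambda_linear_zero[OF assms(1)])

lemma add_box_iff_vstrip: "\<mu> \<nearrow> \<nu> \<longleftrightarrow> vstrip \<mu> \<nu> \<and> psize \<nu> = psize \<mu> + 1"
proof
  assume "\<mu> \<nearrow> \<nu>"
  then obtain s where s: "s \<notin> diagram \<mu>" "diagram \<nu> = insert s (diagram \<mu>)" by (auto simp: add_box_def)
  interpret macdonald 0 0 by unfold_locales auto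
  obtain m where "\<And>i. part \<nu> i = (if i = m then Suc (part \<mu> m) else part \<mu> i)"
    using add_boxE[OF \<open>\<mu> \<nearrow> \<nu>\<close>] by metis
  then have "vstrip \<mu> \<nu>" by (simp add: vstrip_def)
  then show "vstrip \<mu> \<nu> \<and> psize \<nu> = psize \<mu> + 1" using s by (simp add: psize_def)
next
  assume a: "vstrip \<mu> \<nu> \<and> psize \<nu> = psize \<mu> + 1"
  then have sub: "diagram \<mu> \<subseteq> diagram \<nu>" by (simp add: diagram_subset_iff vstrip_def)
  then have "card (diagram \<nu> - diagram \<mu>) = 1" using a by (simp add: card_Diff_subset psize_def)
  then obtain s where "diagram \<nu> - diagram \<mu> = {s}" by (auto simp: card_1_singleton_iff)
  then have "s \<notin> diagram \<mu>" "diagram \<nu> = insert s (diagram \<mu>)" using sub by auto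
  then show "\<mu> \<nearrow> \<nu>" unfolding add_box_def by blast
qed

lemma finite_add_box: "finite {\<nu>. \<mu> \<nearrow> \<nu>}"
  by (rule finite_subset[OF _ finite_psize_eq[of "psize \<mu> + 1"]]) (auto simp: add_box_iff_vstrip)

lemma vstrip_card:
  assumes "vstrip \<mu> \<nu>"
  shows "finite {i. part \<nu> i \<noteq> part \<mu> i}" "psize \<nu> = psize \<mu> + card {i. part \<nu> i \<noteq> part \<mu> i}"
proof -
  let ?I = "{i. part \<nu> i \<noteq> part \<mu> i}"
  define N where "N = max (plen \<mu>) (plen \<nu>)"
  have sub: "?I \<subseteq> {..<N}"
  proof
    fix i assume "i \<in> ?I"
    then show "i \<in> {..<N}" by (rule contrapos_pp) (simp add: N_def)
  qed
  then show "finite ?I" using finite_subset by blast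
  have "part \<nu> i = part \<mu> i + (if i \<in> ?I then 1 else 0)" for i
    using assms[unfolded vstrip_def, rule_format, of i] by auto
  then have "(\<Sum>i<N. part \<nu> i) = (\<Sum>i<N. part \<mu> i + (if i \<in> ?I then 1 else 0))" by (intro sum.cong refl)
  also have "\<dots> = (\<Sum>i<N. part \<mu> i) + (\<Sum>i<N. if i \<in> ?I then 1 else 0)" by (rule sum.distrib)
  also have "(\<Sum>i<N. if i \<in> ?I then 1 else 0) = card ?I"
    using sub by (subst sum.inter_restrict[symmetric]) (auto simp: inf_absorb2)
  finally show "psize \<nu> = psize \<mu> + card ?I"
    using psize_eq_sum[of \<nu> N] psize_eq_sum[of \<mu> N] by (simp add: N_def)
qed

context macdonald
begin

text \<open>
  A linear functional on a space with a basis is determined by arbitrary values on the basis;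
  so the defining description of \<open>tilde\<close> has exactly one solution.
\<close>

lemma ex1_functional: "\<exists>!\<theta>. \<theta> \<in> Lambda_linear \<and> (\<forall>\<mu>. \<theta> (Q \<mu>) = f \<mu>)"
proof (rule ex_ex1I)
  obtain g where g: "linear g" "\<And>x. x \<in> range Q \<Longrightarrow> g x = f (inv Q x)"
    using real_vector.linear_independent_extend[OF independent_Q, of "\<lambda>x. f (inv Q x)"]
    unfolding linear_def[symmetric] by blast
  have "restrict g Lambda \<in> Lambda_linear"
    unfolding Lambda_linear_def using linear_add[OF g(1)] linear_scale[OF g(1)]
    by (auto simp: Lambda_add Lambda_scaleR)
  moreover have "restrict g Lambda (Q \<mu>) = f \<mu>" for \<mu>
    using g(2)[of "Q \<mu>"] inv_f_f[OF inj_Q] by simp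
  ultimately show "\<exists>\<theta>. \<theta> \<in> Lambda_linear \<and> (\<forall>\<mu>. \<theta> (Q \<mu>) = f \<mu>)" by blast
next
  fix \<theta> \<eta> assume a: "\<theta> \<in> Lambda_linear \<and> (\<forall>\<mu>. \<theta> (Q \<mu>) = f \<mu>)" "\<eta> \<in> Lambda_linear \<and> (\<forall>\<mu>. \<eta> (Q \<mu>) = f \<mu>)"
  have "\<theta> F = \<eta> F" if "F \<in> Lambda" for F
    using that by (induction rule: span_induct_Q) (use a in \<open>auto simp: Lambda_linear_add Lambda_linear_scale\<close>)
  moreover have "\<theta> \<in> extensional Lambda" "\<eta> \<in> extensional Lambda" using a by (auto simp: Lambda_linear_def)
  ultimately show "\<theta> = \<eta>" by (intro extensionalityI)
qed

lemma tilde_linear: "tilde q t f \<in> Lambda_linear" and tilde_Q: "tilde q t f (Q \<mu>) = f \<mu>"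
  using theI'[OF ex1_functional[of f]] by (auto simp: tilde_def)

lemma tilde_eqI: "\<theta> \<in> Lambda_linear \<Longrightarrow> (\<And>\<mu>. \<theta> (Q \<mu>) = f \<mu>) \<Longrightarrow> tilde q t f = \<theta>"
  unfolding tilde_def by (rule the1_equality[OF ex1_functional]) auto

abbreviation c1 :: real where "c1 \<equiv> (1 - t) / (1 - q)"

lemma c1_pos: "c1 > 0"
  using q_bounds t_bounds by simp

lemma h1_Lambda [simp]: "h1 \<in> Lambda"
  unfolding elem_1[symmetric] by simp

text \<open>
  The case $k = 1$ of the Pieri rule turns the edge weights of the Young graph into multiplication
  by a multiple of $h_1$.
\<close>

lemma Pieri_h1: "(c1 *\<^sub>R h1) * Q \<mu> = (\<Sum>\<nu> | \<mu> \<nearrow> \<nu>. psi \<nu> \<mu> *\<^sub>R Q \<nu>)"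
proof -
  have "(c1 *\<^sub>R h1) * Q \<mu> = c1 *\<^sub>R (\<Sum>\<nu> | \<mu> \<nearrow> \<nu>. pieri \<nu> \<mu> *\<^sub>R Q \<nu>)"
    using Pieri_elem[of 1 \<mu>] unfolding elem_1 by (simp add: add_box_iff_vstrip)
  also have "\<dots> = (\<Sum>\<nu> | \<mu> \<nearrow> \<nu>. psi \<nu> \<mu> *\<^sub>R Q \<nu>)"
    unfolding scaleR_sum_right by (rule sum.cong) (auto simp: mac_psi_add_box)
  finally show ?thesis .
qed

text \<open>
  Harmonicity without positivity and normalisation, which is a linear condition.
\<close>

definition prolongable :: "(int_partition \<Rightarrow> real) \<Rightarrow> bool" where
  "prolongable f \<longleftrightarrow> (\<forall>\<mu>. f \<mu> = (\<Sum>\<nu> | \<mu> \<nearrow> \<nu>. psi \<nu> \<mu> * f \<nu>))"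

lemma harmonic_iff: "f \<in> harmonic q t \<longleftrightarrow> (\<forall>\<nu>. f \<nu> \<ge> 0) \<and> f empty_partition = 1 \<and> prolongable f"
  by (simp add: harmonic_def prolongable_def)

lemma functional_h1_iff:
  assumes \<theta>: "\<theta> \<in> Lambda_linear"
  shows "prolongable (\<lambda>\<mu>. \<theta> (Q \<mu>)) \<longleftrightarrow> (\<forall>F\<in>Lambda. \<theta> ((c1 *\<^sub>R h1) * F) = \<theta> F)"
proof -
  have hL: "c1 *\<^sub>R h1 \<in> Lambda" by (intro Lambda_scaleR h1_Lambda)
  have *: "\<theta> ((c1 *\<^sub>R h1) * Q \<mu>) = (\<Sum>\<nu> | \<mu> \<nearrow> \<nu>. psi \<nu> \<mu> * \<theta> (Q \<nu>))" for \<mu>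
    unfolding Pieri_h1 by (rule Lambda_linear_sum[OF \<theta>]) simp
  show ?thesis
  proof
    assume pr: "prolongable (\<lambda>\<mu>. \<theta> (Q \<mu>))"
    show "\<forall>F\<in>Lambda. \<theta> ((c1 *\<^sub>R h1) * F) = \<theta> F"
    proof
      fix F assume "F \<in> Lambda"
      then show "\<theta> ((c1 *\<^sub>R h1) * F) = \<theta> F"
      proof (induction rule: span_induct_Q)
        case (Q \<mu>)
        show ?case unfolding * by (rule pr[unfolded prolongable_def, rule_format, symmetric])
      next
        case (add F G)
        then show ?case using hL \<theta>
          by (simp only: distrib_left Lambda_linear_add Lambda_mult)
      next
        case (scale c F)
        then show ?case using hL \<theta>
          by (simp only: mult_scaleR_right Lambda_linear_scale Lambda_mult)
      qed
    qed
  next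
    assume "\<forall>F\<in>Lambda. \<theta> ((c1 *\<^sub>R h1) * F) = \<theta> F"
    then have "\<theta> (Q \<mu>) = \<theta> ((c1 *\<^sub>R h1) * Q \<mu>)" for \<mu> by (metis Q_Lambda)
    then show "prolongable (\<lambda>\<mu>. \<theta> (Q \<mu>))" unfolding prolongable_def * by blast
  qed
qed

section \<open>Multiplication by elementary symmetric functions is dominated\<close>

text \<open>
  Uniform in the shape: the numerator stays away from 0 and the denominator is at most 4.
\<close>

lemma vf_lower_bound:
  assumes "c > 0" "l > 0"
  shows "vf c d l \<ge> (1 - \<bar>q\<bar>) * (1 - \<bar>t\<bar>) / 4"
proof -
  have pq: "\<bar>q\<bar> ^ c \<le> \<bar>q\<bar>" using power_decreasing[of 1 c "\<bar>q\<bar>"] assms(1) q_bounds by simp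
  have pt: "\<bar>t\<bar> ^ (l + 1) \<le> \<bar>t\<bar>" using power_decreasing[of 1 "l + 1" "\<bar>t\<bar>"] t_bounds by simp
  have 1: "1 - \<bar>q\<bar> \<le> 1 - q ^ c * t ^ (l - 1)" using abs_qt_le(1)[of c "l - 1"] pq by linarith
  have 2: "1 - \<bar>t\<bar> \<le> 1 - q ^ d * t ^ (l + 1)" using abs_qt_le(2)[of d "l + 1"] pt by linarith
  have den: "0 < 1 - q ^ e * t ^ l" "1 - q ^ e * t ^ l \<le> 2" for e
    using qt_less_1[of e l] assms(2) by (simp_all add: abs_less_iff)
  have pos: "0 \<le> 1 - \<bar>q\<bar>" "0 \<le> 1 - \<bar>t\<bar>" using q_bounds t_bounds by auto
  have num: "(1 - \<bar>q\<bar>) * (1 - \<bar>t\<bar>) \<le> (1 - q ^ c * t ^ (l - 1)) * (1 - q ^ d * t ^ (l + 1))"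
    using 1 2 pos by (intro mult_mono) auto
  have "(1 - q ^ c * t ^ l) * (1 - q ^ d * t ^ l) \<le> 2 * 2"
    using den[of c] den[of d] by (intro mult_mono) auto
  moreover have "0 \<le> (1 - \<bar>q\<bar>) * (1 - \<bar>t\<bar>)" using pos by simp
  ultimately show ?thesis
    unfolding vf_def using num den[of c] den[of d] by (intro frac_le) auto
qed

text \<open>
  Let $m$ be the lowest row that receives a box. Adding the strip without this box first and the box
  in row $m$ afterwards yields all factors of $\psi'_{\nu/\mu}$ and, in addition, one
  factor for each pair of $m$ with one of the $k$ other rows of the strip. Each of these is bounded
  below by \<open>vf_lower_bound\<close>, independently of the shape.
\<close>

lemma vstrip_remove_lowest:
  assumes vs: "vstrip \<mu> \<nu>" and sz: "psize \<nu> = psize \<mu> + Suc k"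
  shows "\<exists>\<rho>. vstrip \<mu> \<rho> \<and> psize \<rho> = psize \<mu> + k \<and> \<rho> \<nearrow> \<nu> \<and>
    ((1 - \<bar>q\<bar>) * (1 - \<bar>t\<bar>) / 4) ^ k * pieri \<nu> \<mu> \<le> pieri \<nu> \<rho> * pieri \<rho> \<mu>"
proof -
  let ?\<delta> = "(1 - \<bar>q\<bar>) * (1 - \<bar>t\<bar>) / 4"
  define I where "I = {i. part \<nu> i \<noteq> part \<mu> i}"
  have finI: "finite I" and cardI: "card I = Suc k" using vstrip_card[OF vs] sz by (simp_all add: I_def)
  have inI: "part \<nu> i = (if i \<in> I then Suc (part \<mu> i) else part \<mu> i)" for i
    using vs[unfolded vstrip_def, rule_format, of i] by (auto simp: I_def)
  define m where "m = Max I"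
  have "I \<noteq> {}" using cardI by auto
  then have m: "m \<in> I" "\<And>i. i \<in> I \<Longrightarrow> i \<le> m" using finI Max_in[of I] cardI by (auto simp: m_def card_gt_0_iff )
  define g where "g i = (if i = m then part \<mu> m else part \<nu> i)" for i
  define \<rho> where "\<rho> = of_part g"
  have g: "part \<rho> = g"
    unfolding \<rho>_def
  proof (rule part_of_part[of _ "plen \<nu> + Suc m"])
    fix i
    show "g (Suc i) \<le> g i"
    proof (cases "i = m")
      case True
      have "Suc m \<notin> I" using m(2)[of "Suc m"] by auto
      then show ?thesis using True inI[of "Suc m"] by (simp add: g_def part_antimono)
    next
      case False
      have "part \<mu> m \<le> part \<nu> m" using inI[of m] by simp
      then show ?thesis using False part_antimono[of i "Suc i" \<nu>] by (auto simp: g_def)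
    qed
  qed (simp add: g_def)
  have vs1: "vstrip \<mu> \<rho>" using inI by (simp add: vstrip_def g g_def)
  have I1: "{i. part \<rho> i \<noteq> part \<mu> i} = I - {m}" by (auto simp: g g_def I_def)
  have sz1: "psize \<rho> = psize \<mu> + k" using vstrip_card(2)[OF vs1] m(1) finI cardI by (simp add: I1)
  have vs2: "vstrip \<rho> \<nu>" using inI[of m] m(1) by (simp add: vstrip_def g g_def)
  have box: "\<rho> \<nearrow> \<nu>" using vs2 sz sz1 by (simp add: add_box_iff_vstrip)
  let ?w = "\<lambda>b. \<Prod>a | a < b \<and> a \<notin> I. vf (part \<mu> a - part \<mu> b) (part \<nu> a - part \<nu> b) (b - a)"
  have v0: "vpsi \<nu> \<mu> = (\<Prod>b\<in>I. ?w b)"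
    unfolding vpsi_def I_def by (intro prod.cong) auto
  have v1: "vpsi \<rho> \<mu> = (\<Prod>b\<in>I - {m}. ?w b)"
    unfolding vpsi_def I1
  proof (intro prod.cong refl)
    fix b assume "b \<in> I - {m}"
    then have b: "b < m" using m(2)[of b] by auto
    then show "{a. a < b \<and> part \<rho> a = part \<mu> a} = {a. a < b \<and> a \<notin> I}" by (auto simp: g g_def I_def)
    fix a assume "a \<in> {a. a < b \<and> a \<notin> I}"
    then show "vf (part \<mu> a - part \<mu> b) (part \<rho> a - part \<rho> b) (b - a) =
        vf (part \<mu> a - part \<mu> b) (part \<nu> a - part \<nu> b) (b - a)" using b by (simp add: g g_def)
  qed
  let ?e = "\<lambda>a. vf (part \<nu> a - part \<mu> m) (part \<nu> a - part \<nu> m) (m - a)"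
  have v2: "vpsi \<nu> \<rho> = ?w m * (\<Prod>a\<in>I - {m}. ?e a)"
  proof -
    let ?U = "{a. a < m \<and> a \<notin> I} \<union> (I - {m})"
    have s1: "{b. part \<nu> b \<noteq> part \<rho> b} = {m}" using inI[of m] m(1) by (auto simp: g g_def)
    have "a \<in> ?U \<longleftrightarrow> a < m" for a using m(2)[of a] by auto
    moreover have "part \<nu> a = part \<rho> a" if "a < m" for a using that by (simp add: g g_def)
    ultimately have s2: "{a. a < m \<and> part \<nu> a = part \<rho> a} = ?U" by blast
    have "vpsi \<nu> \<rho> = (\<Prod>a\<in>?U. vf (part \<rho> a - part \<rho> m) (part \<nu> a - part \<nu> m) (m - a))"
      unfolding vpsi_def s1 by (simp add: s2)
    also have "\<dots> = (\<Prod>a\<in>?U. ?e a)"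
      by (rule prod.cong) (auto simp: g g_def)
    also have "\<dots> = (\<Prod>a | a < m \<and> a \<notin> I. ?e a) * (\<Prod>a\<in>I - {m}. ?e a)"
      by (rule prod.union_disjoint) (use finI in auto)
    also have "(\<Prod>a | a < m \<and> a \<notin> I. ?e a) = ?w m"
      by (rule prod.cong) (use inI in auto)
    finally show ?thesis .
  qed
  have \<delta>0: "0 \<le> ?\<delta>" using q_bounds t_bounds by auto
  have "?\<delta> ^ k = (\<Prod>a\<in>I - {m}. ?\<delta>)" using m(1) finI cardI by simp
  also have "\<dots> \<le> (\<Prod>a\<in>I - {m}. ?e a)"
  proof (rule prod_mono, intro conjI \<delta>0 vf_lower_bound)
    fix a assume a: "a \<in> I - {m}"
    then have am: "a < m" using m(2)[of a] by auto
    then show "m - a > 0" by simp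
    show "part \<nu> a - part \<mu> m > 0" using part_antimono[of a m \<mu>] am inI[of a] a by simp
  qed
  finally have "?\<delta> ^ k * vpsi \<nu> \<mu> \<le> (\<Prod>a\<in>I - {m}. ?e a) * vpsi \<nu> \<mu>"
    using vpsi_pos[OF vs] by (intro mult_right_mono) auto
  also have "\<dots> = vpsi \<nu> \<rho> * vpsi \<rho> \<mu>"
    unfolding v0 v1 v2 using m(1) finI by (simp add: prod.remove)
  finally have "?\<delta> ^ k * vpsi \<nu> \<mu> * (bb \<mu> / bb \<nu>) \<le> vpsi \<nu> \<rho> * vpsi \<rho> \<mu> * (bb \<mu> / bb \<nu>)"
    using bb_pos[of \<mu>] bb_pos[of \<nu>] by (intro mult_right_mono) auto
  then have "?\<delta> ^ k * pieri \<nu> \<mu> \<le> pieri \<nu> \<rho> * pieri \<rho> \<mu>"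
    using bb_pos[of \<rho>] by (simp add: pieri_def)
  then show ?thesis using vs1 sz1 box by blast
qed

text \<open>
  By induction on $k$: adding a strip of size $k + 1$ is bounded, up to a constant, by adding a strip
  of size $k$ and then one box, and adding a box in all possible ways does not change a harmonic
  function. That $C$ does not depend on $\mu$ is essential for the convex combination in
  \<open>extreme_imp_hom\<close>.
\<close>

lemma Pieri_dominated:
  "\<exists>C>0. \<forall>f \<mu>. prolongable f \<longrightarrow> (\<forall>\<nu>. f \<nu> \<ge> 0) \<longrightarrow>
    (\<Sum>\<nu> | vstrip \<mu> \<nu> \<and> psize \<nu> = psize \<mu> + k. pieri \<nu> \<mu> * f \<nu>) \<le> C * f \<mu>"
proof (induction k)
  case 0
  have "vstrip \<mu> \<nu> \<and> psize \<nu> = psize \<mu> + 0 \<longleftrightarrow> \<nu> = \<mu>" for \<mu> \<nu>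
    using psize_eq_imp_eq[of \<mu> \<nu>] by (auto simp: vstrip_def)
  then show ?case by (intro exI[of _ 1]) simp
next
  case (Suc k)
  then obtain C where C: "C > 0" and "\<forall>f \<mu>. prolongable f \<longrightarrow> (\<forall>\<nu>. f \<nu> \<ge> 0) \<longrightarrow>
    (\<Sum>\<nu> | vstrip \<mu> \<nu> \<and> psize \<nu> = psize \<mu> + k. pieri \<nu> \<mu> * f \<nu>) \<le> C * f \<mu>"
    by (elim exE conjE) (rule that)
  then have IH: "(\<Sum>\<nu> | vstrip \<mu> \<nu> \<and> psize \<nu> = psize \<mu> + k. pieri \<nu> \<mu> * f \<nu>) \<le> C * f \<mu>"
    if "prolongable f" "\<And>\<nu>. f \<nu> \<ge> 0" for f \<mu> using that by simp
  define \<delta> where "\<delta> = ((1 - \<bar>q\<bar>) * (1 - \<bar>t\<bar>) / 4) ^ k"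
  have \<delta>: "\<delta> > 0" unfolding \<delta>_def using q_bounds t_bounds by (intro zero_less_power) auto
  have "(\<Sum>\<nu> | vstrip \<mu> \<nu> \<and> psize \<nu> = psize \<mu> + Suc k. pieri \<nu> \<mu> * f \<nu>) \<le> C / (\<delta> * c1) * f \<mu>"
    if pr: "prolongable f" and nn: "\<And>\<nu>. f \<nu> \<ge> 0" for f \<mu>
  proof -
    let ?A = "{\<nu>. vstrip \<mu> \<nu> \<and> psize \<nu> = psize \<mu> + Suc k}"
    let ?B = "{\<rho>. vstrip \<mu> \<rho> \<and> psize \<rho> = psize \<mu> + k}"
    have nonneg: "0 \<le> pieri \<nu> \<rho> * pieri \<rho> \<mu> * f \<nu>" if "\<rho> \<in> ?B" "\<rho> \<nearrow> \<nu>" for \<nu> \<rho>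
      using pieri_pos[of \<rho> \<nu>] pieri_pos[of \<mu> \<rho>] nn[of \<nu>] that by (simp add: add_box_iff_vstrip)
    have "\<delta> * (\<Sum>\<nu>\<in>?A. pieri \<nu> \<mu> * f \<nu>) = (\<Sum>\<nu>\<in>?A. \<delta> * pieri \<nu> \<mu> * f \<nu>)" by (simp add: sum_distrib_left mult_ac)
    also have "\<dots> \<le> (\<Sum>\<nu>\<in>?A. \<Sum>\<rho> | \<rho> \<in> ?B \<and> \<rho> \<nearrow> \<nu>. pieri \<nu> \<rho> * pieri \<rho> \<mu> * f \<nu>)"
    proof (rule sum_mono)
      fix \<nu> assume "\<nu> \<in> ?A"
      then obtain \<rho> where \<rho>: "\<rho> \<in> ?B" "\<rho> \<nearrow> \<nu>" "\<delta> * pieri \<nu> \<mu> \<le> pieri \<nu> \<rho> * pieri \<rho> \<mu>"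
        using vstrip_remove_lowest[of \<mu> \<nu> k] by (auto simp: \<delta>_def)
      have "\<delta> * pieri \<nu> \<mu> * f \<nu> \<le> pieri \<nu> \<rho> * pieri \<rho> \<mu> * f \<nu>" using \<rho>(3) nn[of \<nu>] by (intro mult_right_mono) auto
      also have "\<dots> \<le> (\<Sum>\<rho> | \<rho> \<in> ?B \<and> \<rho> \<nearrow> \<nu>. pieri \<nu> \<rho> * pieri \<rho> \<mu> * f \<nu>)"
      proof (rule member_le_sum)
        show "\<rho> \<in> {\<rho>. \<rho> \<in> ?B \<and> \<rho> \<nearrow> \<nu>}" using \<rho> by simp
        show "finite {\<rho>. \<rho> \<in> ?B \<and> \<rho> \<nearrow> \<nu>}" by (rule finite_subset[OF _ finite_vstrip[of \<mu> k]]) auto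
      qed (use nonneg in simp)
      finally show "\<delta> * pieri \<nu> \<mu> * f \<nu> \<le> (\<Sum>\<rho> | \<rho> \<in> ?B \<and> \<rho> \<nearrow> \<nu>. pieri \<nu> \<rho> * pieri \<rho> \<mu> * f \<nu>)" .
    qed
    also have "\<dots> = (\<Sum>\<rho>\<in>?B. \<Sum>\<nu> | \<nu> \<in> ?A \<and> \<rho> \<nearrow> \<nu>. pieri \<nu> \<rho> * pieri \<rho> \<mu> * f \<nu>)"
      by (rule sum.swap_restrict[OF finite_vstrip finite_vstrip])
    also have "\<dots> \<le> (\<Sum>\<rho>\<in>?B. \<Sum>\<nu> | \<rho> \<nearrow> \<nu>. pieri \<nu> \<rho> * pieri \<rho> \<mu> * f \<nu>)"
      by (intro sum_mono sum_mono2 finite_add_box) (use nonneg in auto)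
    also have "\<dots> = (\<Sum>\<rho>\<in>?B. pieri \<rho> \<mu> * (f \<rho> / c1))"
    proof (rule sum.cong[OF refl])
      fix \<rho>
      have "f \<rho> = (\<Sum>\<nu> | \<rho> \<nearrow> \<nu>. psi \<nu> \<rho> * f \<nu>)"
        using pr unfolding prolongable_def by blast
      also have "\<dots> = (\<Sum>\<nu> | \<rho> \<nearrow> \<nu>. c1 * (pieri \<nu> \<rho> * f \<nu>))"
        by (rule sum.cong) (auto simp: mac_psi_add_box)
      also have "\<dots> = c1 * (\<Sum>\<nu> | \<rho> \<nearrow> \<nu>. pieri \<nu> \<rho> * f \<nu>)" by (rule sum_distrib_left[symmetric])
      finally have e: "f \<rho> = c1 * (\<Sum>\<nu> | \<rho> \<nearrow> \<nu>. pieri \<nu> \<rho> * f \<nu>)" .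
      have "f \<rho> / c1 = (\<Sum>\<nu> | \<rho> \<nearrow> \<nu>. pieri \<nu> \<rho> * f \<nu>)"
        unfolding e by (rule nonzero_mult_div_cancel_left[OF less_imp_neq[OF c1_pos, symmetric]])
      then show "(\<Sum>\<nu> | \<rho> \<nearrow> \<nu>. pieri \<nu> \<rho> * pieri \<rho> \<mu> * f \<nu>) = pieri \<rho> \<mu> * (f \<rho> / c1)"
        by (simp only: sum_distrib_left mult_ac)
    qed
    also have "\<dots> = (\<Sum>\<rho>\<in>?B. pieri \<rho> \<mu> * f \<rho>) / c1" by (simp only: sum_divide_distrib times_divide_eq_right)
    also have "\<dots> \<le> C * f \<mu> / c1" using IH[OF pr nn] c1_pos by (intro divide_right_mono) auto
    finally have "\<delta> * (\<Sum>\<nu>\<in>?A. pieri \<nu> \<mu> * f \<nu>) \<le> C * f \<mu> / c1" .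
    then have "(\<Sum>\<nu>\<in>?A. pieri \<nu> \<mu> * f \<nu>) * \<delta> \<le> C * f \<mu> / c1" by (subst mult.commute)
    then have "(\<Sum>\<nu>\<in>?A. pieri \<nu> \<mu> * f \<nu>) \<le> C * f \<mu> / c1 / \<delta>" by (rule mult_imp_le_div_pos[OF \<delta>])
    also have "\<dots> = C / (\<delta> * c1) * f \<mu>" by (simp add: mult_ac)
    finally show ?thesis .
  qed
  moreover have "C / (\<delta> * c1) > 0" by (rule divide_pos_pos[OF C mult_pos_pos[OF \<delta> c1_pos]])
  ultimately show ?case by blast
qed

lemma tilde_elem_mult: "tilde q t f (elem k * Q \<mu>) = (\<Sum>\<nu> | vstrip \<mu> \<nu> \<and> psize \<nu> = psize \<mu> + k. pieri \<nu> \<mu> * f \<nu>)"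
  unfolding Pieri_elem using Lambda_linear_sum[OF tilde_linear, of _ Q] by (simp add: tilde_Q)

lemma Lambda_subset_elem_algebra: "F \<in> Lambda \<Longrightarrow> F \<in> elem_algebra"
  by (induction rule: span_induct_Q) (auto intro: Q_elem_algebra elem_algebra.add elem_algebra.scale)

text \<open>
  The $Q_\mu$ span and the $e_k$ generate, so it suffices to test products of the two kinds.
\<close>

lemma Lambda_hom_if_elem:
  assumes \<theta>: "\<theta> \<in> Lambda_linear" "\<theta> 1 = 1"
    and mult: "\<And>k \<mu>. \<theta> (elem k * Q \<mu>) = \<theta> (elem k) * \<theta> (Q \<mu>)"
  shows "\<theta> \<in> Lambda_hom"
proof -
  note lin = Lambda_linear_add[OF \<theta>(1)] Lambda_linear_scale[OF \<theta>(1)]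
  have elem: "\<theta> (elem k * F) = \<theta> (elem k) * \<theta> F" if "F \<in> Lambda" for k F
    using that
  proof (induction rule: span_induct_Q)
    case (Q \<mu>)
    show ?case by (rule mult)
  next
    case (add F G)
    then show ?case by (simp add: distrib_left lin Lambda_mult)
  next
    case (scale c F)
    then show ?case by (simp add: lin Lambda_mult)
  qed
  have "\<theta> (G * F) = \<theta> G * \<theta> F" if "G \<in> elem_algebra" "F \<in> Lambda" for F G
    using that
  proof (induction arbitrary: F rule: elem_algebra.induct)
    case one
    then show ?case by (simp add: \<theta>)
  next
    case (add G G')
    then show ?case using elem_algebra_Lambda[of G] elem_algebra_Lambda[of G']
      by (simp add: distrib_right lin Lambda_mult)
  next
    case (scale G c)
    then show ?case using elem_algebra_Lambda[of G] by (simp add: lin Lambda_mult)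
  next
    case (mult G k)
    have GL: "G \<in> Lambda" using mult by (simp add: elem_algebra_Lambda)
    have "\<theta> (elem k * G * F) = \<theta> (elem k) * \<theta> (G * F)"
      using elem[of "G * F" k] GL mult by (simp add: mult.assoc Lambda_mult)
    also have "\<dots> = \<theta> (elem k * G) * \<theta> F" using mult elem[OF GL] by simp
    finally show ?case .
  qed
  then show ?thesis using \<theta> by (simp add: Lambda_hom_def Lambda_subset_elem_algebra)
qed

section \<open>Extreme harmonic functions give homomorphisms\<close>

lemma tilde_harmonic_h1:
  assumes "f \<in> harmonic q t" "F \<in> Lambda"
  shows "tilde q t f ((c1 *\<^sub>R h1) * F) = tilde q t f F"
proof -
  have "prolongable (\<lambda>\<mu>. tilde q t f (Q \<mu>))" using assms(1) by (simp add: tilde_Q harmonic_iff)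
  then show ?thesis using functional_h1_iff[OF tilde_linear, of f] assms(2) by blast
qed

text \<open>
  Multiplying by $e_k$ before applying the functional gives a nonnegative function $g$
  that satisfies the harmonicity equation and is at most $C f$. So $f$ lies between the normalisations
  of $f + c g$ and $f - c g$, and extremality makes $g$ proportional to $f$.
\<close>

lemma extreme_imp_hom:
  assumes ext: "f \<in> extreme_harmonic q t"
  shows "tilde q t f \<in> Lambda_hom"
proof (rule Lambda_hom_if_elem[OF tilde_linear])
  have fH: "f \<in> harmonic q t" and extr: "\<And>a b. a \<in> harmonic q t \<Longrightarrow> b \<in> harmonic q t \<Longrightarrow> f \<notin> open_segment a b"
    using ext by (auto simp: extreme_harmonic_def extreme_point_of_def)
  have nn: "f \<nu> \<ge> 0" and f1: "f empty_partition = 1" and pr: "prolongable f" for \<nu>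
    using fH by (auto simp: harmonic_iff)
  let ?\<theta> = "tilde q t f"
  show "?\<theta> 1 = 1" using tilde_Q[of f empty_partition] by (simp add: Q_empty f1)
  fix k \<mu>
  define g where "g \<mu> = ?\<theta> (elem k * Q \<mu>)" for \<mu>
  obtain C where C: "C > 0" and dom0: "\<forall>f \<mu>. prolongable f \<longrightarrow> (\<forall>\<nu>. f \<nu> \<ge> 0) \<longrightarrow>
    (\<Sum>\<nu> | vstrip \<mu> \<nu> \<and> psize \<nu> = psize \<mu> + k. pieri \<nu> \<mu> * f \<nu>) \<le> C * f \<mu>"
    using Pieri_dominated[of k] by (elim exE conjE) (rule that)
  have dom: "g \<nu> \<le> C * f \<nu>" for \<nu> unfolding g_def tilde_elem_mult using dom0 pr nn by simp
  have gnn: "g \<nu> \<ge> 0" for \<nu> unfolding g_def tilde_elem_mult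
    by (intro sum_nonneg mult_nonneg_nonneg nn) (auto intro: less_imp_le[OF pieri_pos])
  have gpr: "prolongable g"
    unfolding prolongable_def
  proof
    fix \<mu>
    have "g \<mu> = ?\<theta> ((c1 *\<^sub>R h1) * (elem k * Q \<mu>))"
      unfolding g_def by (rule tilde_harmonic_h1[OF fH, symmetric]) (intro Lambda_mult; simp)
    also have "(c1 *\<^sub>R h1) * (elem k * Q \<mu>) = elem k * ((c1 *\<^sub>R h1) * Q \<mu>)" by (simp only: mult.left_commute)
    also have "\<dots> = (\<Sum>\<nu> | \<mu> \<nearrow> \<nu>. psi \<nu> \<mu> *\<^sub>R (elem k * Q \<nu>))"
      unfolding Pieri_h1 sum_distrib_left by simp
    also have "?\<theta> \<dots> = (\<Sum>\<nu> | \<mu> \<nearrow> \<nu>. psi \<nu> \<mu> * g \<nu>)"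
      unfolding g_def by (rule Lambda_linear_sum[OF tilde_linear]) (intro Lambda_mult; simp)
    finally show "g \<mu> = (\<Sum>\<nu> | \<mu> \<nearrow> \<nu>. psi \<nu> \<mu> * g \<nu>)" .
  qed
  define a where "a = g empty_partition"
  have a0: "a \<ge> 0" using gnn by (simp add: a_def)
  \<comment> \<open>small enough that \<open>f - c * g\<close> is nonnegative and does not vanish at the empty partition\<close>
  define c where "c = 1 / (2 * C)"
  have c0: "c > 0" using C by (simp add: c_def)
  have "a \<le> C" using dom[of empty_partition] f1 by (simp add: a_def)
  then have ca: "c * a \<le> 1 / 2" using C by (simp add: c_def divide_simps)
  have alg: "(p * x + s * (p * y)) / r = p * ((x + s * y) / r)" for p x y s r :: real
    by (simp add: distrib_left mult.left_commute)
  have prlin: "prolongable (\<lambda>\<mu>. (f \<mu> + s * g \<mu>) / r)" for s r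
    unfolding prolongable_def
  proof
    fix \<mu>
    have "(f \<mu> + s * g \<mu>) / r = ((\<Sum>\<nu> | \<mu> \<nearrow> \<nu>. psi \<nu> \<mu> * f \<nu>)
        + s * (\<Sum>\<nu> | \<mu> \<nearrow> \<nu>. psi \<nu> \<mu> * g \<nu>)) / r"
      using pr gpr unfolding prolongable_def by metis
    also have "\<dots> = (\<Sum>\<nu> | \<mu> \<nearrow> \<nu>. psi \<nu> \<mu> * ((f \<nu> + s * g \<nu>) / r))"
      unfolding sum_distrib_left sum.distrib[symmetric] sum_divide_distrib alg ..
    finally show "(f \<mu> + s * g \<mu>) / r = \<dots>" .
  qed
  define u where "u = (\<lambda>\<mu>. (f \<mu> + c * g \<mu>) / (1 + c * a))"
  define w where "w = (\<lambda>\<mu>. (f \<mu> + (- c) * g \<mu>) / (1 - c * a))"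
  have pos: "1 + c * a > 0" "1 - c * a > 0" using c0 a0 ca by (auto intro: add_pos_nonneg)
  have uH: "u \<in> harmonic q t"
    unfolding harmonic_iff
  proof (intro conjI allI)
    show "u \<nu> \<ge> 0" for \<nu> unfolding u_def using nn[of \<nu>] gnn[of \<nu>] c0 pos by simp
    show "u empty_partition = 1" unfolding u_def using pos by (simp add: f1 a_def)
    show "prolongable u" unfolding u_def by (rule prlin)
  qed
  have wH: "w \<in> harmonic q t"
    unfolding harmonic_iff
  proof (intro conjI allI)
    fix \<nu>
    have "c * g \<nu> \<le> c * (C * f \<nu>)" using dom[of \<nu>] c0 by (intro mult_left_mono) auto
    also have "\<dots> = f \<nu> / 2" using C by (simp add: c_def)
    also have "\<dots> \<le> f \<nu>" using nn[of \<nu>] by simp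
    finally show "w \<nu> \<ge> 0" unfolding w_def using pos by simp
    show "w empty_partition = 1" unfolding w_def using pos by (simp add: f1 a_def)
    show "prolongable w" unfolding w_def by (rule prlin)
  qed
  \<comment> \<open>the weight that undoes the normalisations of \<open>u\<close> and \<open>w\<close>\<close>
  define s where "s = (1 + c * a) / 2"
  have s01: "0 < s" "s < 1" using pos by (simp_all add: s_def)
  have comb: "f = (1 - s) *\<^sub>R w + s *\<^sub>R u"
  proof
    fix \<nu>
    have "1 - s = (1 - c * a) / 2" by (simp add: s_def field_simps)
    moreover have half: "(r / 2) * (x / r) = x / 2" if "r > 0" for r x :: real using that by simp
    ultimately have "(1 - s) * w \<nu> = (f \<nu> + (- c) * g \<nu>) / 2" "s * u \<nu> = (f \<nu> + c * g \<nu>) / 2"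
      unfolding w_def u_def by (simp_all only: half[OF pos(1)] half[OF pos(2)] s_def)
    then show "f \<nu> = ((1 - s) *\<^sub>R w + s *\<^sub>R u) \<nu>" by (simp add: scaleR_fun_def field_simps)
  qed
  have "w = u"
  proof (rule ccontr)
    assume "w \<noteq> u"
    then have "f \<in> open_segment w u" unfolding in_segment using s01 comb by blast
    then show False using extr[OF wH uH] by blast
  qed
  then have "(f \<mu> + c * g \<mu>) / (1 + c * a) = (f \<mu> - c * g \<mu>) / (1 - c * a)"
    unfolding w_def u_def by (auto dest: fun_cong[of _ _ \<mu>])
  then have "(f \<mu> + c * g \<mu>) * (1 - c * a) = (f \<mu> - c * g \<mu>) * (1 + c * a)"
    using pos by (simp add: frac_eq_eq)
  then have "c * g \<mu> = c * (a * f \<mu>)" by (simp add: algebra_simps)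
  then have "g \<mu> = a * f \<mu>" using c0 by simp
  then show "?\<theta> (elem k * Q \<mu>) = ?\<theta> (elem k) * ?\<theta> (Q \<mu>)"
    by (simp add: g_def a_def Q_empty tilde_Q)
qed

section \<open>Compactness of the set of harmonic functions\<close>

lemma ex_remove_box:
  assumes "\<nu> \<noteq> empty_partition"
  shows "\<exists>\<mu>. \<mu> \<nearrow> \<nu>"
proof -
  define m where "m = plen \<nu> - 1"
  have len: "plen \<nu> = Suc m"
  proof (cases "plen \<nu>")
    case 0
    then have "\<nu> = empty_partition" by (intro part_eqI) simp
    then show ?thesis using assms by simp
  qed (simp add: m_def)
  have pos: "part \<nu> m > 0" using part_eq_0_iff[of \<nu> m] len by simp
  define g where "g i = (if i = m then part \<nu> m - 1 else part \<nu> i)" for i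
  have g: "part (of_part g) = g"
  proof (rule part_of_part[of _ "Suc m"])
    show "g (Suc i) \<le> g i" for i
      using part_antimono[of i "Suc i" \<nu>] len by (auto simp: g_def)
  qed (simp add: g_def len)
  have vs: "vstrip (of_part g) \<nu>" by (simp add: vstrip_def g g_def)
  have "{i. part \<nu> i \<noteq> part (of_part g) i} = {m}" using pos by (auto simp: g g_def)
  then have "psize \<nu> = psize (of_part g) + 1" using vstrip_card(2)[OF vs] by simp
  then show ?thesis using vs by (auto simp: add_box_iff_vstrip)
qed

text \<open>
  Remove a box from $\nu$: since all terms are nonnegative, the equation at the smaller
  partition bounds one of them.
\<close>

lemma harmonic_bounded: "\<exists>B. \<forall>f\<in>harmonic q t. f \<nu> \<le> B"
proof (induction "psize \<nu>" arbitrary: \<nu>)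
  case 0
  then have "\<nu> = empty_partition" by (simp add: psize_0_iff)
  then show ?case by (intro exI[of _ 1]) (simp add: harmonic_iff)
next
  case (Suc n)
  then have "\<nu> \<noteq> empty_partition" by auto
  then obtain \<mu> where \<mu>: "\<mu> \<nearrow> \<nu>" using ex_remove_box by blast
  then have "psize \<mu> = n" using Suc.hyps(2) by (simp add: add_box_iff_vstrip)
  then obtain B where B: "\<And>f. f \<in> harmonic q t \<Longrightarrow> f \<mu> \<le> B" using Suc.hyps(1)[of \<mu>] by blast
  let ?p = "psi \<nu> \<mu>"
  have "f \<nu> \<le> B / ?p" if f: "f \<in> harmonic q t" for f
  proof -
    have nn: "\<And>\<rho>. f \<rho> \<ge> 0" using f by (simp add: harmonic_iff)
    have "?p * f \<nu> \<le> (\<Sum>\<rho> | \<mu> \<nearrow> \<rho>. psi \<rho> \<mu> * f \<rho>)"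
    proof (rule member_le_sum)
      show "0 \<le> psi \<rho> \<mu> * f \<rho>" for \<rho>
        using nn[of \<rho>] mac_psi_pos[of \<rho> \<mu>] by simp
    qed (use \<mu> finite_add_box in auto)
    also have "\<dots> = f \<mu>" using f unfolding harmonic_iff prolongable_def by metis
    also have "\<dots> \<le> B" by (rule B[OF f])
    finally show ?thesis using mac_psi_pos[of \<nu> \<mu>] by (simp add: pos_le_divide_eq mult.commute)
  qed
  then show ?case by blast
qed

lemma closed_harmonic: "closed (harmonic q t)"
proof -
  have coord: "continuous_on UNIV (\<lambda>f :: int_partition \<Rightarrow> real. f \<nu>)" for \<nu>
    by (rule continuous_on_product_coordinates)
  have "harmonic q t = (\<Inter>\<nu>. {f. 0 \<le> f \<nu>}) \<inter> {f. f empty_partition = 1} \<inter>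
      (\<Inter>\<mu>. {f. f \<mu> = (\<Sum>\<nu> | \<mu> \<nearrow> \<nu>. psi \<nu> \<mu> * f \<nu>)})"
    by (auto simp: harmonic_def)
  also have "closed \<dots>"
    by (intro closed_Int closed_INT ballI closed_Collect_le closed_Collect_eq continuous_intros coord)
  finally show ?thesis .
qed

lemma compact_harmonic: "compact (harmonic q t)"
proof -
  obtain B where B: "\<And>f \<nu>. f \<in> harmonic q t \<Longrightarrow> f \<nu> \<le> B \<nu>" using harmonic_bounded by metis
  have "compact (PiE UNIV (\<lambda>\<nu>. {0..B \<nu>}))"
    using compactin_PiE[of "\<lambda>_. euclidean :: real topology" UNIV "\<lambda>\<nu>. {0..B \<nu>}"]
    by (simp add: euclidean_product_topology)
  then have "compact (PiE UNIV (\<lambda>\<nu>. {0..B \<nu>}) \<inter> harmonic q t)"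
    using closed_harmonic by (rule compact_Int_closed)
  moreover have "harmonic q t \<subseteq> PiE UNIV (\<lambda>\<nu>. {0..B \<nu>})" using B by (auto simp: harmonic_iff)
  ultimately show ?thesis by (simp only: inf_absorb2)
qed

text \<open>
  A weighted sum of the squares of all coordinates. The weights are chosen from the bounds of the
  coordinates such that the series converges uniformly on the set of harmonic functions.
\<close>

lemma ex_strictly_convex:
  "\<exists>s. continuous_on (harmonic q t) s \<and> (\<forall>y\<in>harmonic q t. \<forall>z\<in>harmonic q t. \<forall>u. y \<noteq> z \<longrightarrow> 0 < u \<longrightarrow> u < 1 \<longrightarrow>
      s ((1 - u) *\<^sub>R y + u *\<^sub>R z) < (1 - u) * s y + u * (s z :: real))"
proof -
  obtain B where B: "\<And>f \<nu>. f \<in> harmonic q t \<Longrightarrow> f \<nu> \<le> B \<nu>" using harmonic_bounded by metis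
  have nn: "f \<in> harmonic q t \<Longrightarrow> 0 \<le> f \<nu>" for f \<nu> by (simp add: harmonic_iff)
  define code :: "int_partition \<Rightarrow> nat" where "code \<nu> = to_nat (parts \<nu>)" for \<nu>
  have inj: "inj code" by (rule injI) (simp add: code_def parts_inject)
  define P where "P n = inv code n" for n
  have P: "P (code \<nu>) = \<nu>" for \<nu> by (simp add: P_def inv_f_f[OF inj])
  \<comment> \<open>adding 1 keeps the denominator positive when the bound is 0\<close>
  define W where "W n = (1 / 2) ^ n / (1 + (B (P n))\<^sup>2)" for n
  have W0: "W n > 0" for n unfolding W_def by (intro divide_pos_pos) (auto simp: add_pos_nonneg)
  have bound: "norm (W n * x\<^sup>2) \<le> (1 / 2) ^ n" if "\<bar>x\<bar> \<le> B (P n)" for n x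
  proof -
    have "x\<^sup>2 \<le> (B (P n))\<^sup>2" using that by (simp add: abs_le_square_iff[symmetric])
    then have "x\<^sup>2 \<le> 1 + (B (P n))\<^sup>2" by simp
    then have "(1 / 2) ^ n * x\<^sup>2 \<le> (1 / 2) ^ n * (1 + (B (P n))\<^sup>2)" by (intro mult_left_mono) auto
    then have "W n * x\<^sup>2 \<le> (1 / 2) ^ n" unfolding W_def by (simp add: divide_le_eq add_pos_nonneg)
    then show ?thesis using W0[of n] by (simp add: abs_mult)
  qed
  have geo: "summable (\<lambda>n. (1 / 2 :: real) ^ n)" by (rule summable_geometric) simp
  have sm: "summable (\<lambda>n. W n * (x n)\<^sup>2)" if "\<And>n. \<bar>x n\<bar> \<le> B (P n)" for x
    by (rule summable_comparison_test'[OF geo, of 0]) (use bound[OF that] in auto)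
  define s where "s f = (\<Sum>n. W n * (f (P n))\<^sup>2)" for f
  have "continuous_on (harmonic q t) s"
    unfolding s_def
  proof (rule uniform_limit_theorem)
    show "uniform_limit (harmonic q t) (\<lambda>n f. \<Sum>i<n. W i * (f (P i))\<^sup>2) (\<lambda>f. \<Sum>n. W n * (f (P n))\<^sup>2) sequentially"
    proof (rule Weierstrass_m_test[OF _ geo])
      fix n and f :: "int_partition \<Rightarrow> real" assume "f \<in> harmonic q t"
      then show "norm (W n * (f (P n))\<^sup>2) \<le> (1 / 2) ^ n"
        using B[of f] nn[of f] by (intro bound) (simp add: abs_of_nonneg)
    qed
    show "\<forall>\<^sub>F n in sequentially. continuous_on (harmonic q t) (\<lambda>f. \<Sum>i<n. W i * (f (P i))\<^sup>2)"
      by (intro always_eventually allI continuous_intros continuous_on_subset[OF continuous_on_product_coordinates]) auto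
  qed simp
  moreover have "s ((1 - u) *\<^sub>R y + u *\<^sub>R z) < (1 - u) * s y + u * s z"
    if y: "y \<in> harmonic q t" and z: "z \<in> harmonic q t" and ne: "y \<noteq> z" and u: "0 < u" "u < 1" for y z u
  proof -
    let ?d = "\<lambda>n. W n * (y (P n) - z (P n))\<^sup>2"
    have sy: "summable (\<lambda>n. W n * (y (P n))\<^sup>2)" using B[OF y] nn[OF y] by (intro sm) (simp add: abs_of_nonneg)
    have sz: "summable (\<lambda>n. W n * (z (P n))\<^sup>2)" using B[OF z] nn[OF z] by (intro sm) (simp add: abs_of_nonneg)
    have sd: "summable ?d"
    proof (rule sm)
      fix n
      show "\<bar>y (P n) - z (P n)\<bar> \<le> B (P n)"
        using B[OF y, of "P n"] B[OF z, of "P n"] nn[OF y, of "P n"] nn[OF z, of "P n"] by linarith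
    qed
    obtain \<nu> where \<nu>: "y \<nu> \<noteq> z \<nu>" using ne by blast
    have "0 < suminf ?d"
    proof (rule suminf_pos2[OF sd])
      show "0 \<le> ?d n" for n using W0[of n] by simp
      show "0 < ?d (code \<nu>)" using W0[of "code \<nu>"] \<nu> by (simp add: P)
    qed
    have "W n * (((1 - u) *\<^sub>R y + u *\<^sub>R z) (P n))\<^sup>2 =
        (1 - u) * (W n * (y (P n))\<^sup>2) + u * (W n * (z (P n))\<^sup>2) - u * (1 - u) * ?d n" for n
      by (simp add: scaleR_fun_def power2_eq_square algebra_simps)
    then have "s ((1 - u) *\<^sub>R y + u *\<^sub>R z) =
        (\<Sum>n. (1 - u) * (W n * (y (P n))\<^sup>2) + u * (W n * (z (P n))\<^sup>2) - u * (1 - u) * ?d n)"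
      unfolding s_def by presburger
    also have "\<dots> = (1 - u) * s y + u * s z - u * (1 - u) * suminf ?d"
      unfolding s_def using sy sz sd
      by (simp add: suminf_diff[symmetric] suminf_add[symmetric] suminf_mult[symmetric] summable_add summable_mult
          del: suminf_mult)
    also have "\<dots> < (1 - u) * s y + u * s z" using \<open>0 < suminf ?d\<close> u by simp
    finally show ?thesis .
  qed
  ultimately show ?thesis by blast
qed

text \<open>
  Bauer's minimum principle. A point that maximises a strictly convex continuous
  function on the compact set of minimisers is extreme: concavity puts the ends of any segment
  through it into the set of minimisers, and then strict convexity contradicts its choice.
\<close>

lemma concave_minimum_principle:
  fixes \<Phi> :: "(int_partition \<Rightarrow> real) \<Rightarrow> real"
  assumes cont: "continuous_on (harmonic q t) \<Phi>"
    and conc: "\<And>y z u. y \<in> harmonic q t \<Longrightarrow> z \<in> harmonic q t \<Longrightarrow> 0 < u \<Longrightarrow> u < 1 \<Longrightarrow>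
      (1 - u) * \<Phi> y + u * \<Phi> z \<le> \<Phi> ((1 - u) *\<^sub>R y + u *\<^sub>R z)"
    and ext: "\<And>f. f \<in> extreme_harmonic q t \<Longrightarrow> \<Phi> f \<ge> 0"
    and g: "g \<in> harmonic q t"
  shows "\<Phi> g \<ge> 0"
proof -
  let ?H = "harmonic q t"
  obtain x0 where x0: "x0 \<in> ?H" "\<And>x. x \<in> ?H \<Longrightarrow> \<Phi> x0 \<le> \<Phi> x"
    using continuous_attains_inf[OF compact_harmonic _ cont] g by blast
  define M where "M = {x \<in> ?H. \<Phi> x = \<Phi> x0}"
  have "compact M"
  proof -
    have "closed (?H \<inter> \<Phi> -` {\<Phi> x0})"
      using cont closed_harmonic by (intro continuous_closed_preimage) auto
    moreover have "M = ?H \<inter> (?H \<inter> \<Phi> -` {\<Phi> x0})" by (auto simp: M_def)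
    ultimately show ?thesis using compact_harmonic by (metis compact_Int_closed)
  qed
  obtain s where s: "continuous_on ?H s" and
    "\<forall>y\<in>?H. \<forall>z\<in>?H. \<forall>u. y \<noteq> z \<longrightarrow> 0 < u \<longrightarrow> u < 1 \<longrightarrow>
      s ((1 - u) *\<^sub>R y + u *\<^sub>R z) < (1 - u) * s y + u * (s z :: real)"
    using ex_strictly_convex by (elim exE conjE) (rule that)
  then have strict: "s ((1 - u) *\<^sub>R y + u *\<^sub>R z) < (1 - u) * s y + u * s z"
    if "y \<in> ?H" "z \<in> ?H" "y \<noteq> z" "0 < u" "u < 1" for y z u using that by simp
  have "continuous_on M s" using s by (rule continuous_on_subset) (auto simp: M_def)
  moreover have "M \<noteq> {}" using x0 by (auto simp: M_def)
  ultimately obtain x where x: "x \<in> M" "\<And>y. y \<in> M \<Longrightarrow> s y \<le> s x"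
    using continuous_attains_sup[OF \<open>compact M\<close>] by blast
  have "x \<notin> open_segment y z" if y: "y \<in> ?H" and z: "z \<in> ?H" for y z
  proof
    assume "x \<in> open_segment y z"
    then obtain u where u: "y \<noteq> z" "0 < u" "u < 1" "x = (1 - u) *\<^sub>R y + u *\<^sub>R z"
      by (auto simp: in_segment)
    let ?m = "\<Phi> x0"
    have "(1 - u) * \<Phi> y + u * \<Phi> z \<le> ?m" using conc[OF y z u(2,3)] x(1) u(4) by (simp add: M_def)
    then have "(1 - u) * (\<Phi> y - ?m) + u * (\<Phi> z - ?m) \<le> 0" by (simp add: algebra_simps)
    moreover have "0 \<le> (1 - u) * (\<Phi> y - ?m)" "0 \<le> u * (\<Phi> z - ?m)" using x0(2)[OF y] x0(2)[OF z] u by simp_all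
    ultimately have "(1 - u) * (\<Phi> y - ?m) = 0" "u * (\<Phi> z - ?m) = 0" by linarith+
    then have "y \<in> M" "z \<in> M" using u y z by (auto simp: M_def)
    then have "(1 - u) * s y + u * s z \<le> (1 - u) * s x + u * s x"
      using x(2) u by (intro add_mono mult_left_mono) auto
    also have "\<dots> = s x" by (simp add: algebra_simps)
    finally show False using strict[OF y z u(1-3)] u(4) by simp
  qed
  then have "x \<in> extreme_harmonic q t" using x(1) by (auto simp: extreme_harmonic_def extreme_point_of_def M_def)
  then have "0 \<le> \<Phi> x0" using ext[of x] x(1) by (simp add: M_def)
  also have "\<dots> \<le> \<Phi> g" by (rule x0(2)[OF g])
  finally show ?thesis .
qed

section \<open>Homomorphisms are extreme\<close>

text \<open>
  Every symmetric function is a finite combination of the $Q_\mu$, so its value under the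
  functional depends on finitely many coordinates of $f$, linearly. This gives affinity and
  continuity at once.
\<close>

lemma tilde_finite_sum:
  assumes "F \<in> Lambda"
  shows "\<exists>P c. finite P \<and> (\<forall>f. tilde q t f F = (\<Sum>\<mu>\<in>P. c \<mu> * f \<mu>))"
proof -
  have "F \<in> span (range Q)" using assms Lambda_eq_span by simp
  then obtain T r where T: "finite T" "T \<subseteq> range Q" "F = (\<Sum>a\<in>T. r a *\<^sub>R a)"
    by (auto simp: real_vector.span_explicit)
  define P where "P = Q -` T"
  have finP: "finite P" unfolding P_def using T(1) inj_Q by (rule finite_vimageI)
  have "T = Q ` P" using T(2) by (auto simp: P_def)
  then have "F = (\<Sum>\<mu>\<in>P. r (Q \<mu>) *\<^sub>R Q \<mu>)"
    using T(3) by (simp add: sum.reindex inj_on_subset[OF inj_Q])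
  then have "\<forall>f. tilde q t f F = (\<Sum>\<mu>\<in>P. r (Q \<mu>) * f \<mu>)"
    using Lambda_linear_sum[OF tilde_linear, of P Q _ "\<lambda>\<mu>. r (Q \<mu>)"] by (simp add: tilde_Q)
  then show ?thesis by (intro exI[of _ P] exI[of _ "\<lambda>\<mu>. r (Q \<mu>)"] conjI finP)
qed

lemma tilde_affine:
  assumes "F \<in> Lambda"
  shows "tilde q t ((1 - u) *\<^sub>R y + u *\<^sub>R z) F = (1 - u) * tilde q t y F + u * tilde q t z F"
proof -
  obtain P c where "\<forall>f. tilde q t f F = (\<Sum>\<mu>\<in>P. c \<mu> * f \<mu>)"
    using tilde_finite_sum[OF assms] by (elim exE conjE) (rule that)
  then show ?thesis
    by (simp add: scaleR_fun_def algebra_simps sum.distrib sum_subtractf sum_distrib_left)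
qed

lemma square_convex:
  fixes u A B :: real
  assumes "0 \<le> u" "u \<le> 1"
  shows "((1 - u) * A + u * B)\<^sup>2 = (1 - u) * A\<^sup>2 + u * B\<^sup>2 - u * (1 - u) * (A - B)\<^sup>2"
  by (simp add: power2_eq_square algebra_simps)

text \<open>
  The difference of the two sides is affine minus the square of affine, hence concave in $g$; at
  extreme points it is 0, since they are multiplicative.
\<close>

lemma harmonic_square_ge:
  assumes F: "F \<in> Lambda" and g: "g \<in> harmonic q t"
  shows "(tilde q t g F)\<^sup>2 \<le> tilde q t g (F * F)"
proof -
  have FF: "F * F \<in> Lambda" using F by (intro Lambda_mult)
  define \<Phi> where "\<Phi> f = tilde q t f (F * F) - (tilde q t f F)\<^sup>2" for f
  obtain P c where "\<forall>f. tilde q t f F = (\<Sum>\<mu>\<in>P. c \<mu> * f \<mu>)"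
    using tilde_finite_sum[OF F] by (elim exE conjE) (rule that)
  then have 1: "tilde q t f F = (\<Sum>\<mu>\<in>P. c \<mu> * f \<mu>)" for f ..
  obtain P' c' where "\<forall>f. tilde q t f (F * F) = (\<Sum>\<mu>\<in>P'. c' \<mu> * f \<mu>)"
    using tilde_finite_sum[OF FF] by (elim exE conjE) (rule that)
  then have 2: "tilde q t f (F * F) = (\<Sum>\<mu>\<in>P'. c' \<mu> * f \<mu>)" for f ..
  have "\<Phi> g \<ge> 0"
  proof (rule concave_minimum_principle[OF _ _ _ g])
    show "continuous_on (harmonic q t) \<Phi>" unfolding \<Phi>_def 1 2
      by (intro continuous_intros continuous_on_subset[OF continuous_on_product_coordinates]) auto
  next
    fix y z and u :: real assume u: "0 < u" "u < 1"
    show "(1 - u) * \<Phi> y + u * \<Phi> z \<le> \<Phi> ((1 - u) *\<^sub>R y + u *\<^sub>R z)"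
      unfolding \<Phi>_def tilde_affine[OF F] tilde_affine[OF FF] using u
      by (subst square_convex) (simp_all add: right_diff_distrib)
  next
    fix f assume "f \<in> extreme_harmonic q t"
    from extreme_imp_hom[OF this] show "\<Phi> f \<ge> 0"
      using F by (simp add: \<Phi>_def Lambda_hom_def power2_eq_square)
  qed
  then show ?thesis by (simp add: \<Phi>_def)
qed

text \<open>
  If $\theta$ is a mixture of the functionals of $a$ and $b$ with weights $1 - u$ and $u$, then the
  inequality for squares and multiplicativity give
  $(1 - u) A^2 + u B^2 \le ((1 - u) A + u B)^2$ for the values $A$, $B$ at each $Q_\mu$, so $A = B$.
\<close>

lemma hom_imp_extreme:
  assumes \<theta>: "\<theta> \<in> Lambda_hom" and norm: "\<theta> (c1 *\<^sub>R h1) = 1" and nonneg: "\<And>\<mu>. \<theta> (Q \<mu>) \<ge> 0"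
  shows "(\<lambda>\<mu>. \<theta> (Q \<mu>)) \<in> extreme_harmonic q t"
proof -
  have lin: "\<theta> \<in> Lambda_linear" and one: "\<theta> 1 = 1"
    and mult: "\<And>F G. F \<in> Lambda \<Longrightarrow> G \<in> Lambda \<Longrightarrow> \<theta> (F * G) = \<theta> F * \<theta> G"
    using \<theta> by (auto simp: Lambda_hom_def)
  define f where "f = (\<lambda>\<mu>. \<theta> (Q \<mu>))"
  have tf: "tilde q t f = \<theta>" by (rule tilde_eqI[OF lin]) (simp add: f_def)
  have hL: "c1 *\<^sub>R h1 \<in> Lambda" by (intro Lambda_scaleR h1_Lambda)
  have "\<theta> ((c1 *\<^sub>R h1) * F) = \<theta> F" if "F \<in> Lambda" for F
    unfolding mult[OF hL that] norm by simp
  then have "prolongable f" unfolding f_def functional_h1_iff[OF lin] by blast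
  then have fH: "f \<in> harmonic q t" using nonneg one by (simp add: harmonic_iff f_def Q_empty)
  have "f \<notin> open_segment a b" if a: "a \<in> harmonic q t" and b: "b \<in> harmonic q t" for a b
  proof
    assume "f \<in> open_segment a b"
    then obtain u where u: "a \<noteq> b" "0 < u" "u < 1" "f = (1 - u) *\<^sub>R a + u *\<^sub>R b" by (auto simp: in_segment)
    have "a \<mu> = b \<mu>" for \<mu>
    proof -
      let ?A = "tilde q t a (Q \<mu>)" and ?B = "tilde q t b (Q \<mu>)"
      have QQ: "Q \<mu> * Q \<mu> \<in> Lambda" by (intro Lambda_mult Q_Lambda)
      have "(1 - u) * ?A\<^sup>2 + u * ?B\<^sup>2 \<le> (1 - u) * tilde q t a (Q \<mu> * Q \<mu>) + u * tilde q t b (Q \<mu> * Q \<mu>)"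
        using harmonic_square_ge[OF Q_Lambda a] harmonic_square_ge[OF Q_Lambda b] u
        by (intro add_mono mult_left_mono) auto
      also have "\<dots> = \<theta> (Q \<mu> * Q \<mu>)" unfolding tf[symmetric] u(4) tilde_affine[OF QQ] ..
      also have "\<dots> = (\<theta> (Q \<mu>))\<^sup>2" by (simp add: mult power2_eq_square)
      also have "\<theta> (Q \<mu>) = (1 - u) * ?A + u * ?B" unfolding tf[symmetric] u(4) tilde_affine[OF Q_Lambda] ..
      also have "((1 - u) * ?A + u * ?B)\<^sup>2 = (1 - u) * ?A\<^sup>2 + u * ?B\<^sup>2 - u * (1 - u) * (?A - ?B)\<^sup>2"
        using u by (intro square_convex) auto
      finally have "u * (1 - u) * (?A - ?B)\<^sup>2 \<le> 0" by simp
      then have "(?A - ?B)\<^sup>2 \<le> 0" using u by (simp add: mult_le_0_iff)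
      then show ?thesis by (simp add: tilde_Q)
    qed
    then show False using u(1) by blast
  qed
  then show ?thesis using fH by (auto simp: extreme_harmonic_def extreme_point_of_def f_def)
qed

end

section \<open>Extreme points and homomorphisms\<close>

theorem proposition1p6:
  fixes q t :: real
  assumes "-1 < q" and "q < 1" and "-1 < t" and "t < 1"
  shows "tilde q t ` extreme_harmonic q t =
    {\<theta> \<in> Lambda_hom. \<theta> (((1 - t) / (1 - q)) *\<^sub>R h1) = 1 \<and> (\<forall>\<mu>. \<theta> (mac_Q q t \<mu>) \<ge> 0)}"
proof -
  interpret macdonald q t by unfold_locales (use assms in auto)
  show ?thesis
  proof (intro equalityI subsetI)
    fix \<theta> assume "\<theta> \<in> tilde q t ` extreme_harmonic q t"
    then obtain f where f: "f \<in> extreme_harmonic q t" "\<theta> = tilde q t f" by blast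
    then have fH: "f \<in> harmonic q t" by (simp add: extreme_harmonic_def extreme_point_of_def)
    have hom: "\<theta> \<in> Lambda_hom" unfolding f(2) by (rule extreme_imp_hom[OF f(1)])
    have "\<theta> (c1 *\<^sub>R h1) = \<theta> 1" unfolding f(2) using tilde_harmonic_h1[OF fH Lambda_one] by simp
    then have "\<theta> (c1 *\<^sub>R h1) = 1" using hom by (simp add: Lambda_hom_def)
    moreover have "\<theta> (Q \<mu>) \<ge> 0" for \<mu> using fH by (simp add: f(2) tilde_Q harmonic_iff)
    ultimately show "\<theta> \<in> {\<theta> \<in> Lambda_hom. \<theta> (c1 *\<^sub>R h1) = 1 \<and> (\<forall>\<mu>. \<theta> (Q \<mu>) \<ge> 0)}" using hom by blast
  next
    fix \<theta> assume "\<theta> \<in> {\<theta> \<in> Lambda_hom. \<theta> (c1 *\<^sub>R h1) = 1 \<and> (\<forall>\<mu>. \<theta> (Q \<mu>) \<ge> 0)}"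
    then have \<theta>: "\<theta> \<in> Lambda_hom" "\<theta> (c1 *\<^sub>R h1) = 1" "\<And>\<mu>. \<theta> (Q \<mu>) \<ge> 0" by auto
    have eq: "tilde q t (\<lambda>\<mu>. \<theta> (Q \<mu>)) = \<theta>"
      by (rule tilde_eqI) (use \<theta>(1) in \<open>simp_all add: Lambda_hom_def\<close>)
    show "\<theta> \<in> tilde q t ` extreme_harmonic q t"
      using imageI[OF hom_imp_extreme[OF \<theta>], of "tilde q t"] unfolding eq .
  qed
qed

end
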